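(* Let $\mu$ be a positive Borel measure on $\mathbb{C}^n$ ($n\ge 1$) such that the monomials $z^\alpha$, $\alpha\in\mathbb{N}^n$, are pairwise orthogonal in $L^2(d\mu)$ and $0<\int|z^\alpha|^2\,d\mu<\infty$ for all $\alpha\in\mathbb{N}^n$. Let $p>0$. Then the canonical solution operator $S\colon A^2_{(0,1)}(d\mu)\to L^2(d\mu)$ to $\bar\partial$ is in the Schatten-$p$-class $\mathcal{S}_p$ if and only if $$\sum_{\gamma\in\Gamma}\left(\sum_{j}\left(\frac{c_{\gamma+e_j}}{c_{\gamma+2e_j}}-\frac{c_\gamma}{c_{\gamma+e_j}}\right)\right)^{\frac p2}<\infty,$$ where, for each $\gamma$, the inner sum runs over all $j\in\{1,\dots,n\}$ with $\gamma+e_j\ge0$.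
   Context: $\mathbb{N}=\{0,1,2,\dots\}$. $A^2(d\mu)$ is the closure in $L^2(d\mu)$ of the linear span of the monomials $z^\alpha$, $\alpha\in\mathbb{N}^n$, and $c_\alpha=\left(\int|z^\alpha|^2\,d\mu\right)^{-1}$ for $\alpha\in\mathbb{N}^n$. $A^2_{(0,1)}(d\mu)$ is the Hilbert space of $(0,1)$-forms $\sum_{j=1}^n f_j\,d\bar z_j$ with $f_j\in A^2(d\mu)$, with norm squared $\sum_j\|f_j\|^2_{L^2(d\mu)}$. Multiindices: $\Gamma$ is the set of $\gamma\in\mathbb{Z}^n$ with all entries $\ge -1$ and at most one entry equal to $-1$. If $\gamma$ has an entry equal to $-1$, put $c_\gamma=0$. $e_j$ is the multiindex with $1$ in position $j$ and $0$ elsewhere; $\gamma+e_j\ge0$ means all entries of $\gamma+e_j$ are nonnegative. Canonical solution operator: $S\omega$ is the solution $f\in L^2(d\mu)$ of $\bar\partial f=\omega$ that is orthogonal to $A^2(d\mu)$. Concretely, since $\bar\partial(\bar z_j z^\alpha)=z^\alpha d\bar z_j$, on the dense subspace of forms with polynomial coefficients (finite linear combinations of the $z^\alpha d\bar z_j$) $S$ is the linear map for which $S(z^\alpha d\bar z_j)$ is the unique element of $\bar z_j z^\alpha+A^2(d\mu)$ orthogonal to $A^2(d\mu)$. A compact operator $T\colon H_1\to H_2$ between Hilbert spaces belongs to the Schatten class $\mathcal{S}_p$ if its sequence of singular values (square roots of the eigenvalues of $T^*T$, with multiplicity) belongs to $\ell^p$. "$S\in\mathcal{S}_p$" means that the densely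 defined map $S$ extends to a (bounded) compact operator $A^2_{(0,1)}(d\mu)\to L^2(d\mu)$ belonging to $\mathcal{S}_p$. *)

theory Defs
  imports "HOL-Analysis.Analysis" "HOL-Library.Function_Algebras"
begin

text \<open>
  A complex Hilbert space is given by a set of representatives, closed under addition (taken from
  the type) and under \<open>scl\<close>, together with a positive semidefinite form \<open>ip\<close>, linear in its first
  argument. Representatives at distance 0 denote the same vector, so equality of vectors is
  \<open>heq\<close>. For \<open>L\<^sup>2\<close> the representatives are functions and \<open>heq\<close> is equality almost everywhere.
\<close>

record 'v hilbert_space =
  vecs :: "'v set"
  scl :: "complex \<Rightarrow> 'v \<Rightarrow> 'v"
  ip :: "'v \<Rightarrow> 'v \<Rightarrow> complex"

definition hnorm :: "'v hilbert_space \<Rightarrow> 'v \<Rightarrow> real" where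
  "hnorm H x = sqrt (Re (ip H x x))"

definition heq :: "('v::ab_group_add) hilbert_space \<Rightarrow> 'v \<Rightarrow> 'v \<Rightarrow> bool" where
  "heq H x y \<longleftrightarrow> hnorm H (x - y) = 0"

definition linear_on :: "'u set \<Rightarrow> ('u::ab_group_add) hilbert_space \<Rightarrow>
    ('v::ab_group_add) hilbert_space \<Rightarrow> ('u \<Rightarrow> 'v) \<Rightarrow> bool" where
  "linear_on D H K T \<longleftrightarrow>
     (\<forall>x\<in>D. T x \<in> vecs K) \<and>
     (\<forall>x\<in>D. \<forall>y\<in>D. heq K (T (x + y)) (T x + T y)) \<and>
     (\<forall>c. \<forall>x\<in>D. heq K (T (scl H c x)) (scl K c (T x)))"

text \<open>Boundedness forces an operator to respect \<open>heq\<close>.\<close>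

definition bounded_op :: "('u::ab_group_add) hilbert_space \<Rightarrow>
    ('v::ab_group_add) hilbert_space \<Rightarrow> ('u \<Rightarrow> 'v) \<Rightarrow> bool" where
  "bounded_op H K T \<longleftrightarrow> linear_on (vecs H) H K T \<and>
     (\<exists>C. \<forall>x\<in>vecs H. hnorm K (T x) \<le> C * hnorm H x)"

definition compact_op :: "('u::ab_group_add) hilbert_space \<Rightarrow>
    ('v::ab_group_add) hilbert_space \<Rightarrow> ('u \<Rightarrow> 'v) \<Rightarrow> bool" where
  "compact_op H K T \<longleftrightarrow> bounded_op H K T \<and>
     (\<forall>X :: nat \<Rightarrow> 'u. \<forall>C. (\<forall>k. X k \<in> vecs H \<and> hnorm H (X k) \<le> C) \<longrightarrow>
        (\<exists>r y. strict_mono r \<and> y \<in> vecs K \<and>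
               (\<lambda>k. hnorm K (T (X (r k)) - y)) \<longlonglongrightarrow> 0))"

definition is_adjoint :: "('u::ab_group_add) hilbert_space \<Rightarrow>
    ('v::ab_group_add) hilbert_space \<Rightarrow> ('u \<Rightarrow> 'v) \<Rightarrow> ('v \<Rightarrow> 'u) \<Rightarrow> bool" where
  "is_adjoint H K T A \<longleftrightarrow> bounded_op K H A \<and>
     (\<forall>x\<in>vecs H. \<forall>y\<in>vecs K. ip K (T x) y = ip H x (A y))"

definition eigenspace :: "('v::ab_group_add) hilbert_space \<Rightarrow> ('v \<Rightarrow> 'v) \<Rightarrow> complex \<Rightarrow> 'v set" where
  "eigenspace H R l = {x \<in> vecs H. heq H (R x) (scl H l x)}"

text \<open>
  Dimension modulo \<open>heq\<close>, via an orthonormal basis. It holds for no \<open>d\<close> if \<open>E\<close> is infinite-dimensional.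
\<close>

definition has_dim :: "('v::ab_group_add) hilbert_space \<Rightarrow> 'v set \<Rightarrow> nat \<Rightarrow> bool" where
  "has_dim H E d \<longleftrightarrow> (\<exists>B. finite B \<and> card B = d \<and> B \<subseteq> E \<and>
     (\<forall>b\<in>B. \<forall>b'\<in>B. ip H b b' = (if b = b' then 1 else 0)) \<and>
     (\<forall>x\<in>E. heq H x (\<Sum>b\<in>B. scl H (ip H x b) b)))"

text \<open>
  \<open>\<sigma>\<close> lists the singular values of \<open>T\<close>, each \<open>s > 0\<close> as often as the dimension of the eigenspace
  of \<open>T\<^sup>*T\<close> for \<open>s\<^sup>2\<close>. The order of the list and the number of zeros in it are left open (so that finite
  lists can be padded); neither affects membership in \<open>\<ell>\<^sup>p\<close>.
\<close>

definition singular_values :: "('u::ab_group_add) hilbert_space \<Rightarrow>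
    ('v::ab_group_add) hilbert_space \<Rightarrow> ('u \<Rightarrow> 'v) \<Rightarrow> (nat \<Rightarrow> real) \<Rightarrow> bool" where
  "singular_values H K T \<sigma> \<longleftrightarrow> (\<forall>k. 0 \<le> \<sigma> k) \<and>
     (\<exists>A. is_adjoint H K T A \<and>
        (\<forall>s>0. finite {k. \<sigma> k = s} \<and>
               has_dim H (eigenspace H (A \<circ> T) (complex_of_real (s\<^sup>2))) (card {k. \<sigma> k = s})))"

definition schatten_class :: "('u::ab_group_add) hilbert_space \<Rightarrow>
    ('v::ab_group_add) hilbert_space \<Rightarrow> real \<Rightarrow> ('u \<Rightarrow> 'v) set" where
  "schatten_class H K p =
     {T. compact_op H K T \<and> (\<exists>\<sigma>. singular_values H K T \<sigma> \<and> summable (\<lambda>k. \<sigma> k powr p))}"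

text \<open>Only the values of \<open>S\<close> on the dense subspace \<open>D\<close> matter.\<close>

definition extends_to_schatten_class :: "'u set \<Rightarrow> ('u::ab_group_add) hilbert_space \<Rightarrow>
    ('v::ab_group_add) hilbert_space \<Rightarrow> real \<Rightarrow> ('u \<Rightarrow> 'v) \<Rightarrow> bool" where
  "extends_to_schatten_class D H K p S \<longleftrightarrow>
     (\<exists>T \<in> schatten_class H K p. \<forall>x\<in>D. heq K (T x) (S x))"

definition L2 :: "'a measure \<Rightarrow> ('a \<Rightarrow> complex) hilbert_space" where
  "L2 M = \<lparr>vecs = {f \<in> borel_measurable M. integrable M (\<lambda>z. (cmod (f z))\<^sup>2)},
           scl = (\<lambda>c f z. c * f z),
           ip = (\<lambda>f g. \<integral>z. f z * cnj (g z) \<partial>M)\<rparr>"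

definition monom_fun :: "nat^'n \<Rightarrow> complex^'n \<Rightarrow> complex" where
  "monom_fun \<alpha> z = (\<Prod>i\<in>UNIV. (z $ i) ^ (\<alpha> $ i))"

definition polynomials :: "(complex^'n \<Rightarrow> complex) set" where
  "polynomials = {(\<lambda>z. \<Sum>\<alpha>\<in>F. a \<alpha> * monom_fun \<alpha> z) | F a. finite F}"

definition A2 :: "(complex^'n) measure \<Rightarrow> (complex^'n \<Rightarrow> complex) set" where
  "A2 M = {f \<in> vecs (L2 M). \<forall>\<epsilon>>0. \<exists>q\<in>polynomials. hnorm (L2 M) (f - q) < \<epsilon>}"

text \<open>The form \<open>\<Sum>j. f\<^sub>j dzbar\<^sub>j\<close> is represented by its tuple of coefficients \<open>\<lambda>j. f\<^sub>j\<close>.\<close>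

type_synonym 'n form01 = "'n \<Rightarrow> complex^'n \<Rightarrow> complex"

definition A2_01 :: "(complex^'n) measure \<Rightarrow> 'n form01 hilbert_space" where
  "A2_01 M = \<lparr>vecs = {\<omega>. \<forall>j. \<omega> j \<in> A2 M},
              scl = (\<lambda>c \<omega> j z. c * \<omega> j z),
              ip = (\<lambda>\<omega> \<eta>. \<Sum>j\<in>UNIV. ip (L2 M) (\<omega> j) (\<eta> j))\<rparr>"

definition polynomial_forms :: "'n::finite form01 set" where
  "polynomial_forms = {\<omega>. \<forall>j. \<omega> j \<in> polynomials}"

definition monom_form :: "nat^'n \<Rightarrow> 'n \<Rightarrow> 'n form01" where
  "monom_form \<alpha> j = (\<lambda>k. if k = j then monom_fun \<alpha> else 0)"

text \<open>
  \<open>S (z\<^sup>\<alpha> dzbar\<^sub>j)\<close> is the element of \<open>zbar\<^sub>j z\<^sup>\<alpha> + A\<^sup>2\<close> orthogonal to \<open>A\<^sup>2\<close>; two such elements are equal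
  almost everywhere, so this determines \<open>S\<close> on \<open>polynomial_forms\<close> up to \<open>heq\<close>.
\<close>

definition canonical_solution_operator ::
    "(complex^'n) measure \<Rightarrow> ('n form01 \<Rightarrow> complex^'n \<Rightarrow> complex) \<Rightarrow> bool" where
  "canonical_solution_operator M S \<longleftrightarrow>
     linear_on polynomial_forms (A2_01 M) (L2 M) S \<and>
     (\<forall>\<alpha> j. S (monom_form \<alpha> j) - (\<lambda>z. cnj (z $ j) * monom_fun \<alpha> z) \<in> A2 M \<and>
            (\<forall>h\<in>A2 M. ip (L2 M) (S (monom_form \<alpha> j)) h = 0))"

text \<open>\<open>c\<^sub>\<gamma>\<close> for \<open>\<gamma> \<in> \<nat>\<^sup>n \<union> \<Gamma>\<close>; it is 0 if \<open>\<gamma>\<close> has an entry \<open>-1\<close>.\<close>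

definition coeff_c :: "(complex^'n) measure \<Rightarrow> int^'n \<Rightarrow> real" where
  "coeff_c M \<gamma> = (if 0 \<le> \<gamma> then 1 / (\<integral>z. (cmod (monom_fun (\<chi> i. nat (\<gamma> $ i)) z))\<^sup>2 \<partial>M) else 0)"

definition Gamma_set :: "(int^'n) set" where
  "Gamma_set = {\<gamma>. (\<forall>i. \<gamma> $ i \<ge> -1) \<and> card {i. \<gamma> $ i = -1} \<le> 1}"

end

theory Submission
  imports Defs "HOL-Library.Diagonal_Subsequence"
begin

text \<open>
  Write \<open>e\<^sub>j\<close> for the unit multiindices. The operator \<open>S\<^sup>*S\<close> is block diagonal with respect to the
  monomial forms: \<open>S (z\<^sup>\<alpha> dzbar\<^sub>j) = zbar\<^sub>j z\<^sup>\<alpha> - (c\<^bsub>\<alpha>-e\<^sub>j\<^esub> / c\<^sub>\<alpha>) z\<^bsup>\<alpha>-e\<^sub>j\<^esup>\<close>, and since the monomials are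
  orthogonal, \<open>S (z\<^sup>\<alpha> dzbar\<^sub>j)\<close> and \<open>S (z\<^sup>\<beta> dzbar\<^sub>k)\<close> are orthogonal unless \<open>\<alpha> - e\<^sub>j = \<beta> - e\<^sub>k\<close>. The common
  value \<open>\<gamma>\<close> of these differences lies in \<open>\<Gamma>\<close>, and the block of \<open>\<gamma>\<close> consists of the forms
  \<open>z\<^bsup>\<gamma>+e\<^sub>j\<^esup> dzbar\<^sub>j\<close> with \<open>\<gamma> + e\<^sub>j \<ge> 0\<close>, so its size is at most \<open>n\<close>. With respect to the normalized forms,
  the matrix of \<open>S\<^sup>*S\<close> on the block is the real symmetric matrix \<open>gram \<gamma>\<close> (\<open>ip_S_unit_form\<close>), whose
  trace is exactly the inner sum of the theorem (\<open>gram_diagonal\<close>).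

  Diagonalizing every block (\<open>symmetric_diagonalizable\<close>) gives a complete orthonormal system of
  \<open>(0,1)\<close>-forms which \<open>S\<close> maps to pairwise orthogonal functions; the squared norms of these
  functions are the eigenvalues \<open>\<mu>\<close> of the blocks. For such a diagonal operator, membership in the
  Schatten class means summability of \<open>\<mu>\<close> to the power \<open>p / 2\<close> (\<open>schatten_class_iff_summable\<close>). A block
  has at most \<open>n\<close> nonnegative eigenvalues, and their sum is the trace. So for \<open>q = p / 2\<close> the sum of their \<open>q\<close>-th
  powers and the \<open>q\<close>-th power of the trace differ at most by a factor depending only on \<open>n\<close> and \<open>q\<close>,
  and summability over all eigenvalues is summability over \<open>\<Gamma>\<close> (\<open>summable_on_trace_powr_iff\<close>).

  The operator theory takes place in the locale \<open>semi_hilbert\<close>, where vectors are compared modulo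
  \<open>heq\<close>. Its analytic input is the completeness of \<open>L\<^sup>2\<close> (\<open>L2_complete\<close>): it provides the limits that
  extend \<open>S\<close> from polynomial forms to the whole space and that compactness asks for.
\<close>

section \<open>Complete spaces with a semidefinite inner product\<close>

lemma mult_cnj_self: "z * cnj z = (complex_of_real (cmod z))\<^sup>2"
  by (metis complex_norm_square of_real_power)

text \<open>
  Addition is that of the type, so \<open>scl_minus_one\<close> has to link it to the scalar multiplication. The other
  vector space laws are consequences modulo \<open>heq\<close>, because a vector is determined up to \<open>heq\<close> by its
  inner products (\<open>heqI\<close> below).
\<close>

locale semi_hilbert =
  fixes H :: "('v::ab_group_add) hilbert_space"
  assumes zero_closed [simp]: "0 \<in> vecs H"
    and add_closed [simp]: "x \<in> vecs H \<Longrightarrow> y \<in> vecs H \<Longrightarrow> x + y \<in> vecs H"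
    and scl_closed [simp]: "x \<in> vecs H \<Longrightarrow> scl H c x \<in> vecs H"
    and scl_minus_one: "scl H (-1) x = - x"
    and ip_add_left: "x \<in> vecs H \<Longrightarrow> y \<in> vecs H \<Longrightarrow> z \<in> vecs H \<Longrightarrow> ip H (x + y) z = ip H x z + ip H y z"
    and ip_scl_left: "x \<in> vecs H \<Longrightarrow> y \<in> vecs H \<Longrightarrow> ip H (scl H c x) y = c * ip H x y"
    and ip_cnj: "x \<in> vecs H \<Longrightarrow> y \<in> vecs H \<Longrightarrow> ip H y x = cnj (ip H x y)"
    and ip_nonneg: "x \<in> vecs H \<Longrightarrow> 0 \<le> Re (ip H x x)"
    and complete: "(\<And>k::nat. X k \<in> vecs H) \<Longrightarrow>
        (\<And>\<epsilon>. \<epsilon> > 0 \<Longrightarrow> \<exists>N. \<forall>m\<ge>N. \<forall>n\<ge>N. hnorm H (X m - X n) < \<epsilon>) \<Longrightarrow>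
        \<exists>y\<in>vecs H. (\<lambda>k. hnorm H (X k - y)) \<longlonglongrightarrow> 0"
begin

lemma minus_closed [simp]: "x \<in> vecs H \<Longrightarrow> - x \<in> vecs H"
  using scl_closed[of x "-1"] by (simp add: scl_minus_one)

lemma diff_closed [simp]: "x \<in> vecs H \<Longrightarrow> y \<in> vecs H \<Longrightarrow> x - y \<in> vecs H"
  using add_closed[of x "- y"] by simp

lemma sum_closed [simp]: "(\<And>i. i \<in> F \<Longrightarrow> f i \<in> vecs H) \<Longrightarrow> sum f F \<in> vecs H"
  by (induction F rule: infinite_finite_induct) auto

lemma ip_minus_left: "x \<in> vecs H \<Longrightarrow> y \<in> vecs H \<Longrightarrow> ip H (- x) y = - ip H x y"
  using ip_scl_left[of x y "-1"] by (simp add: scl_minus_one)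

lemma ip_diff_left: "x \<in> vecs H \<Longrightarrow> y \<in> vecs H \<Longrightarrow> z \<in> vecs H \<Longrightarrow> ip H (x - y) z = ip H x z - ip H y z"
  using ip_add_left[of x "- y" z] by (simp add: ip_minus_left)

lemma ip_zero_left: "x \<in> vecs H \<Longrightarrow> ip H 0 x = 0"
  using ip_add_left[of 0 0 x] by simp

lemma ip_sum_left: "(\<And>i. i \<in> F \<Longrightarrow> f i \<in> vecs H) \<Longrightarrow> z \<in> vecs H \<Longrightarrow> ip H (sum f F) z = (\<Sum>i\<in>F. ip H (f i) z)"
  by (induction F rule: infinite_finite_induct) (auto simp: ip_zero_left ip_add_left)

lemma ip_add_right: "x \<in> vecs H \<Longrightarrow> y \<in> vecs H \<Longrightarrow> z \<in> vecs H \<Longrightarrow> ip H z (x + y) = ip H z x + ip H z y"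
  by (subst (1 2 3) ip_cnj) (auto simp: ip_add_left)

lemma ip_diff_right: "x \<in> vecs H \<Longrightarrow> y \<in> vecs H \<Longrightarrow> z \<in> vecs H \<Longrightarrow> ip H z (x - y) = ip H z x - ip H z y"
  by (subst (1 2 3) ip_cnj) (auto simp: ip_diff_left)

lemma ip_scl_right: "x \<in> vecs H \<Longrightarrow> y \<in> vecs H \<Longrightarrow> ip H y (scl H c x) = cnj c * ip H y x"
  by (subst (1 2) ip_cnj) (auto simp: ip_scl_left)

lemma ip_zero_right: "x \<in> vecs H \<Longrightarrow> ip H x 0 = 0"
  by (subst ip_cnj) (auto simp: ip_zero_left)

lemma ip_sum_right: "(\<And>i. i \<in> F \<Longrightarrow> f i \<in> vecs H) \<Longrightarrow> z \<in> vecs H \<Longrightarrow> ip H z (sum f F) = (\<Sum>i\<in>F. ip H z (f i))"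
  by (induction F rule: infinite_finite_induct) (auto simp: ip_zero_right ip_add_right)

lemma hnorm_nonneg [simp]: "x \<in> vecs H \<Longrightarrow> 0 \<le> hnorm H x"
  by (simp add: hnorm_def ip_nonneg)

lemma hnorm_sq: "x \<in> vecs H \<Longrightarrow> (hnorm H x)\<^sup>2 = Re (ip H x x)"
  by (simp add: hnorm_def ip_nonneg)

lemma ip_self: "x \<in> vecs H \<Longrightarrow> ip H x x = complex_of_real ((hnorm H x)\<^sup>2)"
  using ip_cnj[of x x] by (auto simp: hnorm_sq complex_eq_iff)

lemma hnorm_zero [simp]: "hnorm H 0 = 0"
  by (simp add: hnorm_def ip_zero_left)

lemma hnorm_scl: "x \<in> vecs H \<Longrightarrow> hnorm H (scl H c x) = cmod c * hnorm H x"
proof -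
  assume x: "x \<in> vecs H"
  have "ip H (scl H c x) (scl H c x) = (c * cnj c) * ip H x x"
    using x by (simp add: ip_scl_left ip_scl_right mult.assoc)
  also have "\<dots> = complex_of_real ((cmod c * hnorm H x)\<^sup>2)"
    using x by (simp add: ip_self power_mult_distrib mult_cnj_self)
  finally have "(hnorm H (scl H c x))\<^sup>2 = (cmod c * hnorm H x)\<^sup>2"
    using x by (simp add: hnorm_sq del: of_real_power of_real_mult)
  thus ?thesis using x by simp
qed

lemma hnorm_minus [simp]: "x \<in> vecs H \<Longrightarrow> hnorm H (- x) = hnorm H x"
  using hnorm_scl[of x "-1"] by (simp add: scl_minus_one)

lemma hnorm_diff_commute: "x \<in> vecs H \<Longrightarrow> y \<in> vecs H \<Longrightarrow> hnorm H (x - y) = hnorm H (y - x)"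
  using hnorm_minus[of "x - y"] by simp

lemma hnorm_sq_diff:
  assumes "x \<in> vecs H" "y \<in> vecs H"
  shows "(hnorm H (x - y))\<^sup>2 = (hnorm H x)\<^sup>2 - 2 * Re (ip H x y) + (hnorm H y)\<^sup>2"
  using assms ip_cnj[of x y] by (simp add: hnorm_sq ip_diff_left ip_diff_right)

text \<open>
  Expand \<open>\<parallel>x - t c y\<parallel>\<^sup>2 \<ge> 0\<close> with \<open>c = \<langle>x, y\<rangle>\<close>. If \<open>\<parallel>y\<parallel> \<noteq> 0\<close>, take \<open>t = 1 / \<parallel>y\<parallel>\<^sup>2\<close>. The form is only
  semidefinite, so \<open>\<parallel>y\<parallel> = 0\<close> is possible for a nonzero representative; then a large \<open>t\<close> forces \<open>c = 0\<close>.
\<close>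

lemma Cauchy_Schwarz:
  assumes [simp]: "x \<in> vecs H" "y \<in> vecs H"
  shows "cmod (ip H x y) \<le> hnorm H x * hnorm H y"
proof -
  define c where "c = ip H x y"
  have expand: "0 \<le> (hnorm H x)\<^sup>2 - 2 * t * (cmod c)\<^sup>2 + t\<^sup>2 * (cmod c)\<^sup>2 * (hnorm H y)\<^sup>2" for t
  proof -
    have "ip H x (scl H (of_real t * c) y) = of_real t * (cnj c * c)"
      by (simp add: ip_scl_right c_def)
    also have "\<dots> = of_real (t * (cmod c)\<^sup>2)"
      by (simp add: mult_cnj_self mult.commute[of "cnj c"])
    finally show ?thesis
      using zero_le_power2[of "hnorm H (x - scl H (of_real t * c) y)"]
      by (simp add: hnorm_sq_diff hnorm_scl norm_mult power_mult_distrib mult.assoc)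
  qed
  have "(cmod c)\<^sup>2 \<le> (hnorm H x)\<^sup>2 * (hnorm H y)\<^sup>2"
  proof (cases "hnorm H y = 0")
    case True
    have "c = 0"
    proof (rule ccontr)
      assume "c \<noteq> 0"
      hence "2 * (((hnorm H x)\<^sup>2 + 1) / (cmod c)\<^sup>2) * (cmod c)\<^sup>2 = 2 * ((hnorm H x)\<^sup>2 + 1)"
        by simp
      with expand[of "((hnorm H x)\<^sup>2 + 1) / (cmod c)\<^sup>2"] True
      have "2 * ((hnorm H x)\<^sup>2 + 1) \<le> (hnorm H x)\<^sup>2" by simp
      thus False using zero_le_power2[of "hnorm H x"] by argo
    qed
    thus ?thesis by simp
  next
    case False
    hence "0 < (hnorm H y)\<^sup>2" by simp
    with expand[of "1 / (hnorm H y)\<^sup>2"] show ?thesis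
      by (simp add: divide_simps power2_eq_square split: if_splits)
  qed
  thus ?thesis
    by (metis assms c_def hnorm_nonneg mult_nonneg_nonneg power2_le_imp_le power_mult_distrib)
qed

lemma hnorm_triangle:
  assumes [simp]: "x \<in> vecs H" "y \<in> vecs H"
  shows "hnorm H (x + y) \<le> hnorm H x + hnorm H y"
proof (rule power2_le_imp_le)
  have "(hnorm H (x + y))\<^sup>2 = (hnorm H x)\<^sup>2 + 2 * Re (ip H x y) + (hnorm H y)\<^sup>2"
    using hnorm_sq_diff[of x "- y"] ip_diff_right[of 0 y x] by (simp add: ip_zero_right)
  also have "Re (ip H x y) \<le> hnorm H x * hnorm H y"
    using Cauchy_Schwarz[of x y] complex_Re_le_cmod order_trans by auto
  finally show "(hnorm H (x + y))\<^sup>2 \<le> (hnorm H x + hnorm H y)\<^sup>2"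
    by (simp add: power2_sum)
qed simp

lemma hnorm_diff_triangle:
  "x \<in> vecs H \<Longrightarrow> y \<in> vecs H \<Longrightarrow> z \<in> vecs H \<Longrightarrow> hnorm H (x - z) \<le> hnorm H (x - y) + hnorm H (y - z)"
  using hnorm_triangle[of "x - y" "y - z"] by simp

lemma heq_ip_cong:
  assumes "heq H x y" "x \<in> vecs H" "y \<in> vecs H" "z \<in> vecs H"
  shows "ip H x z = ip H y z" "ip H z x = ip H z y"
proof -
  show *: "ip H x z = ip H y z"
    using assms Cauchy_Schwarz[of "x - y" z] by (simp add: heq_def ip_diff_left)
  show "ip H z x = ip H z y"
    using assms * ip_cnj[of x z] ip_cnj[of y z] by simp
qed

lemma heqI:
  assumes "x \<in> vecs H" "y \<in> vecs H" "\<And>z. z \<in> vecs H \<Longrightarrow> ip H x z = ip H y z"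
  shows "heq H x y"
  using assms(1,2) assms(3)[of "x - y"] by (simp add: heq_def hnorm_def ip_diff_left)

lemma heq_refl [simp]: "heq H x x"
  by (simp add: heq_def)

lemma heq_sym: "heq H x y \<Longrightarrow> x \<in> vecs H \<Longrightarrow> y \<in> vecs H \<Longrightarrow> heq H y x"
  by (simp add: heq_def hnorm_diff_commute)

lemma heq_trans:
  "heq H x y \<Longrightarrow> heq H y z \<Longrightarrow> x \<in> vecs H \<Longrightarrow> y \<in> vecs H \<Longrightarrow> z \<in> vecs H \<Longrightarrow> heq H x z"
  by (intro heqI) (auto simp: heq_ip_cong)

lemma heq_add:
  assumes "heq H x x'" "heq H y y'" and [simp]: "x \<in> vecs H" "x' \<in> vecs H" "y \<in> vecs H" "y' \<in> vecs H"
  shows "heq H (x + y) (x' + y')"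
  using heq_ip_cong(1)[OF assms(1)] heq_ip_cong(1)[OF assms(2)]
  by (intro heqI) (auto simp: ip_add_left)

lemma heq_hnorm:
  assumes "heq H x x'" and [simp]: "x \<in> vecs H" "x' \<in> vecs H"
  shows "hnorm H x = hnorm H x'"
  using assms hnorm_triangle[of "x - x'" x'] hnorm_triangle[of "x' - x" x]
    hnorm_diff_commute[of x x'] by (simp add: heq_def)

lemma tendsto_ip_left:
  assumes X: "\<And>k. X k \<in> vecs H" and [simp]: "y \<in> vecs H" "z \<in> vecs H"
    and lim: "(\<lambda>k. hnorm H (X k - y)) \<longlonglongrightarrow> 0"
  shows "(\<lambda>k. ip H (X k) z) \<longlonglongrightarrow> ip H y z"
proof -
  have "(\<lambda>k. ip H (X k) z - ip H y z) \<longlonglongrightarrow> 0"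
  proof (rule Lim_null_comparison)
    show "\<forall>\<^sub>F k in sequentially. norm (ip H (X k) z - ip H y z) \<le> hnorm H (X k - y) * hnorm H z"
      using Cauchy_Schwarz[of "X _ - y" z] X by (simp add: ip_diff_left)
    show "(\<lambda>k. hnorm H (X k - y) * hnorm H z) \<longlonglongrightarrow> 0"
      using tendsto_mult_left_zero[OF lim] by simp
  qed
  thus ?thesis by (simp add: LIM_zero_iff)
qed

lemma tendsto_hnorm:
  assumes X: "\<And>k. X k \<in> vecs H" and [simp]: "y \<in> vecs H"
    and lim: "(\<lambda>k. hnorm H (X k - y)) \<longlonglongrightarrow> 0"
  shows "(\<lambda>k. hnorm H (X k)) \<longlonglongrightarrow> hnorm H y"
proof -
  have "(\<lambda>k. hnorm H (X k) - hnorm H y) \<longlonglongrightarrow> 0"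
  proof (rule Lim_null_comparison[OF _ lim])
    have "norm (hnorm H (X k) - hnorm H y) \<le> hnorm H (X k - y)" for k
      using X[of k] hnorm_triangle[of "X k - y" y] hnorm_triangle[of "y - X k" "X k"]
        hnorm_diff_commute[of "X k" y] by simp
    thus "\<forall>\<^sub>F k in sequentially. norm (hnorm H (X k) - hnorm H y) \<le> hnorm H (X k - y)"
      by simp
  qed
  thus ?thesis by (simp add: LIM_zero_iff)
qed

section \<open>Orthogonal families\<close>

text \<open>
  The squared norm \<open>\<nu> i\<close> of \<open>f i\<close> may be 0, so that the image of an orthonormal system under an
  operator with a kernel can be such a family.
\<close>

definition orthogonal_family :: "('i \<Rightarrow> 'v) \<Rightarrow> ('i \<Rightarrow> real) \<Rightarrow> bool" where
  "orthogonal_family f \<nu> \<longleftrightarrow> (\<forall>i. f i \<in> vecs H) \<and>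
     (\<forall>i j. ip H (f i) (f j) = (if i = j then complex_of_real (\<nu> i) else 0))"

lemma orthogonal_family_closed: "orthogonal_family f \<nu> \<Longrightarrow> f i \<in> vecs H"
  by (simp add: orthogonal_family_def)

lemma orthogonal_family_ip:
  "orthogonal_family f \<nu> \<Longrightarrow> ip H (f i) (f j) = (if i = j then complex_of_real (\<nu> i) else 0)"
  by (simp add: orthogonal_family_def)

lemma orthogonal_family_nonneg: "orthogonal_family f \<nu> \<Longrightarrow> 0 \<le> \<nu> i"
  using ip_nonneg[of "f i"] by (simp add: orthogonal_family_def)

lemma ip_orthogonal_sum:
  assumes f: "orthogonal_family f \<nu>" and F: "finite F"
  shows "ip H (\<Sum>i\<in>F. scl H (a i) (f i)) (f j) = (if j \<in> F then a j * \<nu> j else 0)"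
proof -
  note [simp] = orthogonal_family_closed[OF f]
  have "ip H (\<Sum>i\<in>F. scl H (a i) (f i)) (f j) = (\<Sum>i\<in>F. if i = j then a j * \<nu> j else 0)"
    by (simp add: ip_sum_left ip_scl_left orthogonal_family_ip[OF f] if_distrib cong: if_cong sum.cong)
  thus ?thesis using F by simp
qed

lemma Pythagoras:
  assumes f: "orthogonal_family f \<nu>" and F: "finite F"
  shows "(hnorm H (\<Sum>i\<in>F. scl H (a i) (f i)))\<^sup>2 = (\<Sum>i\<in>F. (cmod (a i))\<^sup>2 * \<nu> i)"
proof -
  note [simp] = orthogonal_family_closed[OF f]
  have "ip H (\<Sum>i\<in>F. scl H (a i) (f i)) (\<Sum>i\<in>F. scl H (a i) (f i)) = (\<Sum>i\<in>F. cnj (a i) * (a i * \<nu> i))"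
    using F by (subst ip_sum_right) (auto simp: ip_scl_right ip_orthogonal_sum[OF f] intro!: sum.cong)
  also have "\<dots> = complex_of_real (\<Sum>i\<in>F. (cmod (a i))\<^sup>2 * \<nu> i)"
    by (auto simp: complex_norm_square[unfolded of_real_power] intro!: sum.cong)
  finally show ?thesis by (simp add: hnorm_sq del: of_real_sum)
qed

text \<open>
  For the weighted sum \<open>y = \<Sum> \<langle>x, f\<^sub>i\<rangle> f\<^sub>i\<close> the left-hand side is \<open>A = \<langle>x, y\<rangle>\<close>, while \<open>\<parallel>y\<parallel>\<^sup>2 \<le> C A\<close>; now
  Cauchy-Schwarz gives \<open>A\<^sup>2 \<le> \<parallel>x\<parallel>\<^sup>2 C A\<close>.
\<close>

lemma Bessel:
  assumes f: "orthogonal_family f \<nu>" and F: "finite F" and [simp]: "x \<in> vecs H"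
    and C: "\<And>i. i \<in> F \<Longrightarrow> \<nu> i \<le> C" "0 \<le> C"
  shows "(\<Sum>i\<in>F. (cmod (ip H x (f i)))\<^sup>2) \<le> C * (hnorm H x)\<^sup>2"
proof -
  note [simp] = orthogonal_family_closed[OF f]
  define a where "a i = ip H x (f i)" for i
  define y where "y = (\<Sum>i\<in>F. scl H (a i) (f i))"
  define A where "A = (\<Sum>i\<in>F. (cmod (a i))\<^sup>2)"
  have [simp]: "y \<in> vecs H" by (simp add: y_def)
  have A0: "0 \<le> A" by (simp add: A_def sum_nonneg)
  have "ip H x y = complex_of_real A"
    by (simp add: y_def ip_sum_right ip_scl_right A_def mult_cnj_self mult.commute[of "cnj _"] flip: a_def)
  hence "A\<^sup>2 \<le> (hnorm H x * hnorm H y)\<^sup>2"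
    using Cauchy_Schwarz[of x y] A0 by (intro power_mono) auto
  also have "(hnorm H y)\<^sup>2 \<le> C * A"
    unfolding y_def Pythagoras[OF f F] A_def sum_distrib_left
    using C(1) by (intro sum_mono) (simp add: mult.commute[of C] mult_left_mono)
  hence "(hnorm H x * hnorm H y)\<^sup>2 \<le> (hnorm H x)\<^sup>2 * (C * A)"
    by (simp add: power_mult_distrib mult_left_mono)
  finally have "A * A \<le> A * (C * (hnorm H x)\<^sup>2)"
    by (simp add: power2_eq_square ac_simps)
  hence "A \<le> C * (hnorm H x)\<^sup>2"
    using A0 C(2) by (cases "A = 0") (auto simp: mult_le_cancel_left)
  thus ?thesis by (simp add: A_def a_def)
qed

lemma Riesz_Fischer:
  fixes f :: "nat \<Rightarrow> 'v"
  assumes f: "orthogonal_family f \<nu>" and a: "summable (\<lambda>k. (cmod (a k))\<^sup>2 * \<nu> k)"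
  shows "\<exists>y\<in>vecs H. (\<lambda>n. hnorm H ((\<Sum>k<n. scl H (a k) (f k)) - y)) \<longlonglongrightarrow> 0"
proof (rule complete)
  note [simp] = orthogonal_family_closed[OF f]
  define X where "X n = (\<Sum>k<n. scl H (a k) (f k))" for n
  define b where "b k = (cmod (a k))\<^sup>2 * \<nu> k" for k
  have b0: "0 \<le> b k" for k using orthogonal_family_nonneg[OF f] by (simp add: b_def)
  have X [simp]: "X n \<in> vecs H" for n by (simp add: X_def)
  show "(\<Sum>k<n. scl H (a k) (f k)) \<in> vecs H" for n using X by (simp add: X_def)
  fix \<epsilon> :: real assume \<epsilon>: "\<epsilon> > 0"
  obtain N where N: "\<And>m n. m \<ge> N \<Longrightarrow> norm (sum b {m..<n}) < \<epsilon>\<^sup>2"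
    using a[folded b_def] \<epsilon> unfolding summable_Cauchy by (metis zero_less_power)
  have *: "hnorm H (X n - X m) < \<epsilon>" if "N \<le> m" "m \<le> n" for m n
  proof -
    have "X n - X m = (\<Sum>k\<in>{m..<n}. scl H (a k) (f k))"
      using sum_diff_nat_ivl[of 0 m n "\<lambda>k. scl H (a k) (f k)"] that by (simp add: X_def lessThan_atLeast0)
    hence "(hnorm H (X n - X m))\<^sup>2 = sum b {m..<n}"
      by (simp add: Pythagoras[OF f] b_def)
    also have "\<dots> < \<epsilon>\<^sup>2" using N[OF that(1), of n] by simp
    finally show ?thesis using \<epsilon> by (simp add: power2_less_imp_less)
  qed
  show "\<exists>N. \<forall>m\<ge>N. \<forall>n\<ge>N. hnorm H ((\<Sum>k<m. scl H (a k) (f k)) - (\<Sum>k<n. scl H (a k) (f k))) < \<epsilon>"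
    unfolding X_def[symmetric]
    using * hnorm_diff_commute[OF X X] by (metis linorder_le_cases)
qed

text \<open>
  Let \<open>B\<close> be an orthonormal basis of \<open>E\<close> and sum \<open>\<bar>\<langle>e\<^sub>i, b\<rangle>\<bar>\<^sup>2\<close> over all \<open>i \<in> F\<close> and \<open>b \<in> B\<close>. Every \<open>i\<close>
  contributes \<open>\<parallel>e\<^sub>i\<parallel>\<^sup>2 = 1\<close>, and every \<open>b\<close> at most \<open>\<parallel>b\<parallel>\<^sup>2 = 1\<close> by Bessel's inequality.
\<close>

lemma orthonormal_card_le_dim:
  assumes E: "has_dim H E d" "E \<subseteq> vecs H" and F: "finite F" "e ` F \<subseteq> E"
    and ON: "\<And>i j. i \<in> F \<Longrightarrow> j \<in> F \<Longrightarrow> ip H (e i) (e j) = (if i = j then 1 else 0)"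
  shows "card F \<le> d"
proof -
  obtain B where B': "finite B \<and> card B = d \<and> B \<subseteq> E \<and>
      (\<forall>b\<in>B. \<forall>b'\<in>B. ip H b b' = (if b = b' then 1 else 0)) \<and>
      (\<forall>x\<in>E. heq H x (\<Sum>b\<in>B. scl H (ip H x b) b))"
    using E(1) unfolding has_dim_def ..
  note B = B'[THEN conjunct1] B'[THEN conjunct2, THEN conjunct1]
    B'[THEN conjunct2, THEN conjunct2, THEN conjunct1]
    B'[THEN conjunct2, THEN conjunct2, THEN conjunct2, THEN conjunct1, rule_format]
    B'[THEN conjunct2, THEN conjunct2, THEN conjunct2, THEN conjunct2, rule_format]
  have [simp]: "e i \<in> vecs H" if "i \<in> F" for i using E(2) F(2) that by blast
  have [simp]: "b \<in> vecs H" if "b \<in> B" for b using E(2) B(3) that by blast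
  \<comment> \<open>Extending by 0 turns the families on \<open>B\<close> and \<open>F\<close> into orthogonal families on the whole type.\<close>
  define g where "g b = (if b \<in> B then b else 0)" for b
  define e' where "e' i = (if i \<in> F then e i else 0)" for i
  have g: "orthogonal_family g (\<lambda>b. if b \<in> B then 1 else 0)"
    unfolding orthogonal_family_def
  proof (intro conjI allI)
    show "g b \<in> vecs H" for b by (simp add: g_def)
    show "ip H (g b) (g b') = (if b = b' then complex_of_real (if b \<in> B then 1 else 0) else 0)" for b b'
      by (cases "b \<in> B"; cases "b' \<in> B") (auto simp add: g_def B(4) ip_zero_left ip_zero_right)
  qed
  have e': "orthogonal_family e' (\<lambda>i. if i \<in> F then 1 else 0)"
    unfolding orthogonal_family_def
  proof (intro conjI allI)
    show "e' i \<in> vecs H" for i by (simp add: e'_def)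
    show "ip H (e' i) (e' j) = (if i = j then complex_of_real (if i \<in> F then 1 else 0) else 0)" for i j
      by (cases "i \<in> F"; cases "j \<in> F") (auto simp add: e'_def ON ip_zero_left ip_zero_right)
  qed
  have "real (card F) = (\<Sum>i\<in>F. \<Sum>b\<in>B. (cmod (ip H (e i) b))\<^sup>2)"
  proof -
    have "(\<Sum>b\<in>B. (cmod (ip H (e i) b))\<^sup>2) = 1" if i: "i \<in> F" for i
    proof -
      have "1 = (hnorm H (e i))\<^sup>2" using ON[OF i i] i by (simp add: hnorm_sq)
      also have "hnorm H (e i) = hnorm H (\<Sum>b\<in>B. scl H (ip H (e i) b) b)"
        using i F B(5)[of "e i"] by (intro heq_hnorm) auto
      also have "(\<Sum>b\<in>B. scl H (ip H (e i) b) b) = (\<Sum>b\<in>B. scl H (ip H (e i) b) (g b))"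
        by (simp add: g_def)
      also have "(hnorm H \<dots>)\<^sup>2 = (\<Sum>b\<in>B. (cmod (ip H (e i) b))\<^sup>2)"
        by (subst Pythagoras[OF g B(1)]) simp
      finally show ?thesis by simp
    qed
    thus ?thesis by simp
  qed
  also have "\<dots> = (\<Sum>b\<in>B. \<Sum>i\<in>F. (cmod (ip H (e i) b))\<^sup>2)" by (rule sum.swap)
  also have "\<dots> \<le> (\<Sum>b\<in>B. 1)"
  proof (rule sum_mono)
    fix b assume b: "b \<in> B"
    have "(\<Sum>i\<in>F. (cmod (ip H (e i) b))\<^sup>2) = (\<Sum>i\<in>F. (cmod (ip H b (e' i)))\<^sup>2)"
      using b by (intro sum.cong) (auto simp: e'_def ip_cnj[of b])
    also have "\<dots> \<le> 1 * (hnorm H b)\<^sup>2"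
      using b by (intro Bessel[OF e' F(1)]) auto
    also have "\<dots> = 1" using b B(4)[OF b b] by (simp add: hnorm_sq)
    finally show "(\<Sum>i\<in>F. (cmod (ip H (e i) b))\<^sup>2) \<le> 1" .
  qed
  finally show ?thesis using B by simp
qed

end

section \<open>Diagonal operators and the Schatten class\<close>

context semi_hilbert begin

definition total_family :: "('i \<Rightarrow> 'v) \<Rightarrow> bool" where
  "total_family e \<longleftrightarrow> (\<forall>x\<in>vecs H. (\<forall>i. ip H x (e i) = 0) \<longrightarrow> hnorm H x = 0)"

lemma heq_if_same_coefficients:
  assumes "total_family e" "\<And>i. e i \<in> vecs H" "x \<in> vecs H" "y \<in> vecs H"
    and "\<And>i. ip H x (e i) = ip H y (e i)"
  shows "heq H x y"
  using assms unfolding total_family_def heq_def by (auto simp: ip_diff_left)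

lemma has_dim_le:
  assumes d: "has_dim H E d" and d': "has_dim H E d'" and E: "E \<subseteq> vecs H"
  shows "d \<le> d'"
proof -
  obtain B where B: "finite B \<and> card B = d \<and> B \<subseteq> E \<and>
      (\<forall>b\<in>B. \<forall>b'\<in>B. ip H b b' = (if b = b' then 1 else 0)) \<and>
      (\<forall>x\<in>E. heq H x (\<Sum>b\<in>B. scl H (ip H x b) b))"
    using d unfolding has_dim_def ..
  hence "card B \<le> d'"
    by (intro orthonormal_card_le_dim[OF d' E, where e = "\<lambda>x. x"]) auto
  with B show ?thesis by simp
qed

end

locale semi_hilbert_pair = H: semi_hilbert H + K: semi_hilbert K
  for H :: "('u::ab_group_add) hilbert_space" and K :: "('v::ab_group_add) hilbert_space"
begin

lemma bounded_op_closed: "bounded_op H K T \<Longrightarrow> x \<in> vecs H \<Longrightarrow> T x \<in> vecs K"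
  by (simp add: bounded_op_def linear_on_def)

lemma is_adjoint_closed: "is_adjoint H K T A \<Longrightarrow> y \<in> vecs K \<Longrightarrow> A y \<in> vecs H"
  by (simp add: is_adjoint_def bounded_op_def linear_on_def)

lemma ip_adjoint_comp:
  assumes T: "bounded_op H K T" and A: "is_adjoint H K T A" and xy: "x \<in> vecs H" "y \<in> vecs H"
  shows "ip H (A (T x)) y = ip K (T x) (T y)" "ip H x (A (T y)) = ip K (T x) (T y)"
proof -
  note [simp] = bounded_op_closed[OF T] is_adjoint_closed[OF A] xy
  have adj: "ip H u (A v) = ip K (T u) v" if "u \<in> vecs H" "v \<in> vecs K" for u v
    using A that by (simp add: is_adjoint_def)
  show "ip H x (A (T y)) = ip K (T x) (T y)" by (simp add: adj)
  show "ip H (A (T x)) y = ip K (T x) (T y)"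
    using H.ip_cnj[of y "A (T x)"] K.ip_cnj[of "T y" "T x"] by (simp add: adj)
qed

text \<open>
  The coefficient of \<open>A (T e\<^sub>i)\<close> at \<open>e\<^sub>j\<close> is \<open>\<langle>T e\<^sub>i, T e\<^sub>j\<rangle> = \<langle>s\<^sub>i, s\<^sub>j\<rangle>\<close>.
\<close>

lemma adjoint_comp_eigenvector:
  assumes T: "bounded_op H K T" and A: "is_adjoint H K T A"
    and e: "H.orthogonal_family e (\<lambda>_. 1)" "H.total_family e"
    and s: "K.orthogonal_family s \<mu>" and Te: "\<And>i. heq K (T (e i)) (s i)"
  shows "heq H (A (T (e i))) (scl H (of_real (\<mu> i)) (e i))"
proof (rule H.heq_if_same_coefficients[OF e(2)])
  note [simp] = bounded_op_closed[OF T] is_adjoint_closed[OF A]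
    H.orthogonal_family_closed[OF e(1)] K.orthogonal_family_closed[OF s]
  show "e j \<in> vecs H" "A (T (e i)) \<in> vecs H" "scl H (of_real (\<mu> i)) (e i) \<in> vecs H" for j by simp_all
  fix j
  have "ip H (A (T (e i))) (e j) = ip K (T (e i)) (T (e j))"
    by (simp add: ip_adjoint_comp[OF T A])
  also have "\<dots> = ip K (s i) (s j)"
    using K.heq_ip_cong(1)[OF Te[of i], of "T (e j)"] K.heq_ip_cong(2)[OF Te[of j], of "s i"] by simp
  finally show "ip H (A (T (e i))) (e j) = ip H (scl H (of_real (\<mu> i)) (e i)) (e j)"
    by (simp add: K.orthogonal_family_ip[OF s] H.orthogonal_family_ip[OF e(1)] H.ip_scl_left)
qed

text \<open>
  As \<open>A \<circ> T\<close> is symmetric, a vector of the eigenspace for \<open>r\<close> has coefficient 0 at every \<open>e\<^sub>i\<close> with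
  \<open>\<mu>\<^sub>i \<noteq> r\<close>. So the \<open>e\<^sub>i\<close> with \<open>\<mu>\<^sub>i = r\<close> form an orthonormal basis of it.
\<close>

lemma has_dim_eigenspace_iff:
  assumes T: "bounded_op H K T" and A: "is_adjoint H K T A"
    and e: "H.orthogonal_family e (\<lambda>_. 1)" "H.total_family e"
    and s: "K.orthogonal_family s \<mu>" and Te: "\<And>i. heq K (T (e i)) (s i)"
  shows "has_dim H (eigenspace H (A \<circ> T) (of_real r)) d \<longleftrightarrow>
    finite {i. \<mu> i = r} \<and> card {i. \<mu> i = r} = d"
proof -
  note [simp] = bounded_op_closed[OF T] is_adjoint_closed[OF A]
    H.orthogonal_family_closed[OF e(1)] K.orthogonal_family_closed[OF s]
  define E where "E = eigenspace H (A \<circ> T) (of_real r)"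
  define N where "N = {i. \<mu> i = r}"
  note eig = adjoint_comp_eigenvector[OF T A e s Te]
  have E: "E \<subseteq> vecs H" by (auto simp: E_def eigenspace_def)
  have eE: "e i \<in> E" if "i \<in> N" for i
    using eig[of i] that by (simp add: E_def N_def eigenspace_def)
  have ON: "ip H (e i) (e j) = (if i = j then 1 else 0)" for i j
    by (simp add: H.orthogonal_family_ip[OF e(1)])
  have coeff: "ip H x (e i) = 0" if x: "x \<in> E" and i: "i \<notin> N" for x i
  proof -
    have [simp]: "x \<in> vecs H" using x E by auto
    have "r * ip H x (e i) = ip H (scl H (of_real r) x) (e i)" by (simp add: H.ip_scl_left)
    also have "\<dots> = ip H (A (T x)) (e i)"
      using x by (intro H.heq_ip_cong(1)[symmetric]) (auto simp: E_def eigenspace_def)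
    also have "\<dots> = ip H x (A (T (e i)))" by (simp add: ip_adjoint_comp[OF T A])
    also have "\<dots> = ip H x (scl H (of_real (\<mu> i)) (e i))"
      by (intro H.heq_ip_cong(2)[OF eig]) auto
    also have "\<dots> = \<mu> i * ip H x (e i)" by (simp add: H.ip_scl_right)
    finally have "(of_real r - of_real (\<mu> i)) * ip H x (e i) = 0" by (simp add: algebra_simps)
    thus ?thesis using i by (simp add: N_def)
  qed
  have dim: "has_dim H E (card N)" if N: "finite N"
    unfolding has_dim_def
  proof (intro exI conjI ballI)
    have inj: "inj_on e N"
    proof (rule inj_onI)
      fix i j assume "e i = e j"
      thus "i = j" using ON[of i j] ON[of i i] by (simp split: if_splits)
    qed
    show "finite (e ` N)" using N by simp
    show "card (e ` N) = card N" by (rule card_image[OF inj])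
    show "e ` N \<subseteq> E" using eE by auto
    show "ip H b b' = (if b = b' then 1 else 0)" if "b \<in> e ` N" "b' \<in> e ` N" for b b'
      using that ON by auto
    show "heq H x (\<Sum>b\<in>e ` N. scl H (ip H x b) b)" if x: "x \<in> E" for x
    proof (rule H.heq_if_same_coefficients[OF e(2)])
      have [simp]: "x \<in> vecs H" using x E by auto
      have sum: "(\<Sum>b\<in>e ` N. scl H (ip H x b) b) = (\<Sum>i\<in>N. scl H (ip H x (e i)) (e i))"
        using inj by (simp add: sum.reindex)
      show "e i \<in> vecs H" "x \<in> vecs H" "(\<Sum>b\<in>e ` N. scl H (ip H x b) b) \<in> vecs H" for i
        by (auto simp: sum)
      show "ip H x (e i) = ip H (\<Sum>b\<in>e ` N. scl H (ip H x b) b) (e i)" for i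
        using coeff[OF x, of i] by (simp add: sum H.ip_orthogonal_sum[OF e(1) N])
    qed
  qed
  have "finite N \<and> card N = d" if d: "has_dim H E d"
  proof
    show N: "finite N"
    proof (rule ccontr)
      assume "infinite N"
      then obtain F where F: "F \<subseteq> N" "finite F" "card F = Suc d"
        using infinite_arbitrarily_large by blast
      have "card F \<le> d"
        using F eE ON by (intro H.orthonormal_card_le_dim[OF d E, where e = e]) auto
      with F show False by simp
    qed
    show "card N = d"
      using H.has_dim_le[OF d dim[OF N] E] H.has_dim_le[OF dim[OF N] d E] by simp
  qed
  with dim show ?thesis unfolding E_def N_def by blast
qed

text \<open>
  This is \<open>\<Sum>\<^sub>k \<langle>_, f\<^sub>k\<rangle> g\<^sub>k\<close>. If \<open>f\<close> is a complete orthonormal system, it is the operator with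
  \<open>f\<^sub>k \<mapsto> g\<^sub>k\<close>; exchanging \<open>f\<close> and \<open>g\<close> gives its adjoint. The standing hypotheses on \<open>f\<close> and \<open>g\<close> below are
  therefore symmetric.
\<close>

definition series_op :: "(nat \<Rightarrow> 'u) \<Rightarrow> (nat \<Rightarrow> 'v) \<Rightarrow> 'u \<Rightarrow> 'v" where
  "series_op f g x = (SOME y. y \<in> vecs K \<and>
     (\<lambda>n. hnorm K ((\<Sum>k<n. scl K (ip H x (f k)) (g k)) - y)) \<longlonglongrightarrow> 0)"

context
  fixes f :: "nat \<Rightarrow> 'u" and g :: "nat \<Rightarrow> 'v" and \<nu> \<kappa> :: "nat \<Rightarrow> real" and C :: real
  assumes f: "H.orthogonal_family f \<nu>" and g: "K.orthogonal_family g \<kappa>"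
    and \<nu>: "\<And>k. \<nu> k \<le> C" and \<kappa>: "\<And>k. \<kappa> k \<le> C"
begin

lemmas fg_closed = H.orthogonal_family_closed[OF f] K.orthogonal_family_closed[OF g]

lemma norm_bound_nonneg: "0 \<le> C"
  using H.orthogonal_family_nonneg[OF f, of 0] \<nu>[of 0] by linarith

lemma summable_coefficients: "x \<in> vecs H \<Longrightarrow> summable (\<lambda>k. (cmod (ip H x (f k)))\<^sup>2)"
  using H.Bessel[OF f _ _ \<nu> norm_bound_nonneg, of "{..n}" x for n]
  by (intro bounded_imp_summable[where B = "C * (hnorm H x)\<^sup>2"]) auto

lemma suminf_coefficients_le: "x \<in> vecs H \<Longrightarrow> (\<Sum>k. (cmod (ip H x (f k)))\<^sup>2) \<le> C * (hnorm H x)\<^sup>2"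
  by (rule suminf_le_const[OF summable_coefficients]) (auto intro: H.Bessel[OF f _ _ \<nu> norm_bound_nonneg])

lemma summable_weighted_coefficients: "x \<in> vecs H \<Longrightarrow> summable (\<lambda>k. (cmod (ip H x (f k)))\<^sup>2 * \<kappa> k)"
proof (rule summable_comparison_test')
  assume "x \<in> vecs H"
  thus "summable (\<lambda>k. (cmod (ip H x (f k)))\<^sup>2 * C)"
    by (intro summable_mult2 summable_coefficients)
  show "norm ((cmod (ip H x (f k)))\<^sup>2 * \<kappa> k) \<le> (cmod (ip H x (f k)))\<^sup>2 * C" if "k \<ge> 0" for k
    using \<kappa>[of k] K.orthogonal_family_nonneg[OF g, of k] by (simp add: mult_left_mono)
qed

lemma series_op_limit:
  assumes x: "x \<in> vecs H"
  shows "series_op f g x \<in> vecs K"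
    and "(\<lambda>n. hnorm K ((\<Sum>k<n. scl K (ip H x (f k)) (g k)) - series_op f g x)) \<longlonglongrightarrow> 0"
proof -
  have "\<exists>y. y \<in> vecs K \<and> (\<lambda>n. hnorm K ((\<Sum>k<n. scl K (ip H x (f k)) (g k)) - y)) \<longlonglongrightarrow> 0"
    using K.Riesz_Fischer[OF g summable_weighted_coefficients[OF x]] by blast
  from someI_ex[OF this] show "series_op f g x \<in> vecs K"
    "(\<lambda>n. hnorm K ((\<Sum>k<n. scl K (ip H x (f k)) (g k)) - series_op f g x)) \<longlonglongrightarrow> 0"
    by (auto simp: series_op_def)
qed

lemma series_op_ip_sums:
  assumes x: "x \<in> vecs H" and z: "z \<in> vecs K"
  shows "(\<lambda>k. ip H x (f k) * ip K (g k) z) sums ip K (series_op f g x) z"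
proof -
  note [simp] = fg_closed
  have "(\<lambda>n. ip K (\<Sum>k<n. scl K (ip H x (f k)) (g k)) z) \<longlonglongrightarrow> ip K (series_op f g x) z"
    using series_op_limit[OF x] z by (intro K.tendsto_ip_left) auto
  thus ?thesis using z by (simp add: sums_def K.ip_sum_left K.ip_scl_left)
qed

lemma series_op_hnorm_sums:
  assumes x: "x \<in> vecs H"
  shows "(\<lambda>k. (cmod (ip H x (f k)))\<^sup>2 * \<kappa> k) sums (hnorm K (series_op f g x))\<^sup>2"
proof -
  note [simp] = fg_closed
  have "(\<lambda>n. hnorm K (\<Sum>k<n. scl K (ip H x (f k)) (g k))) \<longlonglongrightarrow> hnorm K (series_op f g x)"
    using series_op_limit[OF x] by (intro K.tendsto_hnorm) auto
  from tendsto_power[OF this, of 2] show ?thesis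
    by (simp add: sums_def K.Pythagoras[OF g])
qed

lemma series_op_linear: "linear_on (vecs H) H K (series_op f g)"
  unfolding linear_on_def
proof (intro conjI ballI allI)
  note [simp] = series_op_limit(1) fg_closed
  fix x assume [simp]: "x \<in> vecs H"
  show "series_op f g x \<in> vecs K" by simp
  show "heq K (series_op f g (scl H c x)) (scl K c (series_op f g x))" for c
  proof (rule K.heqI)
    fix z assume [simp]: "z \<in> vecs K"
    have "(\<lambda>k. c * (ip H x (f k) * ip K (g k) z)) sums (c * ip K (series_op f g x) z)"
      by (intro sums_mult series_op_ip_sums) auto
    hence "(\<lambda>k. ip H (scl H c x) (f k) * ip K (g k) z) sums ip K (scl K c (series_op f g x)) z"
      by (simp add: H.ip_scl_left K.ip_scl_left mult.assoc)
    thus "ip K (series_op f g (scl H c x)) z = ip K (scl K c (series_op f g x)) z"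
      by (intro sums_unique2[OF series_op_ip_sums]) auto
  qed auto
  fix y assume [simp]: "y \<in> vecs H"
  show "heq K (series_op f g (x + y)) (series_op f g x + series_op f g y)"
  proof (rule K.heqI)
    fix z assume [simp]: "z \<in> vecs K"
    have "(\<lambda>k. ip H x (f k) * ip K (g k) z + ip H y (f k) * ip K (g k) z) sums
        (ip K (series_op f g x) z + ip K (series_op f g y) z)"
      by (intro sums_add series_op_ip_sums) auto
    hence "(\<lambda>k. ip H (x + y) (f k) * ip K (g k) z) sums ip K (series_op f g x + series_op f g y) z"
      by (simp add: H.ip_add_left K.ip_add_left ring_distribs)
    thus "ip K (series_op f g (x + y)) z = ip K (series_op f g x + series_op f g y) z"
      by (intro sums_unique2[OF series_op_ip_sums]) auto
  qed auto
qed

lemma series_op_bounded: "bounded_op H K (series_op f g)"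
  unfolding bounded_op_def
proof (intro conjI exI[of _ C] ballI series_op_linear)
  fix x assume x: "x \<in> vecs H"
  have "(hnorm K (series_op f g x))\<^sup>2 = (\<Sum>k. (cmod (ip H x (f k)))\<^sup>2 * \<kappa> k)"
    using series_op_hnorm_sums[OF x] by (simp add: sums_iff)
  also have "\<dots> \<le> (\<Sum>k. (cmod (ip H x (f k)))\<^sup>2 * C)"
    using x \<kappa> by (intro suminf_le summable_weighted_coefficients summable_mult2 summable_coefficients)
      (auto simp: mult_left_mono)
  also have "\<dots> = C * (\<Sum>k. (cmod (ip H x (f k)))\<^sup>2)"
    using suminf_mult[OF summable_coefficients[OF x], of C] by (simp add: mult.commute)
  also have "\<dots> \<le> C * (C * (hnorm H x)\<^sup>2)"
    by (intro mult_left_mono suminf_coefficients_le x norm_bound_nonneg)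
  also have "\<dots> = (C * hnorm H x)\<^sup>2" by (simp add: power2_eq_square)
  finally show "hnorm K (series_op f g x) \<le> C * hnorm H x"
    using x norm_bound_nonneg by (meson H.hnorm_nonneg mult_nonneg_nonneg power2_le_imp_le)
qed

lemma hnorm_series_op_diff:
  assumes [simp]: "x \<in> vecs H" "y \<in> vecs H"
  shows "hnorm K (series_op f g x - series_op f g y) = hnorm K (series_op f g (x - y))"
proof (rule K.heq_hnorm)
  note [simp] = series_op_limit(1) fg_closed
  show "heq K (series_op f g x - series_op f g y) (series_op f g (x - y))"
  proof (rule K.heqI)
    fix z assume [simp]: "z \<in> vecs K"
    have "(\<lambda>k. ip H x (f k) * ip K (g k) z - ip H y (f k) * ip K (g k) z) sums
        (ip K (series_op f g x) z - ip K (series_op f g y) z)"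
      by (intro sums_diff series_op_ip_sums) auto
    hence "(\<lambda>k. ip H (x - y) (f k) * ip K (g k) z) sums ip K (series_op f g x - series_op f g y) z"
      by (simp add: H.ip_diff_left K.ip_diff_left ring_distribs)
    thus "ip K (series_op f g x - series_op f g y) z = ip K (series_op f g (x - y)) z"
      by (rule sums_unique2) (auto intro: series_op_ip_sums)
  qed auto
qed (auto intro!: K.diff_closed series_op_limit)

text \<open>
  By a diagonal argument, a bounded sequence has a subsequence along which every single coefficient
  \<open>\<langle>X\<^sub>k, f\<^sub>i\<rangle>\<close> converges. The images of this subsequence are Cauchy: if \<open>\<kappa>\<^sub>i \<le> \<delta>\<close> for \<open>i \<ge> N\<close>, the indices
  \<open>i \<ge> N\<close> contribute at most a constant times \<open>\<delta>\<close> to the squared distances (Bessel), and the finitely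
  many others contribute terms that tend to 0.
\<close>

lemma series_op_compact:
  assumes \<kappa>0: "\<kappa> \<longlonglongrightarrow> 0"
  shows "compact_op H K (series_op f g)"
  unfolding compact_op_def
proof (intro conjI allI impI series_op_bounded)
  note [simp] = fg_closed
  fix X :: "nat \<Rightarrow> 'u" and R assume "\<forall>k. X k \<in> vecs H \<and> hnorm H (X k) \<le> R"
  hence X [simp]: "X k \<in> vecs H" and R: "hnorm H (X k) \<le> R" for k by auto
  define a where "a k i = ip H (X k) (f i)" for k i
  interpret subseqs "\<lambda>i r. convergent (\<lambda>k. a (r k) i)"
  proof
    fix i and r :: "nat \<Rightarrow> nat"
    have "cmod (a k i) \<le> R * hnorm H (f i)" for k
      using H.Cauchy_Schwarz[of "X k" "f i"] R[of k] unfolding a_def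
      by (smt (verit) H.hnorm_nonneg fg_closed(1) mult_right_mono X)
    hence "bounded (range (\<lambda>k. a (r k) i))" by (intro boundedI) auto
    then obtain l r' where "strict_mono r'" "((\<lambda>k. a (r k) i) \<circ> r') \<longlonglongrightarrow> l"
      using bounded_imp_convergent_subsequence by blast
    thus "\<exists>r'. strict_mono r' \<and> convergent (\<lambda>k. a ((r \<circ> r') k) i)"
      by (auto simp: convergent_def o_def)
  qed
  define r where "r = diagseq"
  have "convergent (\<lambda>k. a (r k) i)" for i
  proof -
    have "convergent (\<lambda>k. a ((diagseq \<circ> (+) (Suc i)) k) i)"
      by (rule diagseq_holds) (auto simp: o_def dest: convergent_subseq_convergent)
    hence "convergent (\<lambda>k. a (r (k + Suc i)) i)" by (simp add: r_def o_def add.commute)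
    thus ?thesis by (subst (asm) convergent_ignore_initial_segment)
  qed
  hence a_Cauchy: "Cauchy (\<lambda>k. a (r k) i)" for i by (rule convergent_Cauchy)
  define Y where "Y k = series_op f g (X (r k))" for k
  have [simp]: "Y k \<in> vecs K" for k by (simp add: Y_def series_op_limit)
  have tail_bound: "(hnorm K (Y m - Y n))\<^sup>2 \<le> (\<Sum>i<N. (cmod (a (r m) i - a (r n) i))\<^sup>2 * \<kappa> i) + \<delta> * (C * (2 * R)\<^sup>2)"
    if N: "\<And>i. i \<ge> N \<Longrightarrow> \<kappa> i \<le> \<delta>" and \<delta>: "\<delta> \<ge> 0" for m n N \<delta>
  proof -
    define x where "x = X (r m) - X (r n)"
    have [simp]: "x \<in> vecs H" by (simp add: x_def)
    have xR: "hnorm H x \<le> 2 * R"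
      using H.hnorm_triangle[of "X (r m)" "- X (r n)"] R[of "r m"] R[of "r n"] by (simp add: x_def)
    define w where "w i = (cmod (ip H x (f i)))\<^sup>2" for i
    have w: "w i = (cmod (a (r m) i - a (r n) i))\<^sup>2" for i
      by (simp add: w_def a_def x_def H.ip_diff_left)
    have w0: "0 \<le> w i" for i by (simp add: w_def)
    have sw: "summable w" unfolding w_def by (rule summable_coefficients) simp
    have s1: "summable (\<lambda>i. w i * \<kappa> i)" unfolding w_def by (rule summable_weighted_coefficients) simp
    have "(hnorm K (Y m - Y n))\<^sup>2 = (\<Sum>i. w i * \<kappa> i)"
      using series_op_hnorm_sums[of x] by (simp add: Y_def hnorm_series_op_diff sums_iff w_def x_def)
    also have "\<dots> = (\<Sum>i. w (i + N) * \<kappa> (i + N)) + (\<Sum>i<N. w i * \<kappa> i)"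
      by (rule suminf_split_initial_segment[OF s1])
    also have "(\<Sum>i. w (i + N) * \<kappa> (i + N)) \<le> (\<Sum>i. w (i + N) * \<delta>)"
    proof (rule suminf_le)
      show "w (i + N) * \<kappa> (i + N) \<le> w (i + N) * \<delta>" for i
        using N[of "i + N"] w0 by (intro mult_left_mono) auto
      show "summable (\<lambda>i. w (i + N) * \<kappa> (i + N))" by (rule summable_ignore_initial_segment[OF s1])
      show "summable (\<lambda>i. w (i + N) * \<delta>)"
        using sw by (intro summable_mult2) simp
    qed
    also have "(\<Sum>i. w (i + N) * \<delta>) = \<delta> * (\<Sum>i. w (i + N))"
      using suminf_mult[of "\<lambda>i. w (i + N)" \<delta>] sw by (simp add: mult.commute)
    also have "(\<Sum>i. w (i + N)) \<le> C * (2 * R)\<^sup>2"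
    proof -
      have "(\<Sum>i. w (i + N)) \<le> suminf w"
        using suminf_split_initial_segment[OF sw, of N] sum_nonneg[of "{..<N}" w] w0 by simp
      also have "\<dots> \<le> C * (hnorm H x)\<^sup>2"
        unfolding w_def by (rule suminf_coefficients_le) simp
      also have "\<dots> \<le> C * (2 * R)\<^sup>2"
        using xR norm_bound_nonneg by (intro mult_left_mono power_mono) auto
      finally show ?thesis .
    qed
    finally show ?thesis using \<delta> by (simp add: w mult_left_mono)
  qed
  have "\<exists>y\<in>vecs K. (\<lambda>k. hnorm K (Y k - y)) \<longlonglongrightarrow> 0"
  proof (rule K.complete)
    fix \<epsilon> :: real assume \<epsilon>: "\<epsilon> > 0"
    \<comment> \<open>The constants \<open>\<delta>\<close> and \<open>\<eta>\<close> make each of the two parts of \<open>tail_bound\<close> at most \<open>\<epsilon>\<^sup>2 / 2\<close>; the summands 1 avoid division by 0.\<close>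
    define D where "D = C * (2 * R)\<^sup>2 + 1"
    have D: "D > 0" using norm_bound_nonneg by (simp add: D_def add_nonneg_pos)
    define \<delta> where "\<delta> = \<epsilon>\<^sup>2 / (2 * D)"
    have \<delta>: "\<delta> > 0" using \<epsilon> D by (simp add: \<delta>_def)
    obtain N where N: "\<kappa> i \<le> \<delta>" if "i \<ge> N" for i
      using LIMSEQ_D[OF \<kappa>0 \<delta>] by (force simp: abs_le_iff)
    define q where "q = real N * C + 1"
    define \<eta> where "\<eta> = sqrt (\<epsilon>\<^sup>2 / (2 * q))"
    have NC: "q > 0" using norm_bound_nonneg by (simp add: q_def add_nonneg_pos)
    have \<eta>: "\<eta> > 0" using \<epsilon> NC by (simp add: \<eta>_def)
    have "\<exists>L. \<forall>m\<ge>L. \<forall>n\<ge>L. cmod (a (r m) i - a (r n) i) < \<eta>" for i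
      using CauchyD[OF a_Cauchy \<eta>] by blast
    then obtain L where L: "\<And>i m n. m \<ge> L i \<Longrightarrow> n \<ge> L i \<Longrightarrow> cmod (a (r m) i - a (r n) i) < \<eta>"
      by metis
    define M where "M = (\<Sum>i<N. L i)"
    have LM: "L i \<le> M" if "i < N" for i unfolding M_def using that by (intro member_le_sum) auto
    have "hnorm K (Y m - Y n) < \<epsilon>" if mn: "m \<ge> M" "n \<ge> M" for m n
    proof (rule power2_less_imp_less)
      have "(\<Sum>i<N. (cmod (a (r m) i - a (r n) i))\<^sup>2 * \<kappa> i) \<le> (\<Sum>i<N. \<eta>\<^sup>2 * C)"
      proof (rule sum_mono)
        fix i assume "i \<in> {..<N}"
        hence "cmod (a (r m) i - a (r n) i) \<le> \<eta>" using L[of i m n] LM[of i] mn by force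
        thus "(cmod (a (r m) i - a (r n) i))\<^sup>2 * \<kappa> i \<le> \<eta>\<^sup>2 * C"
          using K.orthogonal_family_nonneg[OF g] \<kappa> by (intro mult_mono power_mono) auto
      qed
      also have "\<dots> = (real N * C) * \<eta>\<^sup>2" by simp
      also have "\<dots> \<le> q * \<eta>\<^sup>2" unfolding q_def by (intro mult_right_mono) auto
      also have "\<dots> = \<epsilon>\<^sup>2 / 2" using NC by (simp add: \<eta>_def)
      finally have 1: "(\<Sum>i<N. (cmod (a (r m) i - a (r n) i))\<^sup>2 * \<kappa> i) \<le> \<epsilon>\<^sup>2 / 2" .
      have "\<delta> * (C * (2 * R)\<^sup>2) < \<delta> * D" using \<delta> by (simp add: D_def)
      also have "\<dots> = \<epsilon>\<^sup>2 / 2" using D by (simp add: \<delta>_def)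
      finally have 2: "\<delta> * (C * (2 * R)\<^sup>2) < \<epsilon>\<^sup>2 / 2" .
      have "(hnorm K (Y m - Y n))\<^sup>2 \<le>
          (\<Sum>i<N. (cmod (a (r m) i - a (r n) i))\<^sup>2 * \<kappa> i) + \<delta> * (C * (2 * R)\<^sup>2)"
        using N \<delta> by (intro tail_bound) auto
      with 1 2 show "(hnorm K (Y m - Y n))\<^sup>2 < \<epsilon>\<^sup>2" by linarith
    qed (use \<epsilon> in simp)
    thus "\<exists>N. \<forall>m\<ge>N. \<forall>n\<ge>N. hnorm K (Y m - Y n) < \<epsilon>" by blast
  qed simp
  thus "\<exists>r y. strict_mono r \<and> y \<in> vecs K \<and> (\<lambda>k. hnorm K (series_op f g (X (r k)) - y)) \<longlonglongrightarrow> 0"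
    using subseq_diagseq unfolding Y_def r_def by blast
qed

end

lemma series_op_adjoint:
  assumes f: "H.orthogonal_family f \<nu>" and g: "K.orthogonal_family g \<kappa>"
    and \<nu>: "\<And>k. \<nu> k \<le> C" and \<kappa>: "\<And>k. \<kappa> k \<le> C"
  shows "is_adjoint H K (series_op f g) (semi_hilbert_pair.series_op K H g f)"
proof -
  interpret KH: semi_hilbert_pair K H ..
  show ?thesis unfolding is_adjoint_def
  proof (intro conjI ballI KH.series_op_bounded[OF g f \<kappa> \<nu>])
    note [simp] = K.orthogonal_family_closed[OF g] H.orthogonal_family_closed[OF f]
      KH.series_op_limit(1)[OF g f \<kappa> \<nu>]
    fix x y assume [simp]: "x \<in> vecs H" "y \<in> vecs K"
    have "(\<lambda>k. cnj (ip K y (g k) * ip H (f k) x)) sums cnj (ip H (KH.series_op g f y) x)"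
      unfolding sums_cnj by (rule KH.series_op_ip_sums[OF g f \<kappa> \<nu>]) auto
    hence "(\<lambda>k. ip H x (f k) * ip K (g k) y) sums ip H x (KH.series_op g f y)"
      by (simp add: mult.commute flip: H.ip_cnj K.ip_cnj)
    thus "ip K (series_op f g x) y = ip H x (KH.series_op g f y)"
      by (intro sums_unique2[OF series_op_ip_sums[OF f g \<nu> \<kappa>]]) auto
  qed
qed

end

text \<open>
  Bijections between the level sets for the same \<open>s > 0\<close> fit together to an injection \<open>b\<close> of the
  support of \<open>\<tau>\<close> with \<open>\<sigma> \<circ> b = \<tau>\<close>.
\<close>

lemma summable_powr_if_equal_multiplicities:
  fixes \<sigma> \<tau> :: "nat \<Rightarrow> real"
  assumes nonneg: "\<And>k. 0 \<le> \<sigma> k" "\<And>k. 0 \<le> \<tau> k"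
    and fin: "\<And>s. s > 0 \<Longrightarrow> finite {k. \<sigma> k = s}" "\<And>s. s > 0 \<Longrightarrow> finite {k. \<tau> k = s}"
    and card: "\<And>s. s > 0 \<Longrightarrow> card {k. \<sigma> k = s} = card {k. \<tau> k = s}"
    and sum: "summable (\<lambda>k. \<sigma> k powr p)"
  shows "summable (\<lambda>k. \<tau> k powr p)"
proof -
  have "\<exists>h. bij_betw h {k. \<tau> k = s} {k. \<sigma> k = s}" if "s > 0" for s
    using finite_same_card_bij[OF fin(2) fin(1)] card that by metis
  then obtain h where h: "\<And>s. s > 0 \<Longrightarrow> bij_betw (h s) {k. \<tau> k = s} {k. \<sigma> k = s}" by metis
  define b where "b k = h (\<tau> k) k" for k
  have \<sigma>b: "\<sigma> (b k) = \<tau> k" if "\<tau> k > 0" for k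
    using bij_betwE[OF h[OF that]] by (auto simp: b_def)
  have "inj_on b {k. \<tau> k > 0}"
  proof (rule inj_onI)
    fix k l assume *: "k \<in> {k. \<tau> k > 0}" "l \<in> {k. \<tau> k > 0}" "b k = b l"
    hence "\<tau> k = \<tau> l" using \<sigma>b[of k] \<sigma>b[of l] by simp
    with * show "k = l"
      using bij_betw_imp_inj_on[OF h[of "\<tau> k"]] by (auto simp: b_def inj_on_def)
  qed
  have "(\<lambda>k. \<sigma> k powr p) summable_on UNIV"
    using sum by (simp add: summable_on_UNIV_nonneg_real_iff)
  hence "(\<lambda>k. \<sigma> k powr p) summable_on b ` {k. \<tau> k > 0}"
    by (rule summable_on_subset_banach) simp
  hence "(\<lambda>k. \<sigma> (b k) powr p) summable_on {k. \<tau> k > 0}"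
    using \<open>inj_on b _\<close> by (simp add: summable_on_reindex o_def)
  hence "(\<lambda>k. \<tau> k powr p) summable_on {k. \<tau> k > 0}"
    by (rule summable_on_cong[THEN iffD1, rotated]) (simp add: \<sigma>b)
  hence "(\<lambda>k. \<tau> k powr p) summable_on UNIV"
    by (rule summable_on_cong_neutral[THEN iffD1, rotated -1])
      (use nonneg(2) in \<open>auto simp: order.order_iff_strict\<close>)
  thus ?thesis by (simp add: summable_on_UNIV_nonneg_real_iff)
qed

context semi_hilbert_pair begin

text \<open>
  If \<open>T\<close> is in the Schatten class, then for \<open>t > 0\<close> the eigenspace of \<open>T\<^sup>*T\<close> for \<open>t\<^sup>2\<close> has dimension
  \<open>card {k. \<mu> k = t\<^sup>2}\<close>, so a list of singular values and \<open>sqrt \<circ> \<mu>\<close> take every positive value equally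
  often. Conversely, summability makes \<open>\<mu>\<close> tend to 0, so that \<open>series_op e s\<close> is compact, and then
  \<open>sqrt \<circ> \<mu>\<close> lists its singular values.
\<close>

theorem schatten_class_iff_summable:
  fixes e :: "nat \<Rightarrow> 'u"
  assumes e: "H.orthogonal_family e (\<lambda>_. 1)" "H.total_family e"
    and s: "K.orthogonal_family s \<mu>" and p: "p > 0"
  shows "(\<exists>T \<in> schatten_class H K p. \<forall>k. heq K (T (e k)) (s k)) \<longleftrightarrow> summable (\<lambda>k. \<mu> k powr (p / 2))"
proof -
  note [simp] = H.orthogonal_family_closed[OF e(1)] K.orthogonal_family_closed[OF s]
  have \<mu>: "0 \<le> \<mu> k" for k by (rule K.orthogonal_family_nonneg[OF s])
  have powr: "\<mu> k powr (p / 2) = sqrt (\<mu> k) powr p" for k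
    using \<mu>[of k] by (simp add: powr_half_sqrt[symmetric] powr_powr)
  have sqrt_level: "{k. sqrt (\<mu> k) = t} = {k. \<mu> k = t\<^sup>2}" if "t > 0" for t
    using \<mu> that by (auto simp: real_sqrt_unique)
  show ?thesis
  proof
    assume "\<exists>T \<in> schatten_class H K p. \<forall>k. heq K (T (e k)) (s k)"
    then obtain T \<sigma> A where T: "compact_op H K T" and Te: "\<And>k. heq K (T (e k)) (s k)"
      and \<sigma>: "\<And>k. 0 \<le> \<sigma> k" "summable (\<lambda>k. \<sigma> k powr p)" and A: "is_adjoint H K T A"
      and dim: "\<And>t. t > 0 \<Longrightarrow> finite {k. \<sigma> k = t} \<and>
          has_dim H (eigenspace H (A \<circ> T) (of_real (t\<^sup>2))) (card {k. \<sigma> k = t})"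
      unfolding schatten_class_def singular_values_def by blast
    have T': "bounded_op H K T" using T by (simp add: compact_op_def)
    have "finite {k. \<mu> k = t\<^sup>2} \<and> card {k. \<mu> k = t\<^sup>2} = card {k. \<sigma> k = t}" if "t > 0" for t
      using dim[OF that] unfolding has_dim_eigenspace_iff[OF T' A e s Te] by blast
    thus "summable (\<lambda>k. \<mu> k powr (p / 2))"
      unfolding powr using \<mu> dim
      by (intro summable_powr_if_equal_multiplicities[OF _ _ _ _ _ \<sigma>(2)] \<sigma>) (auto simp: sqrt_level)
  next
    assume sum: "summable (\<lambda>k. \<mu> k powr (p / 2))"
    have "(\<lambda>k. (\<mu> k powr (p / 2)) powr (2 / p)) \<longlonglongrightarrow> 0"
      using p by (intro tendsto_zero_powrI[OF summable_LIMSEQ_zero[OF sum] tendsto_const]) auto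
    hence \<mu>0: "\<mu> \<longlonglongrightarrow> 0" using p \<mu> by (simp add: powr_powr)
    have "Bseq \<mu>" using \<mu>0 by (intro convergent_imp_Bseq convergentI)
    then obtain C where C: "\<mu> k \<le> C" for k unfolding Bseq_def by (auto simp: abs_le_iff)
    define C' where "C' = max 1 C"
    have e1: "1 \<le> C'" and \<mu>C: "\<mu> k \<le> C'" for k using C[of k] by (auto simp: C'_def)
    define T where "T = series_op e s"
    define A where "A = semi_hilbert_pair.series_op K H s e"
    have T: "compact_op H K T" unfolding T_def
      by (rule series_op_compact[OF e(1) s]) (use e1 \<mu>C \<mu>0 in auto)
    hence T': "bounded_op H K T" by (simp add: compact_op_def)
    have A: "is_adjoint H K T A" unfolding T_def A_def
      by (rule series_op_adjoint[OF e(1) s]) (use e1 \<mu>C in auto)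
    have Te: "heq K (T (e k)) (s k)" for k
    proof (rule K.heqI)
      show "T (e k) \<in> vecs K" using bounded_op_closed[OF T'] by simp
      fix z assume [simp]: "z \<in> vecs K"
      have "(\<lambda>i. ip H (e k) (e i) * ip K (s i) z) sums ip K (T (e k)) z"
        unfolding T_def by (rule series_op_ip_sums[OF e(1) s]) (use e1 \<mu>C in auto)
      moreover have "(\<lambda>i. ip H (e k) (e i) * ip K (s i) z) sums ip K (s k) z"
        using sums_single[of k "\<lambda>i. ip K (s i) z"]
        by (simp add: H.orthogonal_family_ip[OF e(1)] if_distrib[of "\<lambda>u. u * _"] eq_commute[of k] cong: if_cong)
      ultimately show "ip K (T (e k)) z = ip K (s k) z" by (rule sums_unique2)
    qed simp
    have "finite {k. \<mu> k = t}" if t: "t > 0" for t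
    proof -
      obtain N where "\<And>k. k \<ge> N \<Longrightarrow> \<bar>\<mu> k\<bar> < t" using LIMSEQ_D[OF \<mu>0 t] by auto
      hence "{k. \<mu> k = t} \<subseteq> {..<N}" by (force simp: not_less[symmetric])
      thus ?thesis by (rule finite_subset) simp
    qed
    hence "singular_values H K T (\<lambda>k. sqrt (\<mu> k))"
      unfolding singular_values_def using \<mu> A
      by (auto simp: sqrt_level has_dim_eigenspace_iff[OF T' A e s Te] simp del: of_real_power intro!: exI[of _ A])
    hence "T \<in> schatten_class H K p"
      using T sum unfolding schatten_class_def powr by blast
    thus "\<exists>T \<in> schatten_class H K p. \<forall>k. heq K (T (e k)) (s k)" using Te by blast
  qed
qed

end

section \<open>The space of square integrable functions\<close>

lemma L2_simps [simp]:
  "scl (L2 M) c f = (\<lambda>z. c * f z)"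
  "ip (L2 M) f g = (\<integral>z. f z * cnj (g z) \<partial>M)"
  by (simp_all add: L2_def)

lemma L2_closed_iff:
  "f \<in> vecs (L2 M) \<longleftrightarrow> f \<in> borel_measurable M \<and> integrable M (\<lambda>z. (cmod (f z))\<^sup>2)"
  by (simp add: L2_def)

lemma L2_integrable_ip:
  assumes "f \<in> vecs (L2 M)" "g \<in> vecs (L2 M)"
  shows "integrable M (\<lambda>z. f z * cnj (g z))"
proof (rule Bochner_Integration.integrable_bound)
  show "integrable M (\<lambda>z. (cmod (f z))\<^sup>2 + (cmod (g z))\<^sup>2)"
    using assms by (simp add: L2_closed_iff)
  have [measurable]: "f \<in> borel_measurable M" "g \<in> borel_measurable M"
    using assms by (simp_all add: L2_closed_iff)
  show "(\<lambda>z. f z * cnj (g z)) \<in> borel_measurable M"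
    by (intro borel_measurable_times measurable_compose[OF _ borel_measurable_continuous_onI[of cnj]])
      (auto intro: continuous_intros)
  have "cmod (f z) * cmod (g z) \<le> (cmod (f z))\<^sup>2 + (cmod (g z))\<^sup>2" for z
    using sum_squares_bound[of "cmod (f z)" "cmod (g z)"]
      mult_nonneg_nonneg[OF norm_ge_zero[of "f z"] norm_ge_zero[of "g z"]] by linarith
  thus "AE z in M. norm (f z * cnj (g z)) \<le> norm ((cmod (f z))\<^sup>2 + (cmod (g z))\<^sup>2)"
    by (intro always_eventually allI) (simp add: norm_mult)
qed

lemma L2_ip_self: "ip (L2 M) f f = complex_of_real (\<integral>z. (cmod (f z))\<^sup>2 \<partial>M)"
  by (simp add: mult_cnj_self flip: of_real_power)

lemma L2_hnorm_sq: "(hnorm (L2 M) f)\<^sup>2 = (\<integral>z. (cmod (f z))\<^sup>2 \<partial>M)"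
  unfolding hnorm_def L2_ip_self by simp

lemma L2_hnorm_nonneg: "0 \<le> hnorm (L2 M) f"
  unfolding hnorm_def L2_ip_self by simp

lemma L2_nn_integral:
  "f \<in> vecs (L2 M) \<Longrightarrow> (\<integral>\<^sup>+z. ennreal ((cmod (f z))\<^sup>2) \<partial>M) = ennreal ((hnorm (L2 M) f)\<^sup>2)"
  unfolding L2_hnorm_sq by (rule nn_integral_eq_integral) (auto simp: L2_closed_iff)

lemma L2_if_nn_integral_le:
  assumes f [measurable]: "f \<in> borel_measurable M" and c: "0 \<le> c"
    and le: "(\<integral>\<^sup>+z. ennreal ((cmod (f z))\<^sup>2) \<partial>M) \<le> ennreal (c\<^sup>2)"
  shows "f \<in> vecs (L2 M)" "hnorm (L2 M) f \<le> c"
proof -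
  show f2: "f \<in> vecs (L2 M)"
    using le unfolding L2_closed_iff
    by (auto intro!: integrableI_bounded f intro: le_less_trans)
  have "ennreal ((hnorm (L2 M) f)\<^sup>2) \<le> ennreal (c\<^sup>2)"
    using le L2_nn_integral[OF f2] by simp
  hence "(hnorm (L2 M) f)\<^sup>2 \<le> c\<^sup>2" by (simp add: ennreal_le_iff)
  thus "hnorm (L2 M) f \<le> c" using c by (rule power2_le_imp_le)
qed

lemma L2_add_closed:
  assumes "f \<in> vecs (L2 M)" "g \<in> vecs (L2 M)"
  shows "f + g \<in> vecs (L2 M)"
proof -
  have [measurable]: "f \<in> borel_measurable M" "g \<in> borel_measurable M"
    using assms by (simp_all add: L2_closed_iff)
  have "integrable M (\<lambda>z. (cmod (f z + g z))\<^sup>2)"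
  proof (rule Bochner_Integration.integrable_bound)
    show "integrable M (\<lambda>z. 2 * (cmod (f z))\<^sup>2 + 2 * (cmod (g z))\<^sup>2)"
      using assms by (simp add: L2_closed_iff)
    have "(cmod (f z + g z))\<^sup>2 \<le> 2 * (cmod (f z))\<^sup>2 + 2 * (cmod (g z))\<^sup>2" for z
    proof -
      have "(cmod (f z + g z))\<^sup>2 \<le> (cmod (f z) + cmod (g z))\<^sup>2"
        by (intro power_mono norm_triangle_ineq) simp
      also have "\<dots> \<le> 2 * (cmod (f z))\<^sup>2 + 2 * (cmod (g z))\<^sup>2"
        using sum_squares_bound[of "cmod (f z)" "cmod (g z)"] by (simp add: power2_sum)
      finally show ?thesis .
    qed
    thus "AE z in M. norm ((cmod (f z + g z))\<^sup>2) \<le> norm (2 * (cmod (f z))\<^sup>2 + 2 * (cmod (g z))\<^sup>2)"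
      by (intro always_eventually allI) simp
  qed measurable
  thus ?thesis by (simp add: L2_closed_iff plus_fun_def)
qed

lemma L2_scl_closed: "f \<in> vecs (L2 M) \<Longrightarrow> (\<lambda>z. c * f z) \<in> vecs (L2 M)"
  by (auto simp: L2_closed_iff norm_mult power_mult_distrib intro: borel_measurable_times)

lemma L2_diff_closed:
  assumes "f \<in> vecs (L2 M)" "g \<in> vecs (L2 M)"
  shows "f - g \<in> vecs (L2 M)"
  using L2_add_closed[OF assms(1) L2_scl_closed[OF assms(2), of "-1"]]
  by (simp add: plus_fun_def fun_diff_def)

text \<open>
  Choose a subsequence whose steps have norm less than \<open>(1/2)\<^sup>k\<close>. The pointwise step sizes satisfy
  \<open>d\<^sub>k \<le> (1/2)\<^sup>k + 2\<^sup>k d\<^sub>k\<^sup>2\<close>, and the functions \<open>2\<^sup>k d\<^sub>k\<^sup>2\<close> have summable integrals. So the steps are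
  summable almost everywhere, and the subsequence converges there to some \<open>y\<close>. Fatou's lemma,
  applied to the distances from a fixed term of the sequence, turns this into convergence in norm.
\<close>

lemma L2_complete:
  fixes X :: "nat \<Rightarrow> 'a \<Rightarrow> complex"
  assumes X: "\<And>k. X k \<in> vecs (L2 M)"
    and Cauchy: "\<And>\<epsilon>. \<epsilon> > 0 \<Longrightarrow> \<exists>N. \<forall>m\<ge>N. \<forall>n\<ge>N. hnorm (L2 M) (X m - X n) < \<epsilon>"
  shows "\<exists>y\<in>vecs (L2 M). (\<lambda>k. hnorm (L2 M) (X k - y)) \<longlonglongrightarrow> 0"
proof -
  have X_meas [measurable]: "X k \<in> borel_measurable M" for k using X by (simp add: L2_closed_iff)
  have "\<exists>N. \<forall>m\<ge>N. \<forall>n\<ge>N. hnorm (L2 M) (X m - X n) < (1/2)^k" for k :: nat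
    by (intro Cauchy) simp
  then obtain N where N: "\<And>k m n. m \<ge> N k \<Longrightarrow> n \<ge> N k \<Longrightarrow> hnorm (L2 M) (X m - X n) < (1/2)^k"
    by metis
  \<comment> \<open>Summing makes \<open>r j\<close> at least \<open>N k\<close> for all \<open>j \<ge> k\<close>.\<close>
  define r where "r k = (\<Sum>i\<le>k. N i)" for k
  have rN: "r j \<ge> N k" if "j \<ge> k" for j k
    unfolding r_def using that by (intro member_le_sum) auto
  define d where "d k z = cmod (X (r (Suc k)) z - X (r k) z)" for k z
  have [measurable]: "d k \<in> borel_measurable M" for k unfolding d_def by measurable
  have "(\<integral>\<^sup>+z. (\<Sum>k. ennreal (2^k * (d k z)\<^sup>2)) \<partial>M) = (\<Sum>k. \<integral>\<^sup>+z. ennreal (2^k * (d k z)\<^sup>2) \<partial>M)"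
    by (rule nn_integral_suminf) measurable
  also have "\<dots> \<le> (\<Sum>k. ennreal ((1/2)^k))"
  proof (rule suminf_le)
    fix k
    have "(\<integral>\<^sup>+z. ennreal (2^k * (d k z)\<^sup>2) \<partial>M) = ennreal (2^k) * (\<integral>\<^sup>+z. ennreal ((d k z)\<^sup>2) \<partial>M)"
      by (subst nn_integral_cmult[symmetric]) (auto simp: ennreal_mult)
    also have "(\<integral>\<^sup>+z. ennreal ((d k z)\<^sup>2) \<partial>M) = ennreal ((hnorm (L2 M) (X (r (Suc k)) - X (r k)))\<^sup>2)"
      unfolding d_def using L2_nn_integral[OF L2_diff_closed[OF X X], of "r (Suc k)" "r k"]
      by (simp add: fun_diff_def)
    also have "ennreal (2^k) * \<dots> \<le> ennreal (2^k) * ennreal (((1/2)^k)\<^sup>2)"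
      using N[where k=k, OF rN rN, of "Suc k" k] L2_hnorm_nonneg
      by (intro mult_left_mono ennreal_leI power_mono) (auto simp: less_imp_le)
    also have "\<dots> = ennreal ((1/2)^k)"
      by (subst ennreal_mult[symmetric]) (auto simp: power2_eq_square power_mult_distrib[symmetric] mult.assoc[symmetric])
    finally show "(\<integral>\<^sup>+z. ennreal (2^k * (d k z)\<^sup>2) \<partial>M) \<le> ennreal ((1/2)^k)" .
  qed auto
  also have "\<dots> < \<infinity>"
    using summable_geometric[of "1/2::real"] by (subst suminf_ennreal2) auto
  finally have "AE z in M. (\<Sum>k. ennreal (2^k * (d k z)\<^sup>2)) \<noteq> \<infinity>"
    by (intro nn_integral_PInf_AE) auto
  hence conv: "AE z in M. convergent (\<lambda>k. X (r k) z)"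
  proof eventually_elim
    case (elim z)
    have s: "summable (\<lambda>k. 2^k * (d k z)\<^sup>2)"
      using elim by (intro summable_suminf_not_top) auto
    have "summable (\<lambda>k. (1/2)^k + 2^k * (d k z)\<^sup>2)"
      by (intro summable_add s summable_geometric) simp
    moreover have "d k z \<le> (1/2)^k + 2^k * (d k z)\<^sup>2" for k
    proof -
      define t where "t = 2^k * d k z"
      have t0: "0 \<le> t" by (simp add: t_def d_def)
      have "t \<le> 1 + t\<^sup>2" using sum_squares_bound[of 1 t] t0 by simp
      hence "t * (1/2)^k \<le> (1 + t\<^sup>2) * (1/2)^k" by (intro mult_right_mono) auto
      thus ?thesis by (simp add: t_def power2_eq_square field_simps)
    qed
    ultimately have "summable (\<lambda>k. d k z)"
      by (elim summable_comparison_test'[where N = 0]) (simp add: d_def)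
    hence "summable (\<lambda>k. X (r (Suc k)) z - X (r k) z)"
      unfolding d_def by (rule summable_norm_cancel)
    hence "convergent (\<lambda>n. \<Sum>k<n. X (r (Suc k)) z - X (r k) z)"
      by (simp add: summable_iff_convergent)
    hence "convergent (\<lambda>n. X (r n) z - X (r 0) z)"
      by (simp add: sum_lessThan_telescope[of "\<lambda>n. X (r n) z"])
    thus ?case using convergent_add_const_right_iff[of "\<lambda>n. X (r n) z" "- X (r 0) z"] by simp
  qed
  define y where "y z = lim (\<lambda>k. X (r k) z)" for z
  have y_meas [measurable]: "y \<in> borel_measurable M"
    unfolding y_def by (rule borel_measurable_lim_metric) measurable
  have bound: "X m - y \<in> vecs (L2 M)" "hnorm (L2 M) (X m - y) \<le> (1/2)^k" if m: "m \<ge> N k" for m k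
  proof -
    have "(\<integral>\<^sup>+z. ennreal ((cmod ((X m - y) z))\<^sup>2) \<partial>M)
        = (\<integral>\<^sup>+z. liminf (\<lambda>j. ennreal ((cmod (X m z - X (r j) z))\<^sup>2)) \<partial>M)"
    proof (rule nn_integral_cong_AE)
      show "AE z in M. ennreal ((cmod ((X m - y) z))\<^sup>2)
          = liminf (\<lambda>j. ennreal ((cmod (X m z - X (r j) z))\<^sup>2))"
        using conv
      proof eventually_elim
        case (elim z)
        hence "(\<lambda>j. X (r j) z) \<longlonglongrightarrow> y z" by (simp add: convergent_LIMSEQ_iff y_def)
        hence "(\<lambda>j. ennreal ((cmod (X m z - X (r j) z))\<^sup>2)) \<longlonglongrightarrow> ennreal ((cmod (X m z - y z))\<^sup>2)"
          by (intro tendsto_intros)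
        hence "liminf (\<lambda>j. ennreal ((cmod (X m z - X (r j) z))\<^sup>2)) = ennreal ((cmod (X m z - y z))\<^sup>2)"
          by (intro lim_imp_Liminf) auto
        thus ?case by simp
      qed
    qed
    also have "\<dots> \<le> liminf (\<lambda>j. \<integral>\<^sup>+z. ennreal ((cmod (X m z - X (r j) z))\<^sup>2) \<partial>M)"
      by (rule nn_integral_liminf) measurable
    also have "\<dots> \<le> ennreal (((1/2)^k)\<^sup>2)"
    proof (rule Liminf_le)
      show "\<forall>\<^sub>F j in sequentially. (\<integral>\<^sup>+z. ennreal ((cmod (X m z - X (r j) z))\<^sup>2) \<partial>M) \<le> ennreal (((1/2)^k)\<^sup>2)"
      proof (rule eventually_sequentiallyI)
        fix j assume "j \<ge> k"
        hence "hnorm (L2 M) (X m - X (r j)) \<le> (1/2)^k"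
          using N[OF m rN] by (simp add: less_imp_le)
        hence "(hnorm (L2 M) (X m - X (r j)))\<^sup>2 \<le> ((1/2)^k)\<^sup>2"
          by (rule power_mono[OF _ L2_hnorm_nonneg])
        thus "(\<integral>\<^sup>+z. ennreal ((cmod (X m z - X (r j) z))\<^sup>2) \<partial>M) \<le> ennreal (((1/2)^k)\<^sup>2)"
          using L2_nn_integral[OF L2_diff_closed[OF X[of m] X[of "r j"]]]
          by (simp add: fun_diff_def ennreal_leI)
      qed
    qed simp
    finally have *: "(\<integral>\<^sup>+z. ennreal ((cmod ((X m - y) z))\<^sup>2) \<partial>M) \<le> ennreal (((1/2)^k)\<^sup>2)" .
    have meas: "X m - y \<in> borel_measurable M" unfolding fun_diff_def by measurable
    show "X m - y \<in> vecs (L2 M)" "hnorm (L2 M) (X m - y) \<le> (1/2)^k"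
      by (rule L2_if_nn_integral_le[OF meas _ *]; simp)+
  qed
  have "X (N 0) - (X (N 0) - y) \<in> vecs (L2 M)"
    using bound(1)[of 0 "N 0"] by (rule L2_diff_closed[OF X]) simp
  moreover have "X (N 0) - (X (N 0) - y) = y" by (rule diff_diff_eq2[THEN trans]) simp
  ultimately have "y \<in> vecs (L2 M)" by (simp only:)
  moreover have "(\<lambda>k. hnorm (L2 M) (X k - y)) \<longlonglongrightarrow> 0"
  proof (rule LIMSEQ_I)
    fix \<epsilon> :: real assume "\<epsilon> > 0"
    then obtain k where k: "(1/2)^k < \<epsilon>" using real_arch_pow_inv[of \<epsilon> "1/2"] by auto
    have "norm (hnorm (L2 M) (X m - y) - 0) < \<epsilon>" if "m \<ge> N k" for m
      using bound(2)[OF that] k L2_hnorm_nonneg[of M "X m - y"] by simp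
    thus "\<exists>N. \<forall>m\<ge>N. norm (hnorm (L2 M) (X m - y) - 0) < \<epsilon>" by blast
  qed
  ultimately show ?thesis by blast
qed

interpretation L2: semi_hilbert "L2 M" for M :: "'a measure"
proof
  show "0 \<in> vecs (L2 M)" by (simp add: L2_closed_iff zero_fun_def)
  show "scl (L2 M) (-1) x = - x" for x by (simp add: fun_eq_iff)
  show "ip (L2 M) (x + y) z = ip (L2 M) x z + ip (L2 M) y z"
    if "x \<in> vecs (L2 M)" "y \<in> vecs (L2 M)" "z \<in> vecs (L2 M)" for x y z
    using that by (simp add: ring_distribs L2_integrable_ip)
  show "ip (L2 M) y x = cnj (ip (L2 M) x y)" for x y
    unfolding L2_simps by (subst Bochner_Integration.integral_cnj[symmetric]) (simp add: mult.commute)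
  show "0 \<le> Re (ip (L2 M) x x)" for x unfolding L2_ip_self by simp
qed (auto intro: L2_add_closed L2_scl_closed L2_complete simp: mult.assoc)

section \<open>Closure of the polynomials, and forms with coefficients in it\<close>

lemma zero_in_polynomials: "0 \<in> polynomials"
  unfolding polynomials_def by (auto simp: zero_fun_def intro!: exI[of _ "{}"])

lemma monom_in_polynomials: "monom_fun \<alpha> \<in> polynomials"
  unfolding polynomials_def by (auto intro!: exI[of _ "{\<alpha>}"] exI[of _ "\<lambda>_. 1"])

lemma polynomials_add:
  assumes "p \<in> polynomials" "q \<in> polynomials" shows "p + q \<in> polynomials"
proof -
  obtain F a where F: "finite F" "p = (\<lambda>z. \<Sum>\<alpha>\<in>F. a \<alpha> * monom_fun \<alpha> z)"
    using assms(1) unfolding polynomials_def by blast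
  obtain G b where G: "finite G" "q = (\<lambda>z. \<Sum>\<alpha>\<in>G. b \<alpha> * monom_fun \<alpha> z)"
    using assms(2) unfolding polynomials_def by blast
  define c where "c \<alpha> = (if \<alpha> \<in> F then a \<alpha> else 0) + (if \<alpha> \<in> G then b \<alpha> else 0)" for \<alpha>
  have "(\<Sum>\<alpha>\<in>F \<union> G. c \<alpha> * monom_fun \<alpha> z) = p z + q z" for z
  proof -
    have "(\<Sum>\<alpha>\<in>F \<union> G. c \<alpha> * monom_fun \<alpha> z) =
        (\<Sum>\<alpha>\<in>F \<union> G. if \<alpha> \<in> F then a \<alpha> * monom_fun \<alpha> z else 0) +
        (\<Sum>\<alpha>\<in>F \<union> G. if \<alpha> \<in> G then b \<alpha> * monom_fun \<alpha> z else 0)"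
      unfolding sum.distrib[symmetric] by (intro sum.cong) (auto simp: c_def ring_distribs)
    also have "(\<Sum>\<alpha>\<in>F \<union> G. if \<alpha> \<in> F then a \<alpha> * monom_fun \<alpha> z else 0) = p z"
      unfolding F(2) using F(1) G(1) by (intro sum.mono_neutral_cong_right) auto
    also have "(\<Sum>\<alpha>\<in>F \<union> G. if \<alpha> \<in> G then b \<alpha> * monom_fun \<alpha> z else 0) = q z"
      unfolding G(2) using F(1) G(1) by (intro sum.mono_neutral_cong_right) auto
    finally show ?thesis .
  qed
  hence "p + q = (\<lambda>z. \<Sum>\<alpha>\<in>F \<union> G. c \<alpha> * monom_fun \<alpha> z)" by (simp add: fun_eq_iff)
  thus ?thesis unfolding polynomials_def using F(1) G(1) by blast
qed

lemma polynomials_scl: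
  assumes "p \<in> polynomials" shows "(\<lambda>z. c * p z) \<in> polynomials"
proof -
  obtain F a where F: "finite F" "p = (\<lambda>z. \<Sum>\<alpha>\<in>F. a \<alpha> * monom_fun \<alpha> z)"
    using assms unfolding polynomials_def by blast
  have "(\<lambda>z. c * p z) = (\<lambda>z. \<Sum>\<alpha>\<in>F. (c * a \<alpha>) * monom_fun \<alpha> z)"
    by (simp add: F(2) sum_distrib_left mult.assoc)
  thus ?thesis unfolding polynomials_def using F(1)
    by (auto intro!: exI[of _ F] exI[of _ "\<lambda>\<alpha>. c * a \<alpha>"])
qed

lemma polynomials_induct [consumes 1, case_names zero monom add]:
  assumes q: "q \<in> polynomials" and "P 0"
    and monom: "\<And>c \<alpha>. P (\<lambda>z. c * monom_fun \<alpha> z)"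
    and add: "\<And>p q. p \<in> polynomials \<Longrightarrow> q \<in> polynomials \<Longrightarrow> P p \<Longrightarrow> P q \<Longrightarrow> P (p + q)"
  shows "P q"
proof -
  obtain F a where F: "finite F" "q = (\<lambda>z. \<Sum>\<alpha>\<in>F. a \<alpha> * monom_fun \<alpha> z)"
    using q unfolding polynomials_def by blast
  have "(\<Sum>\<alpha>\<in>F. (\<lambda>z. a \<alpha> * monom_fun \<alpha> z)) \<in> polynomials \<and> P (\<Sum>\<alpha>\<in>F. (\<lambda>z. a \<alpha> * monom_fun \<alpha> z))"
    using F(1)
  proof induction
    case empty show ?case unfolding sum.empty using assms(2) zero_in_polynomials by blast
  next
    case (insert \<alpha> F)
    thus ?case
      unfolding sum.insert[OF insert.hyps]
      by (intro conjI polynomials_add add polynomials_scl monom_in_polynomials monom) auto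
  qed
  moreover have "q = (\<Sum>\<alpha>\<in>F. (\<lambda>z. a \<alpha> * monom_fun \<alpha> z))"
    using F(1) unfolding F(2) by induction (auto simp: fun_eq_iff)
  ultimately show ?thesis by simp
qed

locale monomial_measure =
  fixes M :: "(complex^'n) measure"
  assumes sets_M: "sets M = sets borel"
    and monom_orthogonal: "\<And>\<alpha> \<beta>. \<alpha> \<noteq> \<beta> \<Longrightarrow> ip (L2 M) (monom_fun \<alpha>) (monom_fun \<beta>) = 0"
    and monom_integrable: "\<And>\<alpha>. integrable M (\<lambda>z. (cmod (monom_fun \<alpha> z))\<^sup>2)"
    and monom_norm_pos: "\<And>\<alpha>. 0 < (\<integral>z. (cmod (monom_fun \<alpha> z))\<^sup>2 \<partial>M)"
begin

lemma continuous_measurable: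
  fixes f :: "complex^'n \<Rightarrow> complex"
  assumes "continuous_on UNIV f" shows "f \<in> borel_measurable M"
  using borel_measurable_continuous_onI[OF assms] measurable_cong_sets[OF sets_M refl] by blast

lemma continuous_monom: "continuous_on UNIV (monom_fun \<alpha> :: complex^'n \<Rightarrow> complex)"
  unfolding monom_fun_def[abs_def] by (intro continuous_intros)

lemma monom_L2: "monom_fun \<alpha> \<in> vecs (L2 M)"
  by (simp add: L2_closed_iff continuous_measurable continuous_monom monom_integrable)

lemma polynomials_L2: "q \<in> polynomials \<Longrightarrow> q \<in> vecs (L2 M)"
  by (induction rule: polynomials_induct)
    (use L2.zero_closed L2.add_closed L2_scl_closed monom_L2 in blast)+

lemma A2_L2: "f \<in> A2 M \<Longrightarrow> f \<in> vecs (L2 M)"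
  by (simp add: A2_def)

lemma A2_approx: "f \<in> A2 M \<Longrightarrow> \<epsilon> > 0 \<Longrightarrow> \<exists>q\<in>polynomials. hnorm (L2 M) (f - q) < \<epsilon>"
  by (simp add: A2_def)

lemma A2_closed:
  assumes y: "y \<in> vecs (L2 M)" and approx: "\<And>\<epsilon>. \<epsilon> > 0 \<Longrightarrow> \<exists>f\<in>A2 M. hnorm (L2 M) (y - f) < \<epsilon>"
  shows "y \<in> A2 M"
  unfolding A2_def
proof (intro CollectI conjI allI impI y)
  fix \<epsilon> :: real assume "\<epsilon> > 0"
  hence e2: "\<epsilon> / 2 > 0" by simp
  obtain f where f: "f \<in> A2 M" "hnorm (L2 M) (y - f) < \<epsilon> / 2" using approx[OF e2] by blast
  obtain q where q: "q \<in> polynomials" "hnorm (L2 M) (f - q) < \<epsilon> / 2" using A2_approx[OF f(1) e2] by blast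
  have "hnorm (L2 M) (y - q) < \<epsilon>"
    using L2.hnorm_diff_triangle[OF y A2_L2[OF f(1)] polynomials_L2[OF q(1)]] f(2) q(2) by linarith
  with q(1) show "\<exists>q\<in>polynomials. hnorm (L2 M) (y - q) < \<epsilon>" by blast
qed

lemma polynomials_A2: "q \<in> polynomials \<Longrightarrow> q \<in> A2 M"
  unfolding A2_def using polynomials_L2[of q] by (auto intro!: bexI[of _ q])

lemma zero_A2: "0 \<in> A2 M"
  by (intro polynomials_A2 zero_in_polynomials)

lemma add_A2:
  assumes f: "f \<in> A2 M" and g: "g \<in> A2 M" shows "f + g \<in> A2 M"
  unfolding A2_def
proof (intro CollectI conjI allI impI)
  show "f + g \<in> vecs (L2 M)" using f g by (intro L2.add_closed A2_L2)
  fix \<epsilon> :: real assume "\<epsilon> > 0"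
  hence e2: "\<epsilon> / 2 > 0" by simp
  obtain p where p: "p \<in> polynomials" "hnorm (L2 M) (f - p) < \<epsilon> / 2" using A2_approx[OF f e2] by blast
  obtain q where q: "q \<in> polynomials" "hnorm (L2 M) (g - q) < \<epsilon> / 2" using A2_approx[OF g e2] by blast
  have "hnorm (L2 M) ((f - p) + (g - q)) \<le> hnorm (L2 M) (f - p) + hnorm (L2 M) (g - q)"
    using f g p q by (intro L2.hnorm_triangle L2.diff_closed A2_L2 polynomials_L2)
  also have "(f - p) + (g - q) = (f + g) - (p + q)" by simp
  finally have "hnorm (L2 M) ((f + g) - (p + q)) < \<epsilon>" using p q by linarith
  thus "\<exists>q\<in>polynomials. hnorm (L2 M) (f + g - q) < \<epsilon>" using polynomials_add[OF p(1) q(1)] by blast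
qed

lemma scl_A2:
  assumes f: "f \<in> A2 M" shows "(\<lambda>z. c * f z) \<in> A2 M"
  unfolding A2_def
proof (intro CollectI conjI allI impI)
  show "(\<lambda>z. c * f z) \<in> vecs (L2 M)" using L2.scl_closed[OF A2_L2[OF f], of c] by simp
  fix \<epsilon> :: real assume e: "\<epsilon> > 0"
  have c1: "cmod c + 1 > 0" by (simp add: add_nonneg_pos)
  obtain p where p: "p \<in> polynomials" "hnorm (L2 M) (f - p) < \<epsilon> / (cmod c + 1)"
    using A2_approx[OF f, of "\<epsilon> / (cmod c + 1)"] e c1 by auto
  have fp: "f - p \<in> vecs (L2 M)" using f p by (intro L2.diff_closed A2_L2 polynomials_L2)
  have "hnorm (L2 M) ((\<lambda>z. c * f z) - (\<lambda>z. c * p z)) = cmod c * hnorm (L2 M) (f - p)"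
    using L2.hnorm_scl[OF fp, of c] by (simp add: fun_diff_def right_diff_distrib)
  also have "\<dots> \<le> (cmod c + 1) * hnorm (L2 M) (f - p)"
    by (intro mult_right_mono L2_hnorm_nonneg) simp
  also have "\<dots> < \<epsilon>" using p(2) c1 by (simp add: field_simps)
  finally show "\<exists>q\<in>polynomials. hnorm (L2 M) ((\<lambda>z. c * f z) - q) < \<epsilon>"
    using polynomials_scl[OF p(1)] by blast
qed

text \<open>
  By linearity \<open>f\<close> is orthogonal to all polynomials \<open>q\<close>, so \<open>\<parallel>f\<parallel>\<^sup>2 = \<langle>f, f - q\<rangle> \<le> \<parallel>f\<parallel> \<parallel>f - q\<parallel>\<close>, and the last
  factor can be made arbitrarily small.
\<close>

lemma A2_eq_zero:
  assumes f: "f \<in> A2 M" and orth: "\<And>\<alpha>. ip (L2 M) f (monom_fun \<alpha>) = 0"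
  shows "hnorm (L2 M) f = 0"
proof -
  note fL = A2_L2[OF f]
  have orth': "ip (L2 M) f q = 0" if "q \<in> polynomials" for q
    using that
  proof (induction rule: polynomials_induct)
    case zero show ?case by (rule L2.ip_zero_right[OF fL])
  next
    case (monom c \<alpha>)
    show ?case using L2.ip_scl_right[OF monom_L2[of \<alpha>] fL, of c] orth[of \<alpha>] by simp
  next
    case (add p q)
    show ?case
      unfolding L2.ip_add_right[OF polynomials_L2[OF add.hyps(1)] polynomials_L2[OF add.hyps(2)] fL] add.IH
      by simp
  qed
  have "hnorm (L2 M) f \<le> \<epsilon>" if e: "\<epsilon> > 0" for \<epsilon>
  proof -
    obtain q where q: "q \<in> polynomials" "hnorm (L2 M) (f - q) < \<epsilon>" using A2_approx[OF f e] by blast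
    have "(hnorm (L2 M) f)\<^sup>2 = Re (ip (L2 M) f (f - q))"
      unfolding L2.hnorm_sq[OF fL] L2.ip_diff_right[OF fL polynomials_L2[OF q(1)] fL] orth'[OF q(1)] by simp
    also have "\<dots> \<le> hnorm (L2 M) f * hnorm (L2 M) (f - q)"
      by (rule order_trans[OF complex_Re_le_cmod L2.Cauchy_Schwarz[OF fL L2.diff_closed[OF fL polynomials_L2[OF q(1)]]]])
    also have "\<dots> \<le> hnorm (L2 M) f * \<epsilon>"
      using q(2) by (intro mult_left_mono L2_hnorm_nonneg) simp
    finally show ?thesis
      using L2_hnorm_nonneg[of M f] e
      by (cases "hnorm (L2 M) f = 0") (auto simp: power2_eq_square mult_le_cancel_left)
  qed
  hence "hnorm (L2 M) f \<le> 0" using dense_ge[of 0 "hnorm (L2 M) f"] by blast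
  with L2_hnorm_nonneg[of M f] show ?thesis by simp
qed

lemma A2_01_simps [simp]:
  "\<omega> \<in> vecs (A2_01 M) \<longleftrightarrow> (\<forall>j. \<omega> j \<in> A2 M)"
  "scl (A2_01 M) c \<omega> = (\<lambda>j z. c * \<omega> j z)"
  by (simp_all add: A2_01_def)

lemma A2_01_ip: "ip (A2_01 M) \<omega> \<eta> = (\<Sum>j\<in>UNIV. ip (L2 M) (\<omega> j) (\<eta> j))"
  by (simp add: A2_01_def)

lemma A2_01_hnorm_sq: "(hnorm (A2_01 M) \<omega>)\<^sup>2 = (\<Sum>j\<in>UNIV. (hnorm (L2 M) (\<omega> j))\<^sup>2)"
  unfolding hnorm_def A2_01_ip L2_ip_self by (simp add: sum_nonneg)

lemma A2_01_hnorm_nonneg: "0 \<le> hnorm (A2_01 M) \<omega>"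
  unfolding hnorm_def A2_01_ip L2_ip_self by (simp add: sum_nonneg)

lemma component_hnorm_le: "hnorm (L2 M) (\<omega> j) \<le> hnorm (A2_01 M) \<omega>"
proof (rule power2_le_imp_le[OF _ A2_01_hnorm_nonneg])
  show "(hnorm (L2 M) (\<omega> j))\<^sup>2 \<le> (hnorm (A2_01 M) \<omega>)\<^sup>2"
    unfolding A2_01_hnorm_sq by (rule member_le_sum) auto
qed

sublocale A2_01: semi_hilbert "A2_01 M"
proof
  fix X :: "nat \<Rightarrow> 'n form01"
  assume X: "\<And>k. X k \<in> vecs (A2_01 M)"
    and Cauchy: "\<And>\<epsilon>. \<epsilon> > 0 \<Longrightarrow> \<exists>N. \<forall>m\<ge>N. \<forall>n\<ge>N. hnorm (A2_01 M) (X m - X n) < \<epsilon>"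
  have XA: "X k j \<in> A2 M" for k j using X[of k] by simp
  have "\<exists>y\<in>vecs (L2 M). (\<lambda>k. hnorm (L2 M) (X k j - y)) \<longlonglongrightarrow> 0" for j
  proof (rule L2_complete)
    show "X k j \<in> vecs (L2 M)" for k by (rule A2_L2[OF XA])
    fix \<epsilon> :: real assume "\<epsilon> > 0"
    have "hnorm (L2 M) (X m j - X n j) \<le> hnorm (A2_01 M) (X m - X n)" for m n
      using component_hnorm_le[of "X m - X n" j] by simp
    with Cauchy[OF \<open>\<epsilon> > 0\<close>] show "\<exists>N. \<forall>m\<ge>N. \<forall>n\<ge>N. hnorm (L2 M) (X m j - X n j) < \<epsilon>"
      by (meson order_le_less_trans)
  qed
  then obtain y where y: "\<And>j. y j \<in> vecs (L2 M)" "\<And>j. (\<lambda>k. hnorm (L2 M) (X k j - y j)) \<longlonglongrightarrow> 0"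
    by metis
  have "y j \<in> A2 M" for j
  proof (rule A2_closed[OF y(1)])
    fix \<epsilon> :: real assume "\<epsilon> > 0"
    then obtain k where "hnorm (L2 M) (X k j - y j) < \<epsilon>"
      using LIMSEQ_D[OF y(2)[of j]] L2_hnorm_nonneg[of M] by (metis abs_of_nonneg diff_zero order_refl real_norm_def)
    thus "\<exists>f\<in>A2 M. hnorm (L2 M) (y j - f) < \<epsilon>"
      using XA[of k j] L2.hnorm_diff_commute[OF A2_L2[OF XA] y(1), of k j j] by auto
  qed
  moreover have "(\<lambda>k. hnorm (A2_01 M) (X k - y)) \<longlonglongrightarrow> 0"
  proof -
    have "(\<lambda>k. (hnorm (A2_01 M) (X k - y))\<^sup>2) \<longlonglongrightarrow> (\<Sum>j\<in>(UNIV::'n set). 0\<^sup>2)"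
      unfolding A2_01_hnorm_sq using y(2) by (intro tendsto_sum tendsto_power) simp
    hence "(\<lambda>k. sqrt ((hnorm (A2_01 M) (X k - y))\<^sup>2)) \<longlonglongrightarrow> sqrt 0"
      by (intro tendsto_real_sqrt) simp
    thus ?thesis by (simp add: A2_01_hnorm_nonneg)
  qed
  ultimately show "\<exists>y\<in>vecs (A2_01 M). (\<lambda>k. hnorm (A2_01 M) (X k - y)) \<longlonglongrightarrow> 0" by auto
next
  show "ip (A2_01 M) (x + y) z = ip (A2_01 M) x z + ip (A2_01 M) y z"
    if "x \<in> vecs (A2_01 M)" "y \<in> vecs (A2_01 M)" "z \<in> vecs (A2_01 M)" for x y z
    using that unfolding A2_01_ip sum.distrib[symmetric]
    by (intro sum.cong) (auto intro!: L2.ip_add_left A2_L2 simp del: L2_simps)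
  show "ip (A2_01 M) y x = cnj (ip (A2_01 M) x y)"
    if "x \<in> vecs (A2_01 M)" "y \<in> vecs (A2_01 M)" for x y
    using that unfolding A2_01_ip cnj_sum
    by (intro sum.cong) (auto intro!: L2.ip_cnj A2_L2 simp del: L2_simps)
  show "0 \<le> Re (ip (A2_01 M) x x)" for x unfolding A2_01_ip L2_ip_self by (simp add: sum_nonneg)
  show "ip (A2_01 M) (scl (A2_01 M) c x) y = c * ip (A2_01 M) x y" for x y c
    by (simp add: A2_01_ip sum_distrib_left mult.assoc)
qed (auto intro: zero_A2 add_A2 scl_A2 simp: fun_eq_iff)

end

section \<open>Diagonalization of real symmetric matrices\<close>

text \<open>
  The orthogonal complement \<open>W\<close> of the eigenvectors in \<open>B\<close> is invariant under \<open>A\<close> and nonzero. A point of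
  the unit sphere of \<open>W\<close> at which \<open>x \<bullet> (A *v x)\<close> is maximal is an eigenvector.
\<close>

lemma symmetric_matrix_next_eigenvector:
  fixes A :: "real^'n^'n"
  assumes sym: "\<And>x y. (A *v x) \<bullet> y = x \<bullet> (A *v y)"
    and B: "finite B" "card B < CARD('n)" "\<And>b. b \<in> B \<Longrightarrow> \<exists>l. A *v b = l *\<^sub>R b"
  shows "\<exists>x l. norm x = 1 \<and> (\<forall>b\<in>B. x \<bullet> b = 0) \<and> A *v x = l *\<^sub>R x"
proof -
  define W where "W = {x. \<forall>b\<in>B. x \<bullet> b = 0}"
  have W_lin: "x + t *\<^sub>R y \<in> W" if "x \<in> W" "y \<in> W" for x y t
    using that by (simp add: W_def inner_add_left)
  have W_scale: "t *\<^sub>R x \<in> W" if "x \<in> W" for x t using that by (simp add: W_def)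
  have AW: "A *v x \<in> W" if x: "x \<in> W" for x
    unfolding W_def
  proof (intro CollectI ballI)
    fix b assume b: "b \<in> B"
    then obtain l where "A *v b = l *\<^sub>R b" using B(3) by blast
    thus "(A *v x) \<bullet> b = 0" using x b by (simp add: sym W_def)
  qed
  have "dim B < DIM(real^'n)" using B(1,2) dim_le_card'[OF B(1)] by simp
  then obtain x0 where x0: "x0 \<noteq> 0" "\<And>y. y \<in> span B \<Longrightarrow> orthogonal x0 y"
    using orthogonal_to_subspace_exists by blast
  have "x0 \<in> W" using x0(2) span_base by (auto simp: W_def orthogonal_def)
  hence "(1 / norm x0) *\<^sub>R x0 \<in> sphere 0 1 \<inter> W" using x0(1) W_scale by simp
  hence ne: "sphere 0 1 \<inter> W \<noteq> {}" by blast
  have "closed W"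
  proof -
    have "W = (\<Inter>b\<in>B. {x. b \<bullet> x = 0})" by (auto simp: W_def inner_commute)
    thus ?thesis by (simp add: closed_INT closed_hyperplane)
  qed
  hence "compact (sphere 0 1 \<inter> W)" by (intro compact_Int_closed compact_sphere)
  moreover have "continuous_on (sphere 0 1 \<inter> W) (\<lambda>x. x \<bullet> (A *v x))"
    by (intro continuous_on_inner continuous_on_id linear_continuous_on matrix_vector_mul_bounded_linear)
  ultimately obtain x where x: "x \<in> sphere 0 1 \<inter> W"
      and max: "\<And>y. y \<in> sphere 0 1 \<inter> W \<Longrightarrow> y \<bullet> (A *v y) \<le> x \<bullet> (A *v x)"
    using continuous_attains_sup[OF _ ne] by meson
  define m where "m = x \<bullet> (A *v x)"
  have nx: "norm x = 1" and xW: "x \<in> W" using x by auto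
  define Q where "Q y = m * (y \<bullet> y) - y \<bullet> (A *v y)" for y
  have Q0: "0 \<le> Q y" if y: "y \<in> W" for y
  proof (cases "y = 0")
    case False
    define y1 where "y1 = (1 / norm y) *\<^sub>R y"
    have "y1 \<in> sphere 0 1 \<inter> W" using False W_scale[OF y] by (simp add: y1_def)
    hence "y1 \<bullet> (A *v y1) \<le> m" using max m_def by simp
    also have "y1 \<bullet> (A *v y1) = (y \<bullet> (A *v y)) / (norm y)\<^sup>2"
      by (simp add: y1_def matrix_vector_mult_scaleR power2_eq_square)
    finally show ?thesis using False by (simp add: Q_def field_simps power2_norm_eq_inner)
  qed (simp add: Q_def)
  define w where "w = A *v x - m *\<^sub>R x"
  have w: "w \<in> W" using W_lin[OF AW[OF xW] xW, of "- m"] by (simp add: w_def)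
  \<comment> \<open>\<open>Q\<close> is minimal (equal to 0) at \<open>x\<close>, so its derivative in the direction \<open>w\<close> vanishes; that derivative is \<open>- 2 * (w \<bullet> w)\<close>.\<close>
  have expand: "Q (x + t *\<^sub>R w) = - 2 * t * (w \<bullet> w) + t\<^sup>2 * Q w" for t
  proof -
    have xx: "x \<bullet> x = 1" using nx by (simp add: norm_eq_1)
    have Ax: "A *v x = w + m *\<^sub>R x" by (simp add: w_def)
    have xAw: "x \<bullet> (A *v w) = w \<bullet> w + m * (x \<bullet> w)"
      using sym[of x w] by (simp add: Ax inner_add_left)
    have xw: "x \<bullet> w = 0" by (simp add: w_def inner_diff_right m_def xx)
    show ?thesis
      using xw xx by (simp add: Q_def inner_add_left inner_add_right matrix_vector_right_distrib
          matrix_vector_mult_scaleR xAw Ax inner_commute power2_eq_square algebra_simps)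
  qed
  have "w \<bullet> w \<le> 0"
  proof (rule ccontr)
    assume "\<not> w \<bullet> w \<le> 0"
    hence ww: "w \<bullet> w > 0" by linarith
    \<comment> \<open>For this \<open>t\<close> the linear term of \<open>expand\<close> outweighs the quadratic one.\<close>
    define t where "t = (w \<bullet> w) / (Q w + 1)"
    have t: "t > 0" using ww Q0[OF w] by (simp add: t_def)
    have "t * Q w \<le> w \<bullet> w" using ww Q0[OF w] by (simp add: t_def field_simps)
    hence "t * (t * Q w) \<le> t * (w \<bullet> w)" using t by (intro mult_left_mono) auto
    moreover have "0 \<le> - 2 * t * (w \<bullet> w) + t\<^sup>2 * Q w"
      using Q0[OF W_lin[OF xW w]] by (simp add: expand)
    moreover have "t * (w \<bullet> w) > 0" using t ww by simp
    ultimately show False by (simp add: power2_eq_square)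
  qed
  hence "w = 0" using inner_ge_zero[of w] by (metis antisym inner_eq_zero_iff)
  hence "A *v x = m *\<^sub>R x" by (simp add: w_def)
  with nx xW show ?thesis unfolding W_def by blast
qed

lemma symmetric_matrix_eigenbasis:
  fixes A :: "real^'n^'n"
  assumes sym: "\<And>x y. (A *v x) \<bullet> y = x \<bullet> (A *v y)"
  obtains b :: "'n \<Rightarrow> real^'n" and \<mu> :: "'n \<Rightarrow> real"
  where "\<And>i j. b i \<bullet> b j = (if i = j then 1 else 0)" "\<And>i. A *v b i = \<mu> i *\<^sub>R b i"
proof -
  have "\<exists>B::(real^'n) set. finite B \<and> card B = k \<and> (\<forall>b\<in>B. \<exists>l. A *v b = l *\<^sub>R b) \<and>
      (\<forall>b\<in>B. \<forall>b'\<in>B. b \<bullet> b' = (if b = b' then 1 else 0))" if "k \<le> CARD('n)" for k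
    using that
  proof (induction k)
    case 0 show ?case by (intro exI[of _ "{}"]) auto
  next
    case (Suc k)
    then obtain B :: "(real^'n) set" where B: "finite B" "card B = k" "\<And>b. b \<in> B \<Longrightarrow> \<exists>l. A *v b = l *\<^sub>R b"
        "\<And>b b'. b \<in> B \<Longrightarrow> b' \<in> B \<Longrightarrow> b \<bullet> b' = (if b = b' then 1 else 0)" by auto
    obtain x l where x: "norm x = 1" "\<forall>b\<in>B. x \<bullet> b = 0" "A *v x = l *\<^sub>R x"
      using symmetric_matrix_next_eigenvector[OF sym B(1) _ B(3)] B(2) Suc.prems by auto
    have xx: "x \<bullet> x = 1" using x(1) by (simp add: norm_eq_1)
    hence "x \<notin> B" using x(2) by force
    hence "card (insert x B) = Suc k" using B by simp
    moreover have "b \<bullet> b' = (if b = b' then 1 else 0)" if "b \<in> insert x B" "b' \<in> insert x B" for b b'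
      using that B(4) x(2) xx \<open>x \<notin> B\<close> by (auto simp: inner_commute)
    moreover have "\<exists>l. A *v b = l *\<^sub>R b" if "b \<in> insert x B" for b using that B(3) x(3) by auto
    ultimately show ?case using B(1) by (intro exI[of _ "insert x B"]) simp
  qed
  from this[OF order_refl] obtain B :: "(real^'n) set" where B: "finite B" "card B = CARD('n)"
      "\<And>b. b \<in> B \<Longrightarrow> \<exists>l. A *v b = l *\<^sub>R b"
      "\<And>b b'. b \<in> B \<Longrightarrow> b' \<in> B \<Longrightarrow> b \<bullet> b' = (if b = b' then 1 else 0)" by auto
  obtain f :: "'n \<Rightarrow> real^'n" where f: "bij_betw f UNIV B"
    using finite_same_card_bij[OF finite B(1)] B(2) by auto
  have fB: "f i \<in> B" for i using bij_betwE[OF f] by simp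
  have "\<exists>l. A *v f i = l *\<^sub>R f i" for i using B(3) fB by blast
  then obtain \<mu> where "\<And>i. A *v f i = \<mu> i *\<^sub>R f i" by metis
  moreover have "f i \<bullet> f j = (if i = j then 1 else 0)" for i j
    using B(4)[OF fB fB, of i j] bij_betw_imp_inj_on[OF f] by (auto simp: inj_on_def)
  ultimately show ?thesis by (intro that[of f \<mu>])
qed

text \<open>
  The rows of \<open>V\<close> are orthonormal eigenvectors of \<open>G\<close> in \<open>\<real>\<^sup>J\<close> with eigenvalues \<open>\<mu>\<close>. The second condition,
  orthonormality of the columns, says that \<open>V\<close> can be inverted by transposing it.
\<close>

definition diagonalizes ::
    "'n set \<Rightarrow> ('n \<Rightarrow> 'n \<Rightarrow> real) \<Rightarrow> ('n \<Rightarrow> 'n \<Rightarrow> real) \<Rightarrow> ('n \<Rightarrow> real) \<Rightarrow> bool" where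
  "diagonalizes J G V \<mu> \<longleftrightarrow>
     (\<forall>a\<in>J. \<forall>b\<in>J. (\<Sum>k\<in>J. V a k * V b k) = (if a = b then 1 else 0)) \<and>
     (\<forall>j\<in>J. \<forall>k\<in>J. (\<Sum>a\<in>J. V a j * V a k) = (if j = k then 1 else 0)) \<and>
     (\<forall>a\<in>J. \<forall>b\<in>J. (\<Sum>j\<in>J. \<Sum>k\<in>J. V a j * V b k * G j k) = (if a = b then \<mu> a else 0))"

text \<open>
  The two cases for \<open>J\<close> are those that occur for the blocks of the operator \<open>S\<^sup>*S\<close>.
\<close>

lemma symmetric_diagonalizable:
  fixes G :: "'n::finite \<Rightarrow> 'n \<Rightarrow> real"
  assumes sym: "\<And>j k. G j k = G k j" and J: "J = UNIV \<or> (\<exists>i. J = {i})"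
  shows "\<exists>V \<mu>. diagonalizes J G V \<mu>"
  using J
proof
  assume J: "J = UNIV"
  define A :: "real^'n^'n" where "A = (\<chi> j k. G j k)"
  have "transpose A = A" by (simp add: A_def transpose_def vec_eq_iff sym)
  hence "(A *v x) \<bullet> y = x \<bullet> (A *v y)" for x y
    by (metis dot_lmul_matrix transpose_matrix_vector)
  then obtain b :: "'n \<Rightarrow> real^'n" and \<mu> where b: "\<And>i j. b i \<bullet> b j = (if i = j then 1 else 0)"
      and eig: "\<And>i. A *v b i = \<mu> i *\<^sub>R b i"
    using symmetric_matrix_eigenbasis[of A] by metis
  define P :: "real^'n^'n" where "P = (\<chi> a k. b a $ k)"
  have row: "(\<Sum>k\<in>UNIV. b i $ k * b j $ k) = (if i = j then 1 else 0)" for i j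
    using b[of i j] by (simp add: inner_vec_def)
  have "P ** transpose P = mat 1"
    using row by (simp add: P_def matrix_matrix_mult_def transpose_def mat_def vec_eq_iff)
  hence "transpose P ** P = mat 1" by (simp add: matrix_left_right_inverse)
  hence "(\<Sum>a\<in>UNIV. b a $ j * b a $ k) = (if j = k then 1 else 0)" for j k
    by (simp add: P_def matrix_matrix_mult_def transpose_def mat_def vec_eq_iff)
  moreover have "(\<Sum>j\<in>UNIV. \<Sum>k\<in>UNIV. b i $ j * b l $ k * G j k) = (if i = l then \<mu> i else 0)" for i l
  proof -
    have "(\<Sum>j\<in>UNIV. \<Sum>k\<in>UNIV. b i $ j * b l $ k * G j k) = b i \<bullet> (A *v b l)"
      by (simp add: A_def inner_vec_def matrix_vector_mult_def sum_distrib_left ac_simps)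
    also have "\<dots> = (if i = l then \<mu> i else 0)" by (simp add: eig b)
    finally show ?thesis .
  qed
  ultimately have "diagonalizes J G (\<lambda>a k. b a $ k) \<mu>" using row by (simp add: diagonalizes_def J)
  thus ?thesis by blast
next
  assume "\<exists>i. J = {i}"
  hence "diagonalizes J G (\<lambda>_ _. 1) (\<lambda>i. G i i)" by (auto simp: diagonalizes_def)
  thus ?thesis by blast
qed

lemma diagonalizes_trace:
  assumes d: "diagonalizes J G V \<mu>" and J: "finite J"
  shows "(\<Sum>a\<in>J. \<mu> a) = (\<Sum>j\<in>J. G j j)"
proof -
  have "(\<Sum>a\<in>J. \<mu> a) = (\<Sum>a\<in>J. \<Sum>j\<in>J. \<Sum>k\<in>J. V a j * V a k * G j k)"
    using d by (intro sum.cong) (auto simp: diagonalizes_def)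
  also have "\<dots> = (\<Sum>j\<in>J. \<Sum>k\<in>J. \<Sum>a\<in>J. V a j * V a k * G j k)"
    by (subst sum.swap, intro sum.cong refl sum.swap)
  also have "\<dots> = (\<Sum>j\<in>J. \<Sum>k\<in>J. (if j = k then 1 else 0) * G j k)"
    using d by (intro sum.cong refl) (auto simp: diagonalizes_def simp flip: sum_distrib_right)
  also have "\<dots> = (\<Sum>j\<in>J. G j j)" using J by (simp add: if_distrib[of "\<lambda>x. x * _"] cong: if_cong)
  finally show ?thesis .
qed

section \<open>Summability of eigenvalues and of traces\<close>

text \<open>
  Every \<open>\<mu> (x, a)\<close> is at most the sum over \<open>J x\<close>, and that sum is at most \<open>CARD('b)\<close> times the largest
  \<open>\<mu> (x, a)\<close>.
\<close>

lemma summable_on_trace_powr_iff: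
  fixes \<mu> :: "'a \<times> 'b::finite \<Rightarrow> real"
  assumes nonneg: "\<And>x a. x \<in> X \<Longrightarrow> a \<in> J x \<Longrightarrow> 0 \<le> \<mu> (x, a)" and q: "q > 0"
  shows "(\<lambda>i. \<mu> i powr q) summable_on Sigma X J \<longleftrightarrow> (\<lambda>x. (\<Sum>a\<in>J x. \<mu> (x, a)) powr q) summable_on X"
proof
  assume "(\<lambda>i. \<mu> i powr q) summable_on Sigma X J"
  hence "(\<lambda>x. \<Sum>\<^sub>\<infinity>a\<in>J x. \<mu> (x, a) powr q) summable_on X" by (rule summable_on_SigmaD) simp
  hence "(\<lambda>x. \<Sum>a\<in>J x. \<mu> (x, a) powr q) summable_on X" by simp
  hence "(\<lambda>x. CARD('b) powr q * (\<Sum>a\<in>J x. \<mu> (x, a) powr q)) summable_on X"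
    by (rule summable_on_cmult_right)
  thus "(\<lambda>x. (\<Sum>a\<in>J x. \<mu> (x, a)) powr q) summable_on X"
  proof (rule summable_on_comparison_test)
    fix x assume x: "x \<in> X"
    show "(\<Sum>a\<in>J x. \<mu> (x, a)) powr q \<le> CARD('b) powr q * (\<Sum>a\<in>J x. \<mu> (x, a) powr q)"
    proof (cases "J x = {}")
      case False
      define m where "m = Max ((\<lambda>a. \<mu> (x, a)) ` J x)"
      have "m \<in> (\<lambda>a. \<mu> (x, a)) ` J x" unfolding m_def using False by (intro Max_in) auto
      then obtain a0 where a0: "a0 \<in> J x" "m = \<mu> (x, a0)" by blast
      have "(\<Sum>a\<in>J x. \<mu> (x, a)) \<le> card (J x) * m"
        using sum_bounded_above[of "J x" "\<lambda>a. \<mu> (x, a)" m] by (simp add: m_def)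
      also have "\<dots> \<le> CARD('b) * m"
        using nonneg[OF x a0(1)] a0(2) by (intro mult_right_mono) (auto intro: card_mono)
      finally have "(\<Sum>a\<in>J x. \<mu> (x, a)) powr q \<le> (CARD('b) * m) powr q"
        using q nonneg[OF x] by (intro powr_mono2) (auto intro: sum_nonneg)
      also have "\<dots> = CARD('b) powr q * \<mu> (x, a0) powr q"
        using nonneg[OF x a0(1)] a0(2) by (simp add: powr_mult)
      also have "\<dots> \<le> CARD('b) powr q * (\<Sum>a\<in>J x. \<mu> (x, a) powr q)"
        using a0(1) by (intro mult_left_mono member_le_sum) auto
      finally show ?thesis .
    qed simp
  qed simp
next
  assume sum: "(\<lambda>x. (\<Sum>a\<in>J x. \<mu> (x, a)) powr q) summable_on X"
  hence "(\<lambda>x. CARD('b) * (\<Sum>a\<in>J x. \<mu> (x, a)) powr q) summable_on X" by (rule summable_on_cmult_right)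
  hence "(\<lambda>x. \<Sum>a\<in>J x. \<mu> (x, a) powr q) summable_on X"
  proof (rule summable_on_comparison_test)
    fix x assume x: "x \<in> X"
    have "(\<Sum>a\<in>J x. \<mu> (x, a) powr q) \<le> (\<Sum>a\<in>J x. (\<Sum>a\<in>J x. \<mu> (x, a)) powr q)"
      using nonneg[OF x] q by (intro sum_mono powr_mono2 member_le_sum) auto
    also have "\<dots> \<le> CARD('b) * (\<Sum>a\<in>J x. \<mu> (x, a)) powr q"
      by (simp add: mult_right_mono card_mono)
    finally show "(\<Sum>a\<in>J x. \<mu> (x, a) powr q) \<le> CARD('b) * (\<Sum>a\<in>J x. \<mu> (x, a)) powr q" .
  qed (simp add: sum_nonneg)
  thus "(\<lambda>i. \<mu> i powr q) summable_on Sigma X J"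
    by (intro summable_on_SigmaI[where g = "\<lambda>x. \<Sum>a\<in>J x. \<mu> (x, a) powr q"] has_sum_finite) auto
qed

context semi_hilbert_pair begin

lemma linear_on_zero:
  assumes T: "linear_on D H K T" and D: "0 \<in> D"
  shows "heq K (T 0) 0"
proof (rule K.heqI)
  show T0: "T 0 \<in> vecs K" using T D by (simp add: linear_on_def)
  fix z assume z: "z \<in> vecs K"
  have "heq K (T (0 + 0)) (T 0 + T 0)" using T D unfolding linear_on_def by blast
  from K.heq_ip_cong(1)[OF this _ _ z] T0 z show "ip K (T 0) z = ip K 0 z"
    by (simp add: K.ip_add_left K.ip_zero_left)
qed simp

text \<open>
  Linearity holds only modulo \<open>heq\<close>, and only on \<open>D\<close>; so each partial sum must be kept in \<open>D\<close>.
\<close>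

lemma linear_on_sum:
  assumes T: "linear_on D H K T" and D: "0 \<in> D" "\<And>x y. x \<in> D \<Longrightarrow> y \<in> D \<Longrightarrow> x + y \<in> D"
      "\<And>c x. x \<in> D \<Longrightarrow> scl H c x \<in> D"
    and F: "finite F" and x: "\<And>i. i \<in> F \<Longrightarrow> x i \<in> D"
  shows "(\<Sum>i\<in>F. scl H (a i) (x i)) \<in> D \<and>
    heq K (T (\<Sum>i\<in>F. scl H (a i) (x i))) (\<Sum>i\<in>F. scl K (a i) (T (x i)))"
  using F x
proof (induction rule: finite_induct)
  case empty
  show ?case using D(1) linear_on_zero[OF T D(1)] by simp
next
  case (insert j F)
  define s where "s = (\<Sum>i\<in>F. scl H (a i) (x i))"
  define s' where "s' = (\<Sum>i\<in>F. scl K (a i) (T (x i)))"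
  have TK: "T y \<in> vecs K" if "y \<in> D" for y using T that by (simp add: linear_on_def)
  have s: "s \<in> D" "heq K (T s) s'" using insert unfolding s_def s'_def by auto
  have xj: "x j \<in> D" using insert.prems by simp
  have s'K: "s' \<in> vecs K" unfolding s'_def
    by (intro K.sum_closed K.scl_closed TK insert.prems) simp
  have "heq K (T (scl H (a j) (x j) + s)) (T (scl H (a j) (x j)) + T s)"
    using T D(3)[OF xj] s(1) unfolding linear_on_def by blast
  moreover have "heq K (T (scl H (a j) (x j)) + T s) (scl K (a j) (T (x j)) + s')"
  proof (rule K.heq_add[OF _ s(2)])
    show "heq K (T (scl H (a j) (x j))) (scl K (a j) (T (x j)))"
      using T xj unfolding linear_on_def by blast
  qed (use TK D(3) xj s s'K in auto)
  ultimately have "heq K (T (scl H (a j) (x j) + s)) (scl K (a j) (T (x j)) + s')"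
    by (rule K.heq_trans) (use TK D xj s s'K in auto)
  thus ?case using insert.hyps D s(1) xj by (simp add: s_def s'_def)
qed

lemma linear_on_agree_sum:
  assumes T: "linear_on D H K T" and S: "linear_on D H K S"
    and D: "0 \<in> D" "\<And>x y. x \<in> D \<Longrightarrow> y \<in> D \<Longrightarrow> x + y \<in> D"
      "\<And>c x. x \<in> D \<Longrightarrow> scl H c x \<in> D"
    and F: "finite F" and x: "\<And>i. i \<in> F \<Longrightarrow> x i \<in> D"
    and agree: "\<And>i. i \<in> F \<Longrightarrow> heq K (T (x i)) (S (x i))"
  shows "heq K (T (\<Sum>i\<in>F. scl H (a i) (x i))) (S (\<Sum>i\<in>F. scl H (a i) (x i)))"
proof -
  define s where "s = (\<Sum>i\<in>F. scl H (a i) (x i))"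
  have TK: "T y \<in> vecs K" if "y \<in> D" for y using T that by (simp add: linear_on_def)
  have SK: "S y \<in> vecs K" if "y \<in> D" for y using S that by (simp add: linear_on_def)
  have sT: "s \<in> D \<and> heq K (T s) (\<Sum>i\<in>F. scl K (a i) (T (x i)))"
    unfolding s_def by (rule linear_on_sum[OF T D F x])
  have sS: "s \<in> D \<and> heq K (S s) (\<Sum>i\<in>F. scl K (a i) (S (x i)))"
    unfolding s_def by (rule linear_on_sum[OF S D F x])
  have T': "(\<Sum>i\<in>F. scl K (a i) (T (x i))) \<in> vecs K" using TK x by (intro K.sum_closed K.scl_closed) auto
  have S': "(\<Sum>i\<in>F. scl K (a i) (S (x i))) \<in> vecs K" using SK x by (intro K.sum_closed K.scl_closed) auto
  have TS: "heq K (\<Sum>i\<in>F. scl K (a i) (T (x i))) (\<Sum>i\<in>F. scl K (a i) (S (x i)))"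
  proof (rule K.heqI[OF T' S'])
    fix z assume z: "z \<in> vecs K"
    have "ip K (scl K (a i) (T (x i))) z = ip K (scl K (a i) (S (x i))) z" if "i \<in> F" for i
      using that TK SK x z K.heq_ip_cong(1)[OF agree] by (simp add: K.ip_scl_left)
    thus "ip K (\<Sum>i\<in>F. scl K (a i) (T (x i))) z = ip K (\<Sum>i\<in>F. scl K (a i) (S (x i))) z"
      using z TK SK x by (simp add: K.ip_sum_left)
  qed
  have Ts: "T s \<in> vecs K" and Ss: "S s \<in> vecs K" using sT sS TK SK by auto
  have "heq K (T s) (\<Sum>i\<in>F. scl K (a i) (S (x i)))"
    using K.heq_trans[OF conjunct2[OF sT] TS Ts T' S'] by simp
  from K.heq_trans[OF this K.heq_sym[OF conjunct2[OF sS] Ss S'] Ts S' Ss] show ?thesis by (simp add: s_def)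
qed

end

section \<open>The blocks of forms\<close>

\<comment> \<open>Inner products stay folded in what follows, so that the laws of \<open>semi_hilbert\<close> apply to them.\<close>
declare L2_simps(2) [simp del]

context monomial_measure begin

abbreviation wt :: "int^'n \<Rightarrow> real" where "wt \<equiv> coeff_c M"

text \<open>
  The monomial \<open>z\<^sup>\<gamma>\<close> for \<open>\<gamma> \<ge> 0\<close>. Integer exponents make it possible to shift by elements of \<open>\<Gamma>\<close>; if
  \<open>\<gamma>\<close> has a negative entry, the truncated monomial obtained here appears only with coefficient
  \<open>c\<^sub>\<gamma> = 0\<close>.
\<close>

definition int_monom :: "int^'n \<Rightarrow> complex^'n \<Rightarrow> complex" where
  "int_monom \<gamma> = monom_fun (\<chi> i. nat (\<gamma> $ i))"

lemma monom_fun_eq_int_monom: "monom_fun \<alpha> = int_monom (\<chi> i. int (\<alpha> $ i))"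
  by (simp add: int_monom_def)

lemma wt_pos: "0 \<le> \<gamma> \<Longrightarrow> 0 < wt \<gamma>"
  using monom_norm_pos by (simp add: coeff_c_def)

lemma int_monom_A2: "int_monom \<gamma> \<in> A2 M"
  unfolding int_monom_def by (intro polynomials_A2 monom_in_polynomials)

lemmas int_monom_L2 = A2_L2[OF int_monom_A2]

lemma ip_int_monom:
  assumes "0 \<le> \<gamma>" "0 \<le> \<delta>"
  shows "ip (L2 M) (int_monom \<gamma>) (int_monom \<delta>) = (if \<gamma> = \<delta> then complex_of_real (1 / wt \<gamma>) else 0)"
proof (cases "\<gamma> = \<delta>")
  case True
  show ?thesis unfolding True L2_ip_self using assms by (simp add: coeff_c_def int_monom_def)
next
  case False
  then obtain i where "\<gamma> $ i \<noteq> \<delta> $ i" by (auto simp: vec_eq_iff)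
  moreover have "0 \<le> \<gamma> $ i" "0 \<le> \<delta> $ i" using assms by (auto simp: less_eq_vec_def)
  ultimately have "(\<chi> i. nat (\<gamma> $ i)) \<noteq> (\<chi> i. nat (\<delta> $ i))" by (auto simp: vec_eq_iff intro!: exI[of _ i])
  thus ?thesis using False monom_orthogonal by (simp add: int_monom_def)
qed

lemma add_axis_nonneg: "0 \<le> \<gamma> \<Longrightarrow> 0 \<le> \<gamma> + axis j (1::int)"
  by (auto simp: less_eq_vec_def axis_def)

lemma int_monom_add_axis:
  assumes "0 \<le> \<gamma>"
  shows "int_monom (\<gamma> + axis j 1) z = z $ j * int_monom \<gamma> z"
proof -
  have "int_monom (\<gamma> + axis j 1) z = (\<Prod>i\<in>UNIV. (if i = j then z $ i else 1) * (z $ i) ^ nat (\<gamma> $ i))"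
    unfolding int_monom_def monom_fun_def
  proof (intro prod.cong refl)
    fix i
    have "0 \<le> \<gamma> $ i" using assms by (simp add: less_eq_vec_def)
    thus "(z $ i) ^ ((\<chi> i. nat ((\<gamma> + axis j 1) $ i)) $ i) = (if i = j then z $ i else 1) * (z $ i) ^ nat (\<gamma> $ i)"
      by (simp add: axis_def nat_add_distrib)
  qed
  also have "\<dots> = z $ j * int_monom \<gamma> z"
    by (simp add: prod.distrib int_monom_def monom_fun_def)
  finally show ?thesis .
qed

text \<open>
  This is \<open>zbar\<^sub>j z\<^sup>\<gamma>\<close>. In inner products its factor \<open>zbar\<^sub>j\<close> is moved to the other argument, where it
  becomes \<open>z\<^sub>j\<close> and raises an exponent by 1.
\<close>

definition cnj_monom :: "'n \<Rightarrow> int^'n \<Rightarrow> complex^'n \<Rightarrow> complex" where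
  "cnj_monom j \<gamma> = (\<lambda>z. cnj (z $ j) * int_monom \<gamma> z)"

lemma cnj_monom_L2:
  assumes "0 \<le> \<gamma>" shows "cnj_monom j \<gamma> \<in> vecs (L2 M)"
proof -
  have "cmod (cnj_monom j \<gamma> z) = cmod (int_monom (\<gamma> + axis j 1) z)" for z
    using assms by (simp add: cnj_monom_def int_monom_add_axis norm_mult)
  moreover have "cnj_monom j \<gamma> \<in> borel_measurable M"
    unfolding cnj_monom_def int_monom_def by (intro continuous_measurable continuous_intros continuous_monom)
  ultimately show ?thesis using int_monom_L2[of "\<gamma> + axis j 1"] by (simp add: L2_closed_iff)
qed

lemma ip_cnj_monom_cnj_monom:
  assumes "0 \<le> \<gamma>" "0 \<le> \<delta>"
  shows "ip (L2 M) (cnj_monom j \<gamma>) (cnj_monom k \<delta>) = ip (L2 M) (int_monom (\<gamma> + axis k 1)) (int_monom (\<delta> + axis j 1))"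
  unfolding L2_simps using assms by (simp add: int_monom_add_axis cnj_monom_def ac_simps)

lemma ip_cnj_monom_int_monom:
  assumes "0 \<le> \<gamma>" "0 \<le> \<delta>"
  shows "ip (L2 M) (cnj_monom j \<gamma>) (int_monom \<delta>) = ip (L2 M) (int_monom \<gamma>) (int_monom (\<delta> + axis j 1))"
  unfolding L2_simps using assms by (simp add: int_monom_add_axis cnj_monom_def ac_simps)

definition block :: "int^'n \<Rightarrow> 'n set" where
  "block \<gamma> = {j. 0 \<le> \<gamma> + axis j 1}"

lemma mem_blockD: "j \<in> block \<gamma> \<Longrightarrow> 0 \<le> \<gamma> + axis j 1"
  by (simp add: block_def)

lemma block_cases:
  assumes "\<gamma> \<in> Gamma_set"
  shows "block \<gamma> = UNIV \<or> (\<exists>i. block \<gamma> = {i})"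
proof (cases "0 \<le> \<gamma>")
  case True
  thus ?thesis by (auto simp: block_def add_axis_nonneg)
next
  case False
  have ge: "\<gamma> $ i \<ge> -1" for i using assms by (simp add: Gamma_set_def)
  from False obtain i where "\<gamma> $ i < 0" by (auto simp: less_eq_vec_def not_le)
  with ge[of i] have i: "\<gamma> $ i = -1" by simp
  have only: "j = i" if "\<gamma> $ j = -1" for j
  proof -
    have "card {i. \<gamma> $ i = -1} \<le> Suc 0" using assms by (simp add: Gamma_set_def)
    thus ?thesis using that i by (auto simp: card_le_Suc0_iff_eq)
  qed
  have "block \<gamma> = {i}"
  proof (intro equalityI subsetI)
    fix j assume "j \<in> block \<gamma>"
    hence "0 \<le> \<gamma> $ i + axis j 1 $ i" by (simp add: block_def less_eq_vec_def)
    thus "j \<in> {i}" using i by (auto simp: axis_def split: if_splits)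
  next
    fix j assume "j \<in> {i}"
    moreover have "0 \<le> \<gamma> $ k + axis i 1 $ k" for k
    proof (cases "k = i")
      case False
      hence "\<gamma> $ k \<noteq> -1" using only by blast
      with ge[of k] False show ?thesis by (simp add: axis_def)
    qed (simp add: i axis_def)
    ultimately show "j \<in> block \<gamma>" by (simp add: block_def less_eq_vec_def)
  qed
  thus ?thesis by blast
qed

lemma Gamma_set_of_monomial:
  assumes "0 \<le> \<delta>"
  shows "\<delta> - axis j 1 \<in> Gamma_set" "j \<in> block (\<delta> - axis j 1)"
proof -
  have ge: "0 \<le> \<delta> $ i" for i using assms by (simp add: less_eq_vec_def)
  have "{i. (\<delta> - axis j 1) $ i = -1} \<subseteq> {j}"
  proof
    fix i assume "i \<in> {i. (\<delta> - axis j 1) $ i = -1}"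
    thus "i \<in> {j}" using ge[of i] by (auto simp: axis_def split: if_splits)
  qed
  hence "card {i. (\<delta> - axis j 1) $ i = -1} \<le> card {j}" by (intro card_mono) auto
  hence "card {i. (\<delta> - axis j 1) $ i = -1} \<le> 1" by simp
  moreover have "(\<delta> - axis j 1) $ i \<ge> -1" for i using ge[of i] by (auto simp: axis_def)
  ultimately show "\<delta> - axis j 1 \<in> Gamma_set" by (simp add: Gamma_set_def)
  show "j \<in> block (\<delta> - axis j 1)" using assms by (simp add: block_def)
qed

text \<open>
  This is \<open>z\<^bsup>\<gamma>+e\<^sub>j\<^esup> dzbar\<^sub>j\<close>. For \<open>\<gamma> \<in> \<Gamma>\<close> and \<open>j \<in> block \<gamma>\<close>, these are all the monomial forms, each
  exactly once: \<open>z\<^sup>\<delta> dzbar\<^sub>j\<close> belongs to \<open>\<gamma> = \<delta> - e\<^sub>j\<close>.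
\<close>

definition block_form :: "int^'n \<Rightarrow> 'n \<Rightarrow> 'n form01" where
  "block_form \<gamma> j = monom_form (\<chi> i. nat ((\<gamma> + axis j 1) $ i)) j"

lemma block_form_component: "block_form \<gamma> j k = (if k = j then int_monom (\<gamma> + axis j 1) else 0)"
  by (simp add: block_form_def monom_form_def int_monom_def)

lemma polynomial_forms_zero: "0 \<in> polynomial_forms"
  by (simp add: polynomial_forms_def zero_in_polynomials)

lemma polynomial_forms_add: "x \<in> polynomial_forms \<Longrightarrow> y \<in> polynomial_forms \<Longrightarrow> x + y \<in> polynomial_forms"
  by (simp add: polynomial_forms_def polynomials_add)

lemma polynomial_forms_scl: "x \<in> polynomial_forms \<Longrightarrow> scl (A2_01 M) c x \<in> polynomial_forms"
  by (simp add: polynomial_forms_def polynomials_scl)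

lemma monom_form_polynomial: "monom_form \<alpha> j \<in> polynomial_forms"
  by (simp add: polynomial_forms_def monom_form_def zero_in_polynomials monom_in_polynomials)

lemma polynomial_forms_A2_01: "x \<in> polynomial_forms \<Longrightarrow> x \<in> vecs (A2_01 M)"
  by (simp add: polynomial_forms_def polynomials_A2)

lemma ip_block_form_right:
  assumes "x \<in> vecs (A2_01 M)"
  shows "ip (A2_01 M) x (block_form \<gamma> j) = ip (L2 M) (x j) (int_monom (\<gamma> + axis j 1))"
proof -
  have "ip (L2 M) (x k) (block_form \<gamma> j k) = (if k = j then ip (L2 M) (x j) (int_monom (\<gamma> + axis j 1)) else 0)" for k
    using assms L2.ip_zero_right[OF A2_L2, of "x k"] by (simp add: block_form_component)
  thus ?thesis by (simp add: A2_01_ip)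
qed

definition unit_form :: "int^'n \<Rightarrow> 'n \<Rightarrow> 'n form01" where
  "unit_form \<gamma> j = scl (A2_01 M) (of_real (sqrt (wt (\<gamma> + axis j 1)))) (block_form \<gamma> j)"

lemma unit_form_polynomial: "unit_form \<gamma> j \<in> polynomial_forms"
  unfolding unit_form_def block_form_def by (intro polynomial_forms_scl monom_form_polynomial)

lemma block_form_A2_01: "block_form \<gamma> j \<in> vecs (A2_01 M)"
  unfolding block_form_def by (intro polynomial_forms_A2_01 monom_form_polynomial)

lemmas unit_form_A2_01 = polynomial_forms_A2_01[OF unit_form_polynomial]

lemma ip_unit_form_right:
  assumes "x \<in> vecs (A2_01 M)"
  shows "ip (A2_01 M) x (unit_form \<gamma> j) = sqrt (wt (\<gamma> + axis j 1)) * ip (L2 M) (x j) (int_monom (\<gamma> + axis j 1))"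
  unfolding unit_form_def A2_01.ip_scl_right[OF block_form_A2_01 assms] ip_block_form_right[OF assms] by simp

lemma ip_unit_form:
  assumes j: "j \<in> block \<gamma>" and k: "k \<in> block \<delta>"
  shows "ip (A2_01 M) (unit_form \<gamma> j) (unit_form \<delta> k) = (if \<gamma> = \<delta> \<and> j = k then 1 else 0)"
proof -
  note nonneg = mem_blockD[OF j] mem_blockD[OF k]
  have "ip (A2_01 M) (unit_form \<gamma> j) (unit_form \<delta> k) = sqrt (wt (\<gamma> + axis j 1)) *
      (sqrt (wt (\<delta> + axis k 1)) * ip (L2 M) (block_form \<gamma> j k) (int_monom (\<delta> + axis k 1)))"
    unfolding ip_unit_form_right[OF unit_form_A2_01]
    using L2.ip_scl_left[OF A2_L2 int_monom_L2, of "block_form \<gamma> j k" "of_real (sqrt (wt (\<gamma> + axis j 1)))"] block_form_A2_01[of \<gamma> j]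
    by (simp add: unit_form_def)
  also have "ip (L2 M) (block_form \<gamma> j k) (int_monom (\<delta> + axis k 1)) = (if \<gamma> = \<delta> \<and> j = k then of_real (1 / wt (\<gamma> + axis j 1)) else 0)"
    using nonneg by (auto simp: block_form_component ip_int_monom L2.ip_zero_left[OF int_monom_L2])
  finally show ?thesis
    using wt_pos[OF nonneg(1)] by (cases "\<gamma> = \<delta> \<and> j = k") (auto simp flip: of_real_mult mult.assoc)
qed

lemma hnorm_zero_if_orthogonal_to_unit_forms:
  assumes x: "x \<in> vecs (A2_01 M)"
    and orth: "\<And>\<gamma> j. \<gamma> \<in> Gamma_set \<Longrightarrow> j \<in> block \<gamma> \<Longrightarrow> ip (A2_01 M) x (unit_form \<gamma> j) = 0"
  shows "hnorm (A2_01 M) x = 0"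
proof -
  have "hnorm (L2 M) (x j) = 0" for j
  proof (rule A2_eq_zero)
    show "x j \<in> A2 M" using x by simp
    fix \<alpha> :: "nat^'n"
    define \<delta> :: "int^'n" where "\<delta> = (\<chi> i. int (\<alpha> $ i))"
    have \<delta>: "0 \<le> \<delta>" by (simp add: \<delta>_def less_eq_vec_def)
    have "sqrt (wt \<delta>) * ip (L2 M) (x j) (int_monom \<delta>) = 0"
      using orth[OF Gamma_set_of_monomial[OF \<delta>], of j] ip_unit_form_right[OF x, of "\<delta> - axis j 1" j] by simp
    thus "ip (L2 M) (x j) (monom_fun \<alpha>) = 0"
      using wt_pos[OF \<delta>] by (simp add: monom_fun_eq_int_monom \<delta>_def)
  qed
  thus ?thesis using A2_01_hnorm_sq[of x] by simp
qed

text \<open>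
  The matrix of \<open>S\<^sup>*S\<close> on the block of \<open>\<gamma>\<close> in the orthonormal basis \<open>unit_form \<gamma> j\<close>; see
  \<open>ip_S_unit_form\<close>.
\<close>

definition gram :: "int^'n \<Rightarrow> 'n \<Rightarrow> 'n \<Rightarrow> real" where
  "gram \<gamma> j k = sqrt (wt (\<gamma> + axis j 1)) * sqrt (wt (\<gamma> + axis k 1)) *
     (1 / wt (\<gamma> + axis j 1 + axis k 1) - wt \<gamma> / (wt (\<gamma> + axis j 1) * wt (\<gamma> + axis k 1)))"

lemma gram_sym: "gram \<gamma> j k = gram \<gamma> k j"
  by (simp add: gram_def ac_simps)

lemma gram_diagonal:
  assumes "j \<in> block \<gamma>"
  shows "gram \<gamma> j j = wt (\<gamma> + axis j 1) / wt (\<gamma> + axis j 2) - wt \<gamma> / wt (\<gamma> + axis j 1)"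
proof -
  have "\<gamma> + axis j 1 + axis j 1 = \<gamma> + axis j 2" by (simp add: vec_eq_iff axis_def)
  thus ?thesis unfolding gram_def add.assoc[of \<gamma>] using wt_pos[OF mem_blockD[OF assms]]
    by (simp add: right_diff_distrib add.assoc)
qed

end

section \<open>The canonical solution operator on the blocks\<close>

locale canonical_solution = monomial_measure M for M :: "(complex^'n) measure" +
  fixes S :: "'n form01 \<Rightarrow> complex^'n \<Rightarrow> complex"
  assumes S: "canonical_solution_operator M S"
begin

sublocale semi_hilbert_pair "A2_01 M" "L2 M" ..

lemma S_linear: "linear_on polynomial_forms (A2_01 M) (L2 M) S"
  using S by (simp add: canonical_solution_operator_def)

lemma S_L2: "x \<in> polynomial_forms \<Longrightarrow> S x \<in> vecs (L2 M)"
  using S_linear by (simp add: linear_on_def)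

lemma S_block_form_orthogonal: "f \<in> A2 M \<Longrightarrow> ip (L2 M) (S (block_form \<gamma> j)) f = 0"
  using S by (simp add: canonical_solution_operator_def block_form_def)

lemma S_block_form_diff_A2: "S (block_form \<gamma> j) - cnj_monom j (\<gamma> + axis j 1) \<in> A2 M"
  using S by (simp add: canonical_solution_operator_def block_form_def cnj_monom_def int_monom_def)

lemma block_form_polynomial: "block_form \<gamma> j \<in> polynomial_forms"
  unfolding block_form_def by (rule monom_form_polynomial)

text \<open>
  The projection of \<open>zbar\<^sub>j z\<^bsup>\<gamma>+e\<^sub>j\<^esup>\<close> to \<open>A\<^sup>2\<close> is \<open>(c\<^sub>\<gamma> / c\<^bsub>\<gamma>+e\<^sub>j\<^esub>) z\<^sup>\<gamma>\<close>, because both have the same inner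
  products with all monomials. If \<open>\<gamma>\<close> has an entry \<open>-1\<close>, the projection is 0, in accordance with
  \<open>c\<^sub>\<gamma> = 0\<close>.
\<close>

lemma S_block_form_correction:
  assumes j: "j \<in> block \<gamma>"
  shows "heq (L2 M) (S (block_form \<gamma> j) - cnj_monom j (\<gamma> + axis j 1))
    (scl (L2 M) (- of_real (wt \<gamma> / wt (\<gamma> + axis j 1))) (int_monom \<gamma>))"
proof -
  define h where "h = S (block_form \<gamma> j) - cnj_monom j (\<gamma> + axis j 1)"
  define h0 where "h0 = scl (L2 M) (- of_real (wt \<gamma> / wt (\<gamma> + axis j 1))) (int_monom \<gamma>)"
  have h: "h \<in> A2 M" unfolding h_def by (rule S_block_form_diff_A2)
  have h0: "h0 \<in> A2 M" unfolding h0_def L2_simps by (intro scl_A2 int_monom_A2)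
  note nonneg = mem_blockD[OF j]
  have "h - h0 \<in> A2 M"
    using add_A2[OF h scl_A2[OF h0, of "-1"]] by (simp add: plus_fun_def fun_diff_def)
  hence "hnorm (L2 M) (h - h0) = 0"
  proof (rule A2_eq_zero)
    fix \<alpha> :: "nat^'n"
    define \<delta> :: "int^'n" where "\<delta> = (\<chi> i. int (\<alpha> $ i))"
    have \<delta>: "0 \<le> \<delta>" by (simp add: \<delta>_def less_eq_vec_def)
    have 1: "ip (L2 M) h (int_monom \<delta>) = - (if \<gamma> = \<delta> then of_real (1 / wt (\<gamma> + axis j 1)) else 0)"
      unfolding h_def L2.ip_diff_left[OF S_L2[OF block_form_polynomial] cnj_monom_L2[OF nonneg] int_monom_L2]
        S_block_form_orthogonal[OF int_monom_A2] ip_cnj_monom_int_monom[OF nonneg \<delta>] ip_int_monom[OF nonneg add_axis_nonneg[OF \<delta>]]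
      by simp
    have 2: "ip (L2 M) h0 (int_monom \<delta>) = - of_real (wt \<gamma> / wt (\<gamma> + axis j 1)) * ip (L2 M) (int_monom \<gamma>) (int_monom \<delta>)"
      unfolding h0_def by (rule L2.ip_scl_left[OF int_monom_L2 int_monom_L2])
    have "ip (L2 M) h0 (int_monom \<delta>) = ip (L2 M) h (int_monom \<delta>)"
    proof (cases "0 \<le> \<gamma>")
      case True
      thus ?thesis unfolding 1 2 ip_int_monom[OF True \<delta>] using wt_pos[OF True] by (cases "\<gamma> = \<delta>") auto
    next
      case False
      hence "wt \<gamma> = 0" "\<gamma> \<noteq> \<delta>" using \<delta> by (auto simp: coeff_c_def)
      thus ?thesis unfolding 1 2 by simp
    qed
    thus "ip (L2 M) (h - h0) (monom_fun \<alpha>) = 0"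
      using L2.ip_diff_left[OF A2_L2[OF h] A2_L2[OF h0] int_monom_L2, of \<delta>]
      by (simp add: monom_fun_eq_int_monom \<delta>_def)
  qed
  thus ?thesis by (simp add: heq_def h_def h0_def)
qed

text \<open>
  As \<open>S (block_form \<gamma> j)\<close> is orthogonal to \<open>A\<^sup>2\<close>, the second argument may be replaced by
  \<open>zbar\<^sub>k z\<^bsup>\<delta>+e\<^sub>k\<^esup>\<close>. With the formula for the projection in the first argument, only inner products of
  monomials remain, and their exponents agree only if \<open>\<gamma> = \<delta>\<close>.
\<close>

lemma ip_S_block_form:
  assumes j: "j \<in> block \<gamma>" and k: "k \<in> block \<delta>"
  shows "ip (L2 M) (S (block_form \<gamma> j)) (S (block_form \<delta> k)) = (if \<gamma> = \<delta> then of_real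
    (1 / wt (\<gamma> + axis j 1 + axis k 1) - wt \<gamma> / (wt (\<gamma> + axis j 1) * wt (\<gamma> + axis k 1))) else 0)"
proof -
  define s where "s = S (block_form \<gamma> j)"
  define t where "t = S (block_form \<delta> k)"
  define w where "w = cnj_monom j (\<gamma> + axis j 1)"
  define v where "v = cnj_monom k (\<delta> + axis k 1)"
  note \<gamma>j = mem_blockD[OF j] and \<delta>k = mem_blockD[OF k]
  have sL: "s \<in> vecs (L2 M)" and tL: "t \<in> vecs (L2 M)"
    unfolding s_def t_def by (intro S_L2 block_form_polynomial)+
  have wL: "w \<in> vecs (L2 M)" and vL: "v \<in> vecs (L2 M)"
    unfolding w_def v_def by (intro cnj_monom_L2 \<gamma>j \<delta>k)+
  have "ip (L2 M) s t = ip (L2 M) s v"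
    using L2.ip_diff_right[OF tL vL sL] S_block_form_orthogonal[OF S_block_form_diff_A2[of \<delta> k], of \<gamma> j]
    by (simp add: s_def t_def v_def)
  also have "\<dots> = ip (L2 M) w v + ip (L2 M) (s - w) v"
    using L2.ip_diff_left[OF sL wL vL] by simp
  also have "ip (L2 M) (s - w) v = - of_real (wt \<gamma> / wt (\<gamma> + axis j 1)) * ip (L2 M) (int_monom \<gamma>) v"
    unfolding L2.ip_scl_left[OF int_monom_L2 vL, symmetric] s_def w_def
    by (rule L2.heq_ip_cong(1)[OF S_block_form_correction[OF j] _ _ vL])
      (use sL wL L2.scl_closed[OF int_monom_L2] in \<open>auto simp: s_def w_def simp del: L2_simps intro: L2.diff_closed\<close>)
  also have "wt \<gamma> * ip (L2 M) (int_monom \<gamma>) v = (if \<gamma> = \<delta> then wt \<gamma> / wt (\<gamma> + axis k 1) else 0)"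
  proof (cases "0 \<le> \<gamma>")
    case True
    have "ip (L2 M) v (int_monom \<gamma>) = (if \<gamma> = \<delta> then of_real (1 / wt (\<gamma> + axis k 1)) else 0)"
      unfolding v_def ip_cnj_monom_int_monom[OF \<delta>k True] ip_int_monom[OF \<delta>k add_axis_nonneg[OF True]] by auto
    thus ?thesis using L2.ip_cnj[OF vL int_monom_L2] by (cases "\<gamma> = \<delta>") auto
  next
    case False
    hence "wt \<gamma> = 0" by (simp add: coeff_c_def)
    thus ?thesis by auto
  qed
  hence "- of_real (wt \<gamma> / wt (\<gamma> + axis j 1)) * ip (L2 M) (int_monom \<gamma>) v =
      - (if \<gamma> = \<delta> then of_real (wt \<gamma> / (wt (\<gamma> + axis j 1) * wt (\<gamma> + axis k 1))) else 0)"
    by (simp add: field_simps split: if_splits)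
  also have "ip (L2 M) w v = (if \<gamma> = \<delta> then of_real (1 / wt (\<gamma> + axis j 1 + axis k 1)) else 0)"
    unfolding w_def v_def ip_cnj_monom_cnj_monom[OF \<gamma>j \<delta>k] ip_int_monom[OF add_axis_nonneg[OF \<gamma>j] add_axis_nonneg[OF \<delta>k]]
    by (auto simp: algebra_simps)
  finally show ?thesis by (simp add: s_def t_def)
qed

lemma ip_S_unit_form:
  assumes j: "j \<in> block \<gamma>" and k: "k \<in> block \<delta>"
  shows "ip (L2 M) (S (unit_form \<gamma> j)) (S (unit_form \<delta> k)) = (if \<gamma> = \<delta> then of_real (gram \<gamma> j k) else 0)"
proof -
  have Su: "heq (L2 M) (S (unit_form \<gamma> j)) (scl (L2 M) (of_real (sqrt (wt (\<gamma> + axis j 1)))) (S (block_form \<gamma> j)))" for \<gamma> j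
    using S_linear block_form_polynomial unfolding linear_on_def unit_form_def by blast
  note [simp] = S_L2[OF unit_form_polynomial] S_L2[OF block_form_polynomial]
  have scl [simp]: "scl (L2 M) c (S (block_form \<gamma> j)) \<in> vecs (L2 M)" for c \<gamma> j
    by (rule L2.scl_closed) simp
  have "ip (L2 M) (S (unit_form \<gamma> j)) (S (unit_form \<delta> k)) =
      ip (L2 M) (scl (L2 M) (of_real (sqrt (wt (\<gamma> + axis j 1)))) (S (block_form \<gamma> j)))
        (scl (L2 M) (of_real (sqrt (wt (\<delta> + axis k 1)))) (S (block_form \<delta> k)))"
    using L2.heq_ip_cong(1)[OF Su[of \<gamma> j]] L2.heq_ip_cong(2)[OF Su[of \<delta> k]] scl
    by (simp del: L2_simps)
  also have "\<dots> = sqrt (wt (\<gamma> + axis j 1)) * (sqrt (wt (\<delta> + axis k 1)) * ip (L2 M) (S (block_form \<gamma> j)) (S (block_form \<delta> k)))"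
    by (simp add: L2.ip_scl_left L2.ip_scl_right scl del: L2_simps)
  also have "\<dots> = (if \<gamma> = \<delta> then of_real (gram \<gamma> j k) else 0)"
    unfolding ip_S_block_form[OF j k] by (simp add: gram_def)
  finally show ?thesis .
qed

lemma S_sum:
  assumes "finite F" "\<And>i. i \<in> F \<Longrightarrow> x i \<in> polynomial_forms"
  shows "(\<Sum>i\<in>F. scl (A2_01 M) (a i) (x i)) \<in> polynomial_forms"
    and "heq (L2 M) (S (\<Sum>i\<in>F. scl (A2_01 M) (a i) (x i))) (\<Sum>i\<in>F. scl (L2 M) (a i) (S (x i)))"
proof -
  have "(\<Sum>i\<in>F. scl (A2_01 M) (a i) (x i)) \<in> polynomial_forms \<and>
    heq (L2 M) (S (\<Sum>i\<in>F. scl (A2_01 M) (a i) (x i))) (\<Sum>i\<in>F. scl (L2 M) (a i) (S (x i)))"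
    by (rule linear_on_sum[OF S_linear polynomial_forms_zero])
      (fact polynomial_forms_add polynomial_forms_scl assms)+
  thus "(\<Sum>i\<in>F. scl (A2_01 M) (a i) (x i)) \<in> polynomial_forms"
    "heq (L2 M) (S (\<Sum>i\<in>F. scl (A2_01 M) (a i) (x i))) (\<Sum>i\<in>F. scl (L2 M) (a i) (S (x i)))"
    by blast+
qed

lemma agree_on_sum:
  assumes T: "bounded_op (A2_01 M) (L2 M) T"
    and "finite F" "\<And>i. i \<in> F \<Longrightarrow> x i \<in> polynomial_forms"
    and "\<And>i. i \<in> F \<Longrightarrow> heq (L2 M) (T (x i)) (S (x i))"
  shows "heq (L2 M) (T (\<Sum>i\<in>F. scl (A2_01 M) (a i) (x i))) (S (\<Sum>i\<in>F. scl (A2_01 M) (a i) (x i)))"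
proof -
  have "linear_on polynomial_forms (A2_01 M) (L2 M) T"
    using T polynomial_forms_A2_01 unfolding bounded_op_def linear_on_def by blast
  thus ?thesis
    by (rule linear_on_agree_sum[OF _ S_linear polynomial_forms_zero])
      (fact polynomial_forms_add polynomial_forms_scl assms)+
qed

definition eigenform :: "('n \<Rightarrow> 'n \<Rightarrow> real) \<Rightarrow> int^'n \<Rightarrow> 'n \<Rightarrow> 'n form01" where
  "eigenform V \<gamma> a = (\<Sum>k\<in>block \<gamma>. scl (A2_01 M) (of_real (V a k)) (unit_form \<gamma> k))"

lemma eigenform_polynomial: "eigenform V \<gamma> a \<in> polynomial_forms"
  and S_eigenform: "heq (L2 M) (S (eigenform V \<gamma> a)) (\<Sum>k\<in>block \<gamma>. scl (L2 M) (of_real (V a k)) (S (unit_form \<gamma> k)))"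
  unfolding eigenform_def by (rule S_sum; simp add: unit_form_polynomial)+

lemmas eigenform_A2_01 = polynomial_forms_A2_01[OF eigenform_polynomial]

lemma ip_eigenform_right:
  assumes "x \<in> vecs (A2_01 M)"
  shows "ip (A2_01 M) x (eigenform V \<gamma> a) = (\<Sum>k\<in>block \<gamma>. of_real (V a k) * ip (A2_01 M) x (unit_form \<gamma> k))"
  unfolding eigenform_def using assms
  by (subst A2_01.ip_sum_right)
    (simp_all add: A2_01.ip_scl_right unit_form_A2_01 A2_01.scl_closed del: A2_01_simps)

lemma ip_eigenform:
  assumes V: "diagonalizes (block \<gamma>) (gram \<gamma>) (V \<gamma>) \<mu>" and a: "a \<in> block \<gamma>" and b: "b \<in> block \<delta>"
  shows "ip (A2_01 M) (eigenform (V \<gamma>) \<gamma> a) (eigenform (V \<delta>) \<delta> b) = (if \<gamma> = \<delta> \<and> a = b then 1 else 0)"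
proof -
  have "ip (A2_01 M) (eigenform (V \<gamma>) \<gamma> a) (unit_form \<delta> l) = (if \<gamma> = \<delta> then of_real (V \<gamma> a l) else 0)"
    if l: "l \<in> block \<delta>" for l
  proof -
    have "ip (A2_01 M) (eigenform (V \<gamma>) \<gamma> a) (unit_form \<delta> l) =
        (\<Sum>k\<in>block \<gamma>. of_real (V \<gamma> a k) * ip (A2_01 M) (unit_form \<gamma> k) (unit_form \<delta> l))"
      unfolding eigenform_def
      by (subst A2_01.ip_sum_left)
        (simp_all add: A2_01.ip_scl_left unit_form_A2_01 A2_01.scl_closed del: A2_01_simps)
    also have "\<dots> = (\<Sum>k\<in>block \<gamma>. if k = l then (if \<gamma> = \<delta> then of_real (V \<gamma> a l) else 0) else 0)"
      using l by (intro sum.cong) (auto simp: ip_unit_form)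
    also have "\<dots> = (if \<gamma> = \<delta> then of_real (V \<gamma> a l) else 0)"
      using l by auto
    finally show ?thesis .
  qed
  hence "ip (A2_01 M) (eigenform (V \<gamma>) \<gamma> a) (eigenform (V \<delta>) \<delta> b) =
      (\<Sum>l\<in>block \<delta>. of_real (V \<delta> b l) * (if \<gamma> = \<delta> then of_real (V \<gamma> a l) else 0))"
    unfolding ip_eigenform_right[OF eigenform_A2_01] by (intro sum.cong) auto
  also have "\<dots> = (if \<gamma> = \<delta> then of_real (\<Sum>l\<in>block \<gamma>. V \<gamma> b l * V \<gamma> a l) else 0)" by auto
  also have "\<dots> = (if \<gamma> = \<delta> \<and> a = b then 1 else 0)"
    using V a b by (auto simp: diagonalizes_def simp del: of_real_sum)
  finally show ?thesis .
qed

lemma ip_S_eigenform: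
  assumes V: "diagonalizes (block \<gamma>) (gram \<gamma>) (V \<gamma>) \<mu>" and a: "a \<in> block \<gamma>" and b: "b \<in> block \<delta>"
  shows "ip (L2 M) (S (eigenform (V \<gamma>) \<gamma> a)) (S (eigenform (V \<delta>) \<delta> b)) =
    (if \<gamma> = \<delta> \<and> a = b then of_real (\<mu> a) else 0)"
proof -
  define T where "T \<gamma> a = (\<Sum>k\<in>block \<gamma>. scl (L2 M) (of_real (V \<gamma> a k)) (S (unit_form \<gamma> k)))" for \<gamma> a
  have Su [simp]: "scl (L2 M) c (S (unit_form \<gamma> k)) \<in> vecs (L2 M)" "S (unit_form \<gamma> k) \<in> vecs (L2 M)" for c \<gamma> k
    by (intro L2.scl_closed S_L2 unit_form_polynomial)+
  have TL: "T \<gamma> a \<in> vecs (L2 M)" for \<gamma> a unfolding T_def by (intro L2.sum_closed Su)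
  have ST: "heq (L2 M) (S (eigenform (V \<gamma>) \<gamma> a)) (T \<gamma> a)" for \<gamma> a
    unfolding T_def by (rule S_eigenform)
  have SL: "S (eigenform (V \<gamma>) \<gamma> a) \<in> vecs (L2 M)" for \<gamma> a by (intro S_L2 eigenform_polynomial)
  have "ip (L2 M) (S (eigenform (V \<gamma>) \<gamma> a)) (S (eigenform (V \<delta>) \<delta> b)) = ip (L2 M) (T \<gamma> a) (T \<delta> b)"
    using L2.heq_ip_cong(1)[OF ST[of \<gamma> a] SL TL SL[of \<delta> b]] L2.heq_ip_cong(2)[OF ST[of \<delta> b] SL TL TL[of \<gamma> a]]
    by simp
  also have "\<dots> = (\<Sum>j\<in>block \<gamma>. \<Sum>k\<in>block \<delta>.
      of_real (V \<gamma> a j) * (of_real (V \<delta> b k) * ip (L2 M) (S (unit_form \<gamma> j)) (S (unit_form \<delta> k))))"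
  proof -
    have "ip (L2 M) (S (unit_form \<gamma> j)) (T \<delta> b) =
        (\<Sum>k\<in>block \<delta>. of_real (V \<delta> b k) * ip (L2 M) (S (unit_form \<gamma> j)) (S (unit_form \<delta> k)))" for j
      unfolding T_def by (subst L2.ip_sum_right) (simp_all add: L2.ip_scl_right del: L2_simps)
    moreover have "ip (L2 M) (T \<gamma> a) (T \<delta> b) = (\<Sum>j\<in>block \<gamma>. of_real (V \<gamma> a j) * ip (L2 M) (S (unit_form \<gamma> j)) (T \<delta> b))"
      unfolding T_def[of \<gamma> a] by (subst L2.ip_sum_left) (simp_all add: L2.ip_scl_left TL del: L2_simps)
    ultimately show ?thesis by (simp add: sum_distrib_left)
  qed
  also have "\<dots> = (if \<gamma> = \<delta> then of_real (\<Sum>j\<in>block \<gamma>. \<Sum>k\<in>block \<gamma>. V \<gamma> a j * V \<gamma> b k * gram \<gamma> j k) else 0)"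
    by (auto simp: ip_S_unit_form mult.assoc intro!: sum.cong sum.neutral)
  also have "\<dots> = (if \<gamma> = \<delta> \<and> a = b then of_real (\<mu> a) else 0)"
    using V a b by (auto simp: diagonalizes_def simp del: of_real_sum)
  finally show ?thesis .
qed

lemma unit_form_eq_sum_eigenform:
  assumes V: "diagonalizes (block \<gamma>) (gram \<gamma>) V \<mu>" and j: "j \<in> block \<gamma>"
  shows "unit_form \<gamma> j = (\<Sum>a\<in>block \<gamma>. scl (A2_01 M) (of_real (V a j)) (eigenform V \<gamma> a))"
proof (intro ext)
  fix i z
  have sum_apply: "(\<Sum>a\<in>F. f a) i z = (\<Sum>a\<in>F. f a i z)" for F and f :: "'n \<Rightarrow> 'n form01"
    by (induction F rule: infinite_finite_induct) auto
  have "(\<Sum>a\<in>block \<gamma>. scl (A2_01 M) (of_real (V a j)) (eigenform V \<gamma> a)) i z =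
      (\<Sum>a\<in>block \<gamma>. \<Sum>k\<in>block \<gamma>. of_real (V a j * V a k) * unit_form \<gamma> k i z)"
    by (simp add: sum_apply eigenform_def sum_distrib_left mult.assoc)
  also have "\<dots> = (\<Sum>k\<in>block \<gamma>. \<Sum>a\<in>block \<gamma>. of_real (V a j * V a k) * unit_form \<gamma> k i z)"
    by (rule sum.swap)
  also have "\<dots> = (\<Sum>k\<in>block \<gamma>. of_real (\<Sum>a\<in>block \<gamma>. V a j * V a k) * unit_form \<gamma> k i z)"
    by (simp add: sum_distrib_right)
  also have "\<dots> = (\<Sum>k\<in>block \<gamma>. if j = k then unit_form \<gamma> k i z else 0)"
    using V j by (intro sum.cong) (auto simp: diagonalizes_def simp del: of_real_sum)
  also have "\<dots> = unit_form \<gamma> j i z" using j by simp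
  finally show "unit_form \<gamma> j i z = (\<Sum>a\<in>block \<gamma>. scl (A2_01 M) (of_real (V a j)) (eigenform V \<gamma> a)) i z" ..
qed

text \<open>
  The forms \<open>unit_form \<gamma> j\<close> span the polynomial forms algebraically, so finite sums suffice.
\<close>

lemma agree_on_polynomial_forms:
  assumes T: "bounded_op (A2_01 M) (L2 M) T"
    and agree: "\<And>\<gamma> j. \<gamma> \<in> Gamma_set \<Longrightarrow> j \<in> block \<gamma> \<Longrightarrow> heq (L2 M) (T (unit_form \<gamma> j)) (S (unit_form \<gamma> j))"
    and x: "x \<in> polynomial_forms"
  shows "heq (L2 M) (T x) (S x)"
proof -
  have monom: "heq (L2 M) (T (monom_form \<alpha> j)) (S (monom_form \<alpha> j))" for \<alpha> j
  proof -
    define \<delta> :: "int^'n" where "\<delta> = (\<chi> i. int (\<alpha> $ i))"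
    have \<delta>: "0 \<le> \<delta>" by (simp add: \<delta>_def less_eq_vec_def)
    have "monom_form \<alpha> j = block_form (\<delta> - axis j 1) j" by (simp add: block_form_def \<delta>_def)
    also have "\<dots> = (\<Sum>i\<in>{()}. scl (A2_01 M) (of_real (1 / sqrt (wt \<delta>))) (unit_form (\<delta> - axis j 1) j))"
      using wt_pos[OF \<delta>] by (simp add: unit_form_def fun_eq_iff flip: of_real_mult mult.assoc)
    finally show ?thesis
      by (simp only:) (intro agree_on_sum[OF T] finite.intros unit_form_polynomial agree Gamma_set_of_monomial[OF \<delta>])
  qed
  have "\<forall>j. \<exists>F a. finite F \<and> x j = (\<lambda>z. \<Sum>\<alpha>\<in>F. a \<alpha> * monom_fun \<alpha> z)"
    using x unfolding polynomial_forms_def polynomials_def by fast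
  then obtain F a where F: "\<And>j. finite (F j)" "\<And>j. x j = (\<lambda>z. \<Sum>\<alpha>\<in>F j. a j \<alpha> * monom_fun \<alpha> z)"
    by metis
  define I where "I = Sigma UNIV F"
  have I: "finite I" unfolding I_def using F(1) by (intro finite_SigmaI) auto
  have "x = (\<Sum>i\<in>I. scl (A2_01 M) (a (fst i) (snd i)) (monom_form (snd i) (fst i)))"
  proof (intro ext)
    fix k z
    have sum_apply: "(\<Sum>i\<in>G. f i) k z = (\<Sum>i\<in>G. f i k z)" for G and f :: "'n \<times> (nat^'n) \<Rightarrow> 'n form01"
      by (induction G rule: infinite_finite_induct) auto
    have "(\<Sum>i\<in>I. scl (A2_01 M) (a (fst i) (snd i)) (monom_form (snd i) (fst i))) k z =
        (\<Sum>j\<in>UNIV. \<Sum>\<alpha>\<in>F j. a j \<alpha> * monom_form \<alpha> j k z)"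
      unfolding sum_apply I_def using F(1) by (subst sum.Sigma) (auto simp: case_prod_unfold)
    also have "\<dots> = (\<Sum>j\<in>UNIV. if j = k then x k z else 0)"
      by (intro sum.cong) (auto simp: monom_form_def F(2))
    also have "\<dots> = x k z" by simp
    finally show "x k z = (\<Sum>i\<in>I. scl (A2_01 M) (a (fst i) (snd i)) (monom_form (snd i) (fst i))) k z" ..
  qed
  thus ?thesis
    by (simp only:) (intro agree_on_sum[OF T I] monom_form_polynomial monom)
qed

section \<open>Membership of the canonical solution operator in the Schatten class\<close>

text \<open>
  The eigenforms of all blocks, enumerated by the natural numbers, are a complete orthonormal system
  whose images under \<open>S\<close> are orthogonal with squared norms the eigenvalues. An operator in the
  Schatten class extends \<open>S\<close> if and only if it agrees with \<open>S\<close> on these forms.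
\<close>

theorem extends_to_schatten_class_iff:
  assumes p: "p > 0"
  shows "extends_to_schatten_class polynomial_forms (A2_01 M) (L2 M) p S \<longleftrightarrow>
    (\<lambda>\<gamma>. (\<Sum>j\<in>block \<gamma>. gram \<gamma> j j) powr (p / 2)) summable_on Gamma_set"
proof -
  have "\<forall>\<gamma>\<in>Gamma_set. \<exists>V \<mu>. diagonalizes (block \<gamma>) (gram \<gamma>) V \<mu>"
  proof
    fix \<gamma> :: "int^'n" assume "\<gamma> \<in> Gamma_set"
    from symmetric_diagonalizable[of "gram \<gamma>", OF gram_sym block_cases[OF this]]
    show "\<exists>V \<mu>. diagonalizes (block \<gamma>) (gram \<gamma>) V \<mu>" .
  qed
  then obtain V \<mu> where V: "\<And>\<gamma>. \<gamma> \<in> Gamma_set \<Longrightarrow> diagonalizes (block \<gamma>) (gram \<gamma>) (V \<gamma>) (\<mu> \<gamma>)"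
    by metis
  define I where "I = Sigma Gamma_set block"
  have "countable I" unfolding I_def by (intro countable_SIGMA countableI_type countable_finite) auto
  moreover have "infinite I"
  proof
    assume "finite I"
    define d :: "nat \<Rightarrow> int^'n" where "d m = (\<chi> i. int m)" for m
    have d: "0 \<le> d m" for m by (simp add: d_def less_eq_vec_def)
    fix j :: 'n
    have "inj (\<lambda>m. (d m - axis j 1, j))" by (auto simp: inj_on_def d_def vec_eq_iff)
    moreover have "range (\<lambda>m. (d m - axis j 1, j)) \<subseteq> I"
      using Gamma_set_of_monomial[OF d] by (auto simp: I_def)
    ultimately show False using \<open>finite I\<close> finite_subset range_inj_infinite by blast
  qed
  ultimately have "bij_betw (from_nat_into I) UNIV I" by (rule bij_betw_from_nat_into)
  then obtain idx where idx_bij: "bij_betw idx (UNIV :: nat set) I" by blast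
  have idxI: "fst (idx n) \<in> Gamma_set" "snd (idx n) \<in> block (fst (idx n))" for n
    using bij_betwE[OF idx_bij, rule_format, of n] by (auto simp: I_def mem_Sigma_iff)
  have idx_eq: "fst (idx m) = fst (idx n) \<and> snd (idx m) = snd (idx n) \<longleftrightarrow> m = n" for m n
    using bij_betw_imp_inj_on[OF idx_bij] by (metis injD prod_eqI)
  define e where "e n = eigenform (V (fst (idx n))) (fst (idx n)) (snd (idx n))" for n
  define s where "s n = S (e n)" for n
  define \<nu> where "\<nu> i = \<mu> (fst i) (snd i)" for i
  have e_poly: "e n \<in> polynomial_forms" for n unfolding e_def by (rule eigenform_polynomial)
  note e_A2 = polynomial_forms_A2_01[OF e_poly]
  have e: "A2_01.orthogonal_family e (\<lambda>_. 1)"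
    unfolding A2_01.orthogonal_family_def
  proof (intro conjI allI e_A2)
    show "ip (A2_01 M) (e m) (e n) = (if m = n then complex_of_real 1 else 0)" for m n
      unfolding e_def ip_eigenform[where V = V, OF V[OF idxI(1)] idxI(2) idxI(2)] idx_eq by simp
  qed
  have s: "L2.orthogonal_family M s (\<lambda>n. \<nu> (idx n))"
    unfolding L2.orthogonal_family_def
  proof (intro conjI allI)
    show "s n \<in> vecs (L2 M)" for n unfolding s_def by (intro S_L2 e_poly)
    show "ip (L2 M) (s m) (s n) = (if m = n then complex_of_real (\<nu> (idx m)) else 0)" for m n
      unfolding s_def e_def ip_S_eigenform[where V = V, OF V[OF idxI(1)] idxI(2) idxI(2)] idx_eq
      by (simp add: \<nu>_def)
  qed
  have eigenform_e: "\<exists>n. eigenform (V \<gamma>) \<gamma> a = e n" if "\<gamma> \<in> Gamma_set" "a \<in> block \<gamma>" for \<gamma> a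
  proof -
    have "(\<gamma>, a) \<in> idx ` UNIV" using that bij_betw_imp_surj_on[OF idx_bij] by (simp add: I_def)
    then obtain n where "(\<gamma>, a) = idx n" by blast
    hence "eigenform (V \<gamma>) \<gamma> a = e n" unfolding e_def by (metis fst_conv snd_conv)
    thus ?thesis ..
  qed
  have total: "A2_01.total_family e"
    unfolding A2_01.total_family_def
  proof (intro ballI impI hnorm_zero_if_orthogonal_to_unit_forms)
    fix x \<gamma> j
    assume x: "x \<in> vecs (A2_01 M)" "\<forall>n. ip (A2_01 M) x (e n) = 0" and \<gamma>: "\<gamma> \<in> Gamma_set" "j \<in> block \<gamma>"
    have "ip (A2_01 M) x (eigenform (V \<gamma>) \<gamma> a) = 0" if "a \<in> block \<gamma>" for a
      using eigenform_e[OF \<gamma>(1) that] x(2) by auto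
    thus "ip (A2_01 M) x (unit_form \<gamma> j) = 0"
      unfolding unit_form_eq_sum_eigenform[OF V[OF \<gamma>(1)] \<gamma>(2)] using x(1)
      by (subst A2_01.ip_sum_right)
        (simp_all add: A2_01.ip_scl_right eigenform_A2_01 A2_01.scl_closed del: A2_01_simps)
  qed
  have "extends_to_schatten_class polynomial_forms (A2_01 M) (L2 M) p S \<longleftrightarrow>
      (\<exists>T \<in> schatten_class (A2_01 M) (L2 M) p. \<forall>n. heq (L2 M) (T (e n)) (s n))"
    unfolding extends_to_schatten_class_def
  proof (intro bex_cong refl iffI allI ballI)
    fix T n
    assume "\<forall>x\<in>polynomial_forms. heq (L2 M) (T x) (S x)"
    thus "heq (L2 M) (T (e n)) (s n)" using e_poly by (simp add: s_def)
  next
    fix T :: "'n form01 \<Rightarrow> complex^'n \<Rightarrow> complex" and x :: "'n form01"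
    assume T: "T \<in> schatten_class (A2_01 M) (L2 M) p" and Te: "\<forall>n. heq (L2 M) (T (e n)) (s n)"
      and x: "x \<in> polynomial_forms"
    have T': "bounded_op (A2_01 M) (L2 M) T" using T by (simp add: schatten_class_def compact_op_def)
    show "heq (L2 M) (T x) (S x)"
    proof (rule agree_on_polynomial_forms[OF T' _ x])
      fix \<gamma> j assume \<gamma>: "\<gamma> \<in> Gamma_set" "j \<in> block \<gamma>"
      show "heq (L2 M) (T (unit_form \<gamma> j)) (S (unit_form \<gamma> j))"
        unfolding unit_form_eq_sum_eigenform[OF V[OF \<gamma>(1)] \<gamma>(2)]
      proof (rule agree_on_sum[OF T' finite eigenform_polynomial])
        fix a assume "a \<in> block \<gamma>"
        then obtain n where "eigenform (V \<gamma>) \<gamma> a = e n" using eigenform_e[OF \<gamma>(1)] by blast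
        thus "heq (L2 M) (T (eigenform (V \<gamma>) \<gamma> a)) (S (eigenform (V \<gamma>) \<gamma> a))" using Te by (simp add: s_def)
      qed
    qed
  qed
  also have "\<dots> \<longleftrightarrow> summable (\<lambda>n. \<nu> (idx n) powr (p / 2))"
    by (rule schatten_class_iff_summable[OF e total s p])
  also have "\<dots> \<longleftrightarrow> (\<lambda>n. \<nu> (idx n) powr (p / 2)) summable_on UNIV"
    by (simp add: summable_on_UNIV_nonneg_real_iff)
  also have "\<dots> \<longleftrightarrow> (\<lambda>i. \<nu> i powr (p / 2)) summable_on I"
    by (rule summable_on_reindex_bij_betw[OF idx_bij])
  also have "\<dots> \<longleftrightarrow> (\<lambda>\<gamma>. (\<Sum>a\<in>block \<gamma>. \<nu> (\<gamma>, a)) powr (p / 2)) summable_on Gamma_set"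
    unfolding I_def
  proof (rule summable_on_trace_powr_iff)
    fix \<gamma> a assume "\<gamma> \<in> Gamma_set" "a \<in> block \<gamma>"
    hence "(\<gamma>, a) \<in> idx ` UNIV" using bij_betw_imp_surj_on[OF idx_bij] by (simp add: I_def)
    then obtain n where "(\<gamma>, a) = idx n" by blast
    thus "0 \<le> \<nu> (\<gamma>, a)" using L2.orthogonal_family_nonneg[OF s, of n] by simp
  qed (use p in simp)
  also have "\<dots> \<longleftrightarrow> (\<lambda>\<gamma>. (\<Sum>j\<in>block \<gamma>. gram \<gamma> j j) powr (p / 2)) summable_on Gamma_set"
    using diagonalizes_trace[OF V finite] by (intro summable_on_cong) (simp add: \<nu>_def)
  finally show ?thesis .
qed

end

theorem theorem3:
  fixes M :: "(complex^'n) measure" and p :: real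
    and S :: "'n form01 \<Rightarrow> complex^'n \<Rightarrow> complex"
  assumes "sets M = sets borel"
    and "\<And>\<alpha> \<beta>. \<alpha> \<noteq> \<beta> \<Longrightarrow> ip (L2 M) (monom_fun \<alpha>) (monom_fun \<beta>) = 0"
    and "\<And>\<alpha>. integrable M (\<lambda>z. (cmod (monom_fun \<alpha> z))\<^sup>2)"
    and "\<And>\<alpha>. 0 < (\<integral>z. (cmod (monom_fun \<alpha> z))\<^sup>2 \<partial>M)"
    and "canonical_solution_operator M S"
    and "p > 0"
  shows "extends_to_schatten_class polynomial_forms (A2_01 M) (L2 M) p S \<longleftrightarrow>
    (\<lambda>\<gamma>. (\<Sum>j | 0 \<le> \<gamma> + axis j 1.
        coeff_c M (\<gamma> + axis j 1) / coeff_c M (\<gamma> + axis j 2) - coeff_c M \<gamma> / coeff_c M (\<gamma> + axis j 1)) powr (p / 2))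
      summable_on Gamma_set"
proof -
  interpret canonical_solution M S
    using assms(1-5) by unfold_locales
  have "(\<Sum>j\<in>block \<gamma>. gram \<gamma> j j) = (\<Sum>j | 0 \<le> \<gamma> + axis j 1.
      coeff_c M (\<gamma> + axis j 1) / coeff_c M (\<gamma> + axis j 2) - coeff_c M \<gamma> / coeff_c M (\<gamma> + axis j 1))" for \<gamma>
    by (intro sum.cong gram_diagonal) (simp_all add: block_def)
  thus ?thesis using extends_to_schatten_class_iff[OF assms(6)] by simp
qed

end
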